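(* Let $p$ be a prime, $\rho_1,\rho_2\in(0,1)$, $c\in\mathbb{R}$, $M=\begin{bmatrix}\rho_1^{-1} & c\\ 0 & \rho_2^{-1}\end{bmatrix}$, and let $D=\{d_0,d_1,\dots,d_{p-1}\}\subset\mathbb{Z}^2$ be a set of $p$ distinct vectors with $d_0=(0,0)^*$, $d_1=(d_{1,1},0)^*$, $d_{1,1}\neq0$, such that $\mathcal{Z}(\widehat{\delta}_D)=\bigcup_{j=1}^{p-1}\left(\frac{j\bm{a}}{p}+\mathbb{Z}^2\right)$ for some $\bm{a}=(a_1,a_2)^*\in\mathcal{E}_p$. Let $\mu_{M,D}$ be the associated self-affine measure, let $E_{\bm{a}}=\left\{\frac{h}{l}: la_2-ha_1\in\mathbb{Z}\setminus p\mathbb{Z},\ \gcd(h,l)=1\right\}\cup\{0\}$ and, when $\rho_1\ne\rho_2$, put $c''=\frac{c}{\rho_1^{-1}-\rho_2^{-1}}$. Then $\mu_{M,D}$ is a spectral measure if and only if one of the following conditions holds: (i) $\rho_1\neq\rho_2$, $\rho_1^{-1}\in p\mathbb{Z}$, and $c''\in\mathbb{Q}\setminus E_{\bm{a}}$. (ii) $\rho_1\neq\rho_2$, $\rho_1^{-1},\rho_2^{-1}\in p\mathbb{Z}$, and $c''=\frac{s}{t}\in E_{\bm{a}}$ with $\gcd(s,t)=1$, $t\in p^{\ell}(\mathbb{Z}\setminus p\mathbb{Z})$ and $p^{\ell+1}\mid(\rho_1^{-1}-\rho_2^{-1})$ for some integer $\ell\ge0$. (iii) $\rho_1=\rho_2$,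 $\rho_1^{-1}\in p\mathbb{Z}$ and $c\in\left\{\frac{t}{s}: t\in p\mathbb{Z},\ \gcd(s,t)=1\right\}\cup\{0\}$.
   Context: In the definition of $E_{\bm a}$, $h,l$ are integers with $l\neq0$; in (ii) and (iii) $s,t$ are integers with nonzero denominator. $v^*$ denotes the (conjugate) transpose, so $(i_1,i_2)^*$ is a column vector. $\mathcal{E}_p=\{(i_1,i_2)^*: i_1,i_2\in\{1,\dots,p-1\}\}$. For a finite set $E\subset\mathbb{R}^2$, $\delta_E=\frac{1}{\#E}\sum_{e\in E}\delta_e$, where $\delta_e$ is the Dirac measure at $e$. For a compactly supported Borel probability measure $\mu$ on $\mathbb{R}^2$, $\widehat{\mu}(\xi)=\int e^{-2\pi i\langle\xi,x\rangle}\,d\mu(x)$, $\xi\in\mathbb{R}^2$; $\mathcal{Z}(f)$ is the set of zeros of $f$ in $\mathbb{R}^2$. The self-affine measure $\mu_{M,D}$ is the unique Borel probability measure satisfying $\mu=\frac{1}{\#D}\sum_{d\in D}\mu\circ\varphi_d^{-1}$ with $\varphi_d(x)=M^{-1}(x+d)$. A compactly supported Borel probability measure $\mu$ is a spectral measure if there is a countable $\Lambda\subset\mathbb{R}^2$ (a spectrum of $\mu$) such that $\{e^{-2\pi i\langle\lambda,x\rangle}:\lambda\in\Lambda\}$ is an orthonormal basis of $L^2(\mu)$. *)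

theory Defs
  imports "HOL-Probability.Probability"
begin

definition fourier_exp :: "'a::euclidean_space \<Rightarrow> 'a \<Rightarrow> complex" where
  "fourier_exp \<xi> x = exp (- 2 * of_real pi * \<i> * of_real (\<xi> \<bullet> x))"

definition fourier_transform :: "'a::euclidean_space measure \<Rightarrow> 'a \<Rightarrow> complex" where
  "fourier_transform \<mu> \<xi> = (LINT x|\<mu>. fourier_exp \<xi> x)"

definition zero_set :: "('a \<Rightarrow> complex) \<Rightarrow> 'a set" where
  "zero_set f = {\<xi>. f \<xi> = 0}"

text \<open>The library's uniform counting measure on \<open>E\<close> lives on the power set of \<open>E\<close>; it is transported
  to a Borel measure on the whole space. See \<open>emeasure_mean_dirac\<close> for the usual formula.\<close>

definition mean_dirac :: "'a::euclidean_space set \<Rightarrow> 'a measure" where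
  "mean_dirac E = distr (uniform_count_measure E) borel (\<lambda>x. x)"

lemma emeasure_mean_dirac:
  assumes "finite E" and "E \<noteq> {}" and "A \<in> sets borel"
  shows "emeasure (mean_dirac E) A = (\<Sum>e\<in>E. emeasure (return borel e) A) / of_nat (card E)"
proof -
  have "emeasure (mean_dirac E) A = emeasure (uniform_count_measure E) (A \<inter> E)"
    unfolding mean_dirac_def using assms
    by (subst emeasure_distr) (auto simp: space_uniform_count_measure sets_uniform_count_measure measurable_def)
  also have "\<dots> = of_nat (card (A \<inter> E)) / of_nat (card E)"
    using assms by (subst emeasure_uniform_count_measure)
      (auto simp: divide_ennreal[symmetric] ennreal_of_nat_eq_real_of_nat card_gt_0_iff)
  also have "(of_nat (card (A \<inter> E)) :: ennreal) = (\<Sum>e\<in>E. emeasure (return borel e) A)"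
    using assms by (simp add: emeasure_return indicator_def sum.If_cases Int_commute)
  finally show ?thesis .
qed

definition self_affine_measure :: "real^'n^'n \<Rightarrow> (real^'n) set \<Rightarrow> (real^'n) measure \<Rightarrow> bool" where
  "self_affine_measure M D \<mu> \<longleftrightarrow>
     prob_space \<mu> \<and> sets \<mu> = sets borel \<and>
     (\<forall>A\<in>sets borel. emeasure \<mu> A =
        (\<Sum>d\<in>D. emeasure (distr \<mu> borel (\<lambda>x. matrix_inv M *v (x + d))) A) / of_nat (card D))"

text \<open>Functions, not classes modulo equality almost everywhere, represent the elements of $L^2$.\<close>

definition L2 :: "'a measure \<Rightarrow> ('a \<Rightarrow> complex) set" where
  "L2 M = {f \<in> borel_measurable M. integrable M (\<lambda>x. (cmod (f x))\<^sup>2)}"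

definition L2_inner :: "'a measure \<Rightarrow> ('a \<Rightarrow> complex) \<Rightarrow> ('a \<Rightarrow> complex) \<Rightarrow> complex" where
  "L2_inner M f g = (LINT x|M. f x * cnj (g x))"

definition L2_norm :: "'a measure \<Rightarrow> ('a \<Rightarrow> complex) \<Rightarrow> real" where
  "L2_norm M f = sqrt (LINT x|M. (cmod (f x))\<^sup>2)"

text \<open>An orthonormal family whose finite linear combinations are dense.\<close>

definition orthonormal_basis_L2 :: "'a measure \<Rightarrow> 'i set \<Rightarrow> ('i \<Rightarrow> 'a \<Rightarrow> complex) \<Rightarrow> bool" where
  "orthonormal_basis_L2 M I \<phi> \<longleftrightarrow>
     (\<forall>i\<in>I. \<phi> i \<in> L2 M) \<and>
     (\<forall>i\<in>I. \<forall>j\<in>I. L2_inner M (\<phi> i) (\<phi> j) = (if i = j then 1 else 0)) \<and>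
     (\<forall>f\<in>L2 M. \<forall>\<epsilon>>0. \<exists>F u. finite F \<and> F \<subseteq> I \<and>
        L2_norm M (\<lambda>x. f x - (\<Sum>i\<in>F. u i * \<phi> i x)) < \<epsilon>)"

definition is_spectrum :: "'a::euclidean_space measure \<Rightarrow> 'a set \<Rightarrow> bool" where
  "is_spectrum \<mu> \<Lambda> \<longleftrightarrow> countable \<Lambda> \<and> orthonormal_basis_L2 \<mu> \<Lambda> fourier_exp"

definition compactly_supported :: "'a::euclidean_space measure \<Rightarrow> bool" where
  "compactly_supported \<mu> \<longleftrightarrow> (\<exists>K. compact K \<and> emeasure \<mu> (- K) = 0)"

definition spectral_measure :: "'a::euclidean_space measure \<Rightarrow> bool" where
  "spectral_measure \<mu> \<longleftrightarrow>
     prob_space \<mu> \<and> sets \<mu> = sets borel \<and> compactly_supported \<mu> \<and> (\<exists>\<Lambda>. is_spectrum \<mu> \<Lambda>)"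

definition integer_lattice :: "(real^'n) set" where
  "integer_lattice = {x. \<forall>i. x $ i \<in> \<int>}"

definition calE :: "nat \<Rightarrow> (real^2) set" where
  "calE p = {vector [real i, real j] | i j. i \<in> {1..p-1} \<and> j \<in> {1..p-1}}"

text \<open>The set of integer multiples of \<open>m\<close>, as real numbers.\<close>

definition multiples :: "nat \<Rightarrow> real set" where
  "multiples m = range (\<lambda>k::int. real m * of_int k)"

definition E_set :: "nat \<Rightarrow> real^2 \<Rightarrow> real set" where
  "E_set p a = {of_int h / of_int l | h l :: int. l \<noteq> 0 \<and>
       of_int l * a $ 2 - of_int h * a $ 1 \<in> \<int> - multiples p \<and> coprime h l} \<union> {0}"

definition upper_triangular :: "real \<Rightarrow> real \<Rightarrow> real \<Rightarrow> real^2^2" where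
  "upper_triangular \<rho>1 \<rho>2 c = vector [vector [inverse \<rho>1, c], vector [0, inverse \<rho>2]]"

end

theory Submission imports Defs "HOL-Computational_Algebra.Polynomial_Factorial" begin

text \<open>Let \<open>\<phi>\<close> be the Fourier transform of \<open>\<mu>\<close> and \<open>m\<close> that of the uniform measure on the digits. Let \<open>T\<close> be the
  transpose of \<open>M\<close>, \<open>S\<close> its inverse, and \<open>b\<close>, \<open>\<beta>\<close> the diagonal entries of \<open>M\<close>. Self-affinity reads
  \<open>\<phi> \<xi> = m (S \<xi>) * \<phi> (S \<xi>)\<close>, so \<open>\<phi>\<close> is the infinite product of the factors \<open>m (S\<^sup>k \<xi>)\<close> and vanishes
  exactly at the points \<open>T\<^sup>k z\<close> with \<open>k \<ge> 1\<close> and \<open>m z = 0\<close>; here \<open>k\<close> is called the level. The zeros of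
  \<open>m\<close> are the nonzero multiples of \<open>a/p\<close> modulo the integer lattice. There are as many classes of
  multiples as digits, so the squares of \<open>|m|\<close> at the \<open>p\<close> translates of a point by them add up to one.
  A countable set is a spectrum if and only if its nonzero differences are zeros of \<open>\<phi>\<close> and the
  squares of \<open>|\<phi> (\<xi> + v)|\<close> sum to one for every \<open>\<xi>\<close>. The first condition alone bounds the sum by one
  (Bessel's inequality).

  Sufficiency. A spectrum is built level by level inside a set \<open>G\<close> of integer points that is invariant
  under \<open>T\<close> (\<open>spectral_from_lattice\<close>). The one thing to check is that \<open>\<phi>\<close> does not vanish on a
  whole coset of \<open>G\<close>. If the slope \<open>c''\<close> of the eigenvector of \<open>T\<close> for \<open>b\<close> is that of \<open>a\<close> modulo \<open>p\<close>, all
  happens on one line, where \<open>T\<close> is multiplication by \<open>b\<close> (\<open>spectral_on_line\<close>). If both diagonal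
  entries are multiples of \<open>p\<close> and \<open>c\<close> is a fraction with numerator divisible by \<open>p\<close>, then \<open>G\<close> is a
  sublattice of the plane (\<open>spectral_on_plane\<close>).

  Necessity. Multiplied by \<open>p\<close>, the first coordinate of a difference of level \<open>k\<close> is \<open>n b\<^sup>k\<close> with \<open>n\<close>
  prime to \<open>p\<close>. All levels occur (\<open>all_levels_occur\<close>), so there are infinitely many frequencies, and by a
  pigeonhole argument modulo \<open>p\<close> the number \<open>b\<close> cannot be a root of an integer polynomial whose extreme
  coefficients are prime to \<open>p\<close> (\<open>no_unit_polynomial\<close>). The relations between the sides of triangles of
  frequencies are such polynomials unless \<open>b\<close> is rational. Then \<open>b = s/q\<close> with \<open>p\<close> dividing \<open>s\<close>. If \<open>q\<close> were
  greater than one, a difference of level \<open>k\<close> would be of size at least a constant times \<open>s\<^sup>k\<close>, whereas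
  \<open>T\<close> only stretches by \<open>b\<close>. So sparse a set misses part of the mass: far from the origin \<open>\<phi>\<close> is small,
  since powers of a fraction are seldom all close to integers (\<open>eigenfunctional_decay\<close>, \<open>no_fast_gaps\<close>).
  Hence \<open>b\<close> is an integer multiple of \<open>p\<close> (\<open>b_multiple_of_p\<close>).

  For such \<open>b\<close> the frequencies that agree with a given one up to level one form, after rescaling by \<open>S\<close>,
  again a set of integer points with the properties of a spectrum at generic points (\<open>tight_subtree\<close>).
  Induction gives zeros \<open>z\<close> of \<open>m\<close> for which any prescribed number of the points \<open>T z, T\<^sup>2 z, \<dots>\<close> are
  integral. The second coordinates of the first three of them carry all arithmetic conditions. If
  \<open>\<beta> = b\<close>, they determine the shape of \<open>c\<close>. Otherwise they show that \<open>c''\<close> is rational, and that \<open>\<beta>\<close>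
  is rational as well unless \<open>c''\<close> has the slope of \<open>a\<close> modulo \<open>p\<close>. If \<open>c'' = s/t\<close> does not have this
  slope, \<open>t z\<^sub>2 - s z\<^sub>1\<close> is an eigenfunctional of \<open>T\<close> for \<open>\<beta>\<close> whose values on the zeros of \<open>m\<close> have
  numerators prime to \<open>p\<close>, and \<open>\<beta>\<close> is treated like \<open>b\<close> before (\<open>necessary_beta\<close>).\<close>

section \<open>Characters and Fourier transforms of probability measures\<close>

abbreviation borel_prob :: "'a::euclidean_space measure \<Rightarrow> bool" where
  "borel_prob \<mu> \<equiv> prob_space \<mu> \<and> sets \<mu> = sets borel"

lemma fourier_exp_cis: "fourier_exp \<xi> x = cis (- 2 * pi * (\<xi> \<bullet> x))"
  unfolding fourier_exp_def cis_conv_exp by (simp add: algebra_simps)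

lemma norm_fourier_exp [simp]: "cmod (fourier_exp \<xi> x) = 1"
  by (simp add: fourier_exp_cis)

lemma fourier_exp_0_left [simp]: "fourier_exp 0 x = 1"
  and fourier_exp_0_right [simp]: "fourier_exp \<xi> 0 = 1"
  by (simp_all add: fourier_exp_cis)

lemma fourier_exp_add_left: "fourier_exp (\<xi> + \<eta>) x = fourier_exp \<xi> x * fourier_exp \<eta> x"
  by (simp add: fourier_exp_cis cis_mult inner_add_left algebra_simps)

lemma fourier_exp_add_right: "fourier_exp \<xi> (x + y) = fourier_exp \<xi> x * fourier_exp \<xi> y"
  by (simp add: fourier_exp_cis cis_mult inner_add_right algebra_simps)

lemma fourier_exp_cnj: "cnj (fourier_exp \<xi> x) = fourier_exp (- \<xi>) x"
  by (simp add: fourier_exp_cis cis_cnj)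

lemma fourier_exp_mult_cnj: "fourier_exp \<xi> x * cnj (fourier_exp \<eta> x) = fourier_exp (\<xi> - \<eta>) x"
  by (metis fourier_exp_add_left fourier_exp_cnj diff_conv_add_uminus)

lemma fourier_exp_Ints: "\<xi> \<bullet> x \<in> \<int> \<Longrightarrow> fourier_exp \<xi> x = 1"
proof -
  assume "\<xi> \<bullet> x \<in> \<int>"
  then obtain k :: int where "\<xi> \<bullet> x = k" by (auto elim: Ints_cases)
  moreover have "cis (- (2 * pi * of_int k)) = 1"
    using cis_multiple_2pi[of "- real_of_int k"] by simp
  ultimately show ?thesis by (simp add: fourier_exp_cis)
qed

lemma fourier_exp_eq_1: "fourier_exp \<xi> x = 1 \<longleftrightarrow> \<xi> \<bullet> x \<in> \<int>"
proof
  assume "fourier_exp \<xi> x = 1"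
  hence "exp (- 2 * of_real pi * \<i> * of_real (\<xi> \<bullet> x)) = 1" by (simp add: fourier_exp_def)
  then obtain n :: int where "- 2 * pi * (\<xi> \<bullet> x) = of_int (2 * n) * pi"
    by (auto simp: exp_eq_1)
  hence "pi * (\<xi> \<bullet> x) = pi * of_int (- n)" by (simp add: algebra_simps)
  hence "\<xi> \<bullet> x = of_int (- n)" by (simp only: mult_cancel_left pi_neq_zero simp_thms)
  thus "\<xi> \<bullet> x \<in> \<int>" by (metis Ints_of_int)
qed (rule fourier_exp_Ints)

lemma continuous_on_fourier_exp [continuous_intros]: "continuous_on A (fourier_exp \<xi>)"
  unfolding fourier_exp_def by (intro continuous_intros)

lemma isCont_fourier_exp_left: "isCont (\<lambda>\<xi>. fourier_exp \<xi> x) \<eta>"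
  unfolding fourier_exp_def by (intro continuous_intros)

lemma borel_measurable_fourier_exp [measurable]: "fourier_exp \<xi> \<in> borel_measurable borel"
  by (intro borel_measurable_continuous_onI continuous_intros)

lemma integrable_bounded_borel:
  fixes f :: "'a::euclidean_space \<Rightarrow> complex"
  assumes "borel_prob \<mu>" and [measurable]: "f \<in> borel_measurable borel" and "\<And>x. cmod (f x) \<le> B"
  shows "integrable \<mu> f"
proof -
  interpret prob_space \<mu> using assms by auto
  have [measurable_cong]: "sets \<mu> = sets borel" using assms by auto
  show ?thesis by (rule integrable_const_bound[where B = B]) (use assms in auto)
qed

lemma integrable_fourier_exp: "borel_prob \<mu> \<Longrightarrow> integrable \<mu> (fourier_exp \<xi>)"
  by (rule integrable_bounded_borel[where B = 1]) auto

lemma fourier_transform_0 [simp]: "borel_prob \<mu> \<Longrightarrow> fourier_transform \<mu> 0 = 1"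
  by (simp add: fourier_transform_def prob_space.prob_space)

lemma norm_fourier_transform_le: 
  assumes "borel_prob \<mu>" shows "cmod (fourier_transform \<mu> \<xi>) \<le> 1"
proof -
  have "cmod (fourier_transform \<mu> \<xi>) \<le> (LINT x|\<mu>. cmod (fourier_exp \<xi> x))"
    unfolding fourier_transform_def by (rule integral_norm_bound)
  also have "\<dots> = 1" using assms by (simp add: prob_space.prob_space)
  finally show ?thesis .
qed

lemma fourier_transform_uminus: "fourier_transform \<mu> (- \<xi>) = cnj (fourier_transform \<mu> \<xi>)"
  unfolding fourier_transform_def using Bochner_Integration.integral_cnj[of \<mu> "fourier_exp \<xi>"]
  by (simp add: fourier_exp_cnj)

lemma continuous_fourier_transform:
  assumes "borel_prob \<mu>"
  shows "continuous_on A (fourier_transform \<mu>)"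
proof -
  interpret prob_space \<mu> using assms by auto
  have [measurable_cong]: "sets \<mu> = sets borel" using assms by auto
  have "isCont (fourier_transform \<mu>) \<eta>" for \<eta>
    unfolding continuous_at_sequentially comp_def fourier_transform_def
  proof (intro allI impI)
    fix u assume u: "u \<longlonglongrightarrow> \<eta>"
    show "(\<lambda>n. LINT x|\<mu>. fourier_exp (u n) x) \<longlonglongrightarrow> (LINT x|\<mu>. fourier_exp \<eta> x)"
    proof (rule integral_dominated_convergence[where w = "\<lambda>_. 1"])
      show "AE x in \<mu>. (\<lambda>n. fourier_exp (u n) x) \<longlonglongrightarrow> fourier_exp \<eta> x"
        by (rule AE_I2) (rule isCont_tendsto_compose[OF isCont_fourier_exp_left u])
    qed auto
  qed
  thus ?thesis by (simp add: continuous_at_imp_continuous_on)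
qed

lemma L2_inner_fourier_exp:
  "L2_inner \<mu> (fourier_exp v) (fourier_exp \<eta>) = fourier_transform \<mu> (v - \<eta>)"
  by (simp add: L2_inner_def fourier_transform_def fourier_exp_mult_cnj)

text \<open>Pythagoras for an orthogonal family of characters. Both Bessel's inequality and the
  approximation of a character by a spectrum are read off from it.\<close>

lemma character_approximation:
  fixes F :: "'a::euclidean_space set"
  assumes \<mu>: "borel_prob \<mu>" and F: "finite F"
    and orth: "\<And>v w. v \<in> F \<Longrightarrow> w \<in> F \<Longrightarrow> v \<noteq> w \<Longrightarrow> fourier_transform \<mu> (v - w) = 0"
  shows "(LINT x|\<mu>. (cmod (fourier_exp \<eta> x - (\<Sum>v\<in>F. u v * fourier_exp v x)))\<^sup>2)
    = (1 - (\<Sum>v\<in>F. (cmod (fourier_transform \<mu> (\<eta> - v)))\<^sup>2))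
      + (\<Sum>v\<in>F. (cmod (u v - fourier_transform \<mu> (\<eta> - v)))\<^sup>2)"
proof -
  let ?e = fourier_exp and ?T = "fourier_transform \<mu>"
  have [measurable_cong]: "sets \<mu> = sets borel" using \<mu> by auto
  have int: "integrable \<mu> (?e \<xi>)" for \<xi> using \<mu> by (rule integrable_fourier_exp)
  have pt: "complex_of_real ((cmod (?e \<eta> x - (\<Sum>v\<in>F. u v * ?e v x)))\<^sup>2)
      = ?e 0 x - (\<Sum>v\<in>F. cnj (u v) * ?e (\<eta> - v) x) - (\<Sum>v\<in>F. u v * ?e (v - \<eta>) x)
       + (\<Sum>v\<in>F. \<Sum>w\<in>F. u v * cnj (u w) * ?e (v - w) x)" for x
  proof -
    have 1: "?e \<eta> x * cnj (\<Sum>v\<in>F. u v * ?e v x) = (\<Sum>v\<in>F. cnj (u v) * ?e (\<eta> - v) x)"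
      unfolding cnj_sum sum_distrib_left fourier_exp_mult_cnj[symmetric] by (simp add: mult_ac)
    have 2: "(\<Sum>v\<in>F. u v * ?e v x) * cnj (?e \<eta> x) = (\<Sum>v\<in>F. u v * ?e (v - \<eta>) x)"
      unfolding sum_distrib_right fourier_exp_mult_cnj[symmetric] by (simp add: mult_ac)
    have 3: "(\<Sum>v\<in>F. u v * ?e v x) * cnj (\<Sum>v\<in>F. u v * ?e v x)
        = (\<Sum>v\<in>F. \<Sum>w\<in>F. u v * cnj (u w) * ?e (v - w) x)"
      unfolding cnj_sum sum_product fourier_exp_mult_cnj[symmetric] by (simp add: mult_ac)
    have 4: "?e \<eta> x * cnj (?e \<eta> x) = ?e 0 x" by (simp add: fourier_exp_mult_cnj)
    show ?thesis unfolding complex_norm_square complex_cnj_diff 1[symmetric] 2[symmetric] 3[symmetric] 4[symmetric]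
      by (simp only: algebra_simps)
  qed
  have intg: "integrable \<mu> (\<lambda>x. (\<Sum>v\<in>F. c v * ?e (k v) x))" for c k
    by (intro Bochner_Integration.integrable_sum integrable_mult_right int)
  have intg2: "integrable \<mu> (\<lambda>x. (\<Sum>v\<in>F. \<Sum>w\<in>F. c v w * ?e (k v w) x))" for c k
    by (intro Bochner_Integration.integrable_sum integrable_mult_right int)
  have "complex_of_real (LINT x|\<mu>. (cmod (?e \<eta> x - (\<Sum>v\<in>F. u v * ?e v x)))\<^sup>2)
     = ?T 0 - (\<Sum>v\<in>F. cnj (u v) * ?T (\<eta> - v)) - (\<Sum>v\<in>F. u v * ?T (v - \<eta>))
       + (\<Sum>v\<in>F. \<Sum>w\<in>F. u v * cnj (u w) * ?T (v - w))"
    unfolding integral_complex_of_real[symmetric] pt fourier_transform_def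
    by (simp only: Bochner_Integration.integral_add Bochner_Integration.integral_diff
        Bochner_Integration.integral_sum integral_mult_right_zero int intg intg2
        Bochner_Integration.integrable_diff Bochner_Integration.integrable_add integrable_mult_right
        Bochner_Integration.integrable_sum)
  also have "(\<Sum>v\<in>F. \<Sum>w\<in>F. u v * cnj (u w) * ?T (v - w)) = (\<Sum>v\<in>F. u v * cnj (u v))"
  proof (rule sum.cong[OF refl])
    fix v assume l: "v \<in> F"
    have "(\<Sum>w\<in>F. u v * cnj (u w) * ?T (v - w)) = (\<Sum>w\<in>F. if w = v then u v * cnj (u v) else 0)"
      by (rule sum.cong[OF refl]) (use orth l \<mu> in auto)
    thus "(\<Sum>w\<in>F. u v * cnj (u w) * ?T (v - w)) = u v * cnj (u v)" using l F by simp
  qed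
  also have "(\<Sum>v\<in>F. u v * ?T (v - \<eta>)) = (\<Sum>v\<in>F. u v * cnj (?T (\<eta> - v)))"
    by (simp flip: fourier_transform_uminus)
  also have "?T 0 = 1" using \<mu> by simp
  also have "1 - (\<Sum>v\<in>F. cnj (u v) * ?T (\<eta> - v)) - (\<Sum>v\<in>F. u v * cnj (?T (\<eta> - v))) + (\<Sum>v\<in>F. u v * cnj (u v))
    = (1 - (\<Sum>v\<in>F. ?T (\<eta> - v) * cnj (?T (\<eta> - v)))) + (\<Sum>v\<in>F. (u v - ?T (\<eta> - v)) * cnj (u v - ?T (\<eta> - v)))"
    by (simp add: algebra_simps sum.distrib sum_subtractf)
  also have "\<dots> = complex_of_real ((1 - (\<Sum>v\<in>F. (cmod (?T (\<eta> - v)))\<^sup>2)) + (\<Sum>v\<in>F. (cmod (u v - ?T (\<eta> - v)))\<^sup>2))"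
    by (simp only: of_real_add of_real_diff of_real_1 of_real_sum complex_norm_square)
  finally show ?thesis by (simp only: of_real_eq_iff)
qed

lemma cmod_fourier_transform_uminus: "cmod (fourier_transform \<mu> (- \<xi>)) = cmod (fourier_transform \<mu> \<xi>)"
  by (simp add: fourier_transform_uminus)

lemma Bessel_characters:
  fixes F :: "'a::euclidean_space set"
  assumes "borel_prob \<mu>" "finite F"
    and "\<And>v w. v \<in> F \<Longrightarrow> w \<in> F \<Longrightarrow> v \<noteq> w \<Longrightarrow> fourier_transform \<mu> (v - w) = 0"
  shows "(\<Sum>v\<in>F. (cmod (fourier_transform \<mu> (\<xi> + v)))\<^sup>2) \<le> 1"
proof -
  have "0 \<le> (LINT x|\<mu>. (cmod (fourier_exp (-\<xi>) x - (\<Sum>v\<in>F. fourier_transform \<mu> (-\<xi>-v) * fourier_exp v x)))\<^sup>2)"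
    by (intro integral_nonneg_AE) auto
  also have "\<dots> = 1 - (\<Sum>v\<in>F. (cmod (fourier_transform \<mu> (-\<xi> - v)))\<^sup>2)"
    by (subst character_approximation[OF assms]) auto
  also have "\<dots> = 1 - (\<Sum>v\<in>F. (cmod (fourier_transform \<mu> (- (\<xi> + v))))\<^sup>2)" by (simp only: minus_add_distrib diff_conv_add_uminus)
  finally show ?thesis by (simp only: cmod_fourier_transform_uminus)
qed

text \<open>The functions to which Bessel's inequality applies: Fourier transforms of probability
  measures. Partial products and products with one factor left out are again of this kind.\<close>

definition char_fun :: "('a::euclidean_space \<Rightarrow> complex) \<Rightarrow> bool" where
  "char_fun \<phi> \<longleftrightarrow> (\<exists>\<mu>. borel_prob \<mu> \<and> \<phi> = fourier_transform \<mu>)"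

lemma char_funI: "borel_prob \<mu> \<Longrightarrow> char_fun (fourier_transform \<mu>)"
  by (auto simp: char_fun_def)

lemma Bessel_char_fun:
  fixes F :: "'a::euclidean_space set"
  assumes "char_fun \<phi>" "finite F"
    and "\<And>v w. v \<in> F \<Longrightarrow> w \<in> F \<Longrightarrow> v \<noteq> w \<Longrightarrow> \<phi> (v - w) = 0"
  shows "(\<Sum>v\<in>F. (cmod (\<phi> (\<xi> + v)))\<^sup>2) \<le> 1"
  using assms Bessel_characters unfolding char_fun_def by blast

lemma fourier_transform_distr_adjoint:
  fixes L L' :: "'a::euclidean_space \<Rightarrow> 'a"
  assumes \<mu>: "borel_prob \<mu>" and [measurable]: "L' \<in> borel_measurable borel"
    and adj: "\<And>\<xi> x. L \<xi> \<bullet> x = \<xi> \<bullet> L' x"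
  shows "fourier_transform (distr \<mu> borel L') \<xi> = fourier_transform \<mu> (L \<xi>)"
proof -
  have [measurable_cong]: "sets \<mu> = sets borel" using \<mu> by auto
  have e: "fourier_exp (L \<xi>) x = fourier_exp \<xi> (L' x)" for \<xi> x by (simp add: fourier_exp_def adj)
  show ?thesis
    unfolding fourier_transform_def by (simp add: integral_distr flip: e)
qed

lemma char_fun_comp:
  fixes L L' :: "'a::euclidean_space \<Rightarrow> 'a"
  assumes "char_fun \<phi>" and L: "L' \<in> borel_measurable borel" "\<And>\<xi> x. L \<xi> \<bullet> x = \<xi> \<bullet> L' x"
  shows "char_fun (\<lambda>\<xi>. \<phi> (L \<xi>))"
proof -
  obtain \<mu> where \<mu>: "borel_prob \<mu>" "\<phi> = fourier_transform \<mu>" using assms by (auto simp: char_fun_def)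
  have "L' \<in> measurable \<mu> borel" using L(1) \<mu> by (simp cong: measurable_cong_sets)
  hence "borel_prob (distr \<mu> borel L')" using \<mu> by (auto intro!: prob_space.prob_space_distr)
  moreover have "(\<lambda>\<xi>. \<phi> (L \<xi>)) = fourier_transform (distr \<mu> borel L')"
    unfolding \<mu> by (rule ext) (rule fourier_transform_distr_adjoint[OF \<mu>(1) L, symmetric])
  ultimately show ?thesis by (auto simp: char_fun_def)
qed

lemma fourier_transform_convolution:
  fixes \<mu> \<nu> :: "'a::euclidean_space measure"
  assumes \<mu>: "borel_prob \<mu>" and \<nu>: "borel_prob \<nu>"
  defines "\<kappa> \<equiv> distr (\<mu> \<Otimes>\<^sub>M \<nu>) borel (\<lambda>(x, y). x + y)"
  shows "borel_prob \<kappa>" and "fourier_transform \<kappa> \<xi> = fourier_transform \<mu> \<xi> * fourier_transform \<nu> \<xi>"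
proof -
  interpret m: prob_space \<mu> using \<mu> by auto
  interpret n: prob_space \<nu> using \<nu> by auto
  interpret pair_prob_space \<mu> \<nu> ..
  have [measurable_cong]: "sets \<mu> = sets borel" using \<mu> by auto
  have [measurable_cong]: "sets \<nu> = sets borel" using \<nu> by auto
  show "borel_prob \<kappa>" unfolding \<kappa>_def by (auto intro!: prob_space_distr)
  have int: "integrable (\<mu> \<Otimes>\<^sub>M \<nu>) (\<lambda>(x, y). fourier_exp \<xi> x * fourier_exp \<xi> y)"
    by (rule integrable_const_bound[where B = 1]) (auto simp: norm_mult)
  have "fourier_transform \<kappa> \<xi> = (LINT z|(\<mu> \<Otimes>\<^sub>M \<nu>). (case z of (x, y) \<Rightarrow> fourier_exp \<xi> x * fourier_exp \<xi> y))"
    unfolding fourier_transform_def \<kappa>_def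
    by (subst integral_distr) (auto simp: fourier_exp_add_right split_beta')
  also have "\<dots> = (LINT x|\<mu>. LINT y|\<nu>. fourier_exp \<xi> x * fourier_exp \<xi> y)"
    using integral_fst[of "\<lambda>x y. fourier_exp \<xi> x * fourier_exp \<xi> y"] int by simp
  finally show "fourier_transform \<kappa> \<xi> = fourier_transform \<mu> \<xi> * fourier_transform \<nu> \<xi>"
    unfolding fourier_transform_def by simp
qed

lemma char_fun_mult:
  assumes "char_fun \<phi>" "char_fun \<psi>"
  shows "char_fun (\<lambda>\<xi>::'a::euclidean_space. \<phi> \<xi> * \<psi> \<xi>)"
proof -
  obtain \<mu> where \<mu>: "borel_prob \<mu>" "\<phi> = fourier_transform \<mu>" using assms by (auto simp: char_fun_def)
  obtain \<nu> where \<nu>: "borel_prob \<nu>" "\<psi> = fourier_transform \<nu>" using assms by (auto simp: char_fun_def)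
  show ?thesis
    unfolding char_fun_def \<mu>(2) \<nu>(2)
    using fourier_transform_convolution[OF \<mu>(1) \<nu>(1)] by (metis (no_types, lifting) ext)
qed

lemma char_fun_1: "char_fun (\<lambda>_::'a::euclidean_space. 1)"
proof -
  have "borel_prob (return borel (0::'a))" by (auto intro!: prob_space_return)
  moreover have "fourier_transform (return borel (0::'a)) = (\<lambda>_. 1)"
    unfolding fourier_transform_def by (auto simp: integral_return)
  ultimately show ?thesis by (auto simp: char_fun_def)
qed

lemma char_fun_prod:
  assumes "finite I" "\<And>i. i \<in> I \<Longrightarrow> char_fun (\<phi> i)"
  shows "char_fun (\<lambda>\<xi>::'a::euclidean_space. \<Prod>i\<in>I. \<phi> i \<xi>)"
  using assms by (induction I rule: finite_induct) (auto simp: char_fun_1 intro!: char_fun_mult)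

section \<open>Spectra and Parseval's identity for characters\<close>

lemma has_sum_1I:
  fixes f :: "'a \<Rightarrow> real"
  assumes nn: "\<And>v. v \<in> A \<Longrightarrow> 0 \<le> f v"
    and le: "\<And>F. finite F \<Longrightarrow> F \<subseteq> A \<Longrightarrow> sum f F \<le> 1"
    and ge: "\<And>\<epsilon>. \<epsilon> > 0 \<Longrightarrow> \<exists>F. finite F \<and> F \<subseteq> A \<and> 1 - \<epsilon> < sum f F"
  shows "(f has_sum 1) A"
  unfolding has_sum_def
proof (rule tendstoI)
  fix \<epsilon> :: real assume "\<epsilon> > 0"
  then obtain F0 where F0: "finite F0" "F0 \<subseteq> A" "1 - \<epsilon> < sum f F0" using ge by blast
  show "\<forall>\<^sub>F F in finite_subsets_at_top A. dist (sum f F) 1 < \<epsilon>"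
    unfolding eventually_finite_subsets_at_top
  proof (intro exI[of _ F0] conjI allI impI)
    fix F assume F: "finite F \<and> F0 \<subseteq> F \<and> F \<subseteq> A"
    have "sum f F0 \<le> sum f F" by (rule sum_mono2) (use F nn in auto)
    moreover have "sum f F \<le> 1" using F le by auto
    ultimately show "dist (sum f F) 1 < \<epsilon>" using F0 by (auto simp: dist_real_def)
  qed (use F0 in auto)
qed

lemma has_sum_finite_approx:
  fixes f :: "'a \<Rightarrow> real"
  assumes "(f has_sum s) A" "\<epsilon> > 0"
  shows "\<exists>F0. finite F0 \<and> F0 \<subseteq> A \<and> (\<forall>F. finite F \<and> F0 \<subseteq> F \<and> F \<subseteq> A \<longrightarrow> \<bar>sum f F - s\<bar> < \<epsilon>)"
proof -
  have "\<forall>\<^sub>F F in finite_subsets_at_top A. dist (sum f F) s < \<epsilon>"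
    using assms unfolding has_sum_def by (rule tendstoD)
  thus ?thesis unfolding eventually_finite_subsets_at_top dist_real_def by blast
qed

lemma spectrum_orthogonal:
  assumes "is_spectrum \<mu> \<Lambda>" "v \<in> \<Lambda>" "w \<in> \<Lambda>" "v \<noteq> w"
  shows "fourier_transform \<mu> (v - w) = 0"
  using assms unfolding is_spectrum_def orthonormal_basis_L2_def L2_inner_fourier_exp by auto

text \<open>A basis approximates the character of frequency \<open>-\<xi>\<close> arbitrarily well, and the partial sums of the
  series measure the best approximation.\<close>

lemma spectrum_imp_Parseval:
  assumes \<mu>: "borel_prob \<mu>" and spec: "is_spectrum \<mu> \<Lambda>"
  shows "((\<lambda>v. (cmod (fourier_transform \<mu> (\<xi> + v)))\<^sup>2) has_sum 1) \<Lambda>"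
proof (rule has_sum_1I)
  fix F assume "finite F" "F \<subseteq> \<Lambda>"
  thus "(\<Sum>v\<in>F. (cmod (fourier_transform \<mu> (\<xi> + v)))\<^sup>2) \<le> 1"
    by (intro Bessel_characters \<mu> spectrum_orthogonal[OF spec]) auto
next
  fix \<epsilon> :: real assume \<epsilon>: "\<epsilon> > 0"
  have [measurable_cong]: "sets \<mu> = sets borel" using \<mu> by auto
  have "fourier_exp (-\<xi>) \<in> L2 \<mu>"
    unfolding L2_def using \<mu> by (auto simp: prob_space.finite_measure finite_measure.integrable_const)
  then obtain F u where F: "finite F" "F \<subseteq> \<Lambda>"
    and L: "L2_norm \<mu> (\<lambda>x. fourier_exp (-\<xi>) x - (\<Sum>v\<in>F. u v * fourier_exp v x)) < sqrt \<epsilon>"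
    using spec \<epsilon> unfolding is_spectrum_def orthonormal_basis_L2_def by (meson real_sqrt_gt_zero)
  have "1 - (\<Sum>v\<in>F. (cmod (fourier_transform \<mu> (- \<xi> - v)))\<^sup>2)
      \<le> (1 - (\<Sum>v\<in>F. (cmod (fourier_transform \<mu> (- \<xi> - v)))\<^sup>2))
        + (\<Sum>v\<in>F. (cmod (u v - fourier_transform \<mu> (- \<xi> - v)))\<^sup>2)"
    by (simp add: sum_nonneg)
  also have "\<dots> = (LINT x|\<mu>. (cmod (fourier_exp (-\<xi>) x - (\<Sum>v\<in>F. u v * fourier_exp v x)))\<^sup>2)"
    by (rule character_approximation[symmetric, OF \<mu> F(1) spectrum_orthogonal[OF spec]]) (use F in auto)
  also have "\<dots> < \<epsilon>" using L \<epsilon> unfolding L2_norm_def by simp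
  finally have "1 - (\<Sum>v\<in>F. (cmod (fourier_transform \<mu> (- (\<xi> + v))))\<^sup>2) < \<epsilon>"
    by (simp only: minus_add_distrib diff_conv_add_uminus)
  hence "1 - \<epsilon> < (\<Sum>v\<in>F. (cmod (fourier_transform \<mu> (\<xi> + v)))\<^sup>2)"
    by (simp only: cmod_fourier_transform_uminus)
  thus "\<exists>F. finite F \<and> F \<subseteq> \<Lambda> \<and> 1 - \<epsilon> < (\<Sum>v\<in>F. (cmod (fourier_transform \<mu> (\<xi> + v)))\<^sup>2)"
    using F by blast
qed auto

inductive_set trig_polys :: "'a::euclidean_space set \<Rightarrow> ('a \<Rightarrow> complex) set" for \<Lambda> where
  zero: "(\<lambda>_. 0) \<in> trig_polys \<Lambda>"
| add: "v \<in> \<Lambda> \<Longrightarrow> f \<in> trig_polys \<Lambda> \<Longrightarrow> (\<lambda>x. c * fourier_exp v x + f x) \<in> trig_polys \<Lambda>"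

lemma trig_polys_exp: "v \<in> \<Lambda> \<Longrightarrow> (\<lambda>x. c * fourier_exp v x) \<in> trig_polys \<Lambda>"
  using trig_polys.add[OF _ trig_polys.zero, of v \<Lambda> c] by simp

lemma trig_polys_add: "f \<in> trig_polys \<Lambda> \<Longrightarrow> g \<in> trig_polys \<Lambda> \<Longrightarrow> (\<lambda>x. f x + g x) \<in> trig_polys \<Lambda>"
  by (induction rule: trig_polys.induct) (auto simp: add.assoc intro: trig_polys.add)

lemma trig_polys_scale: "f \<in> trig_polys \<Lambda> \<Longrightarrow> (\<lambda>x. c * f x) \<in> trig_polys \<Lambda>"
  by (induction rule: trig_polys.induct)
     (auto simp: distrib_left mult.assoc[symmetric] intro: trig_polys.intros)

lemma trig_polys_exp_mult: "f \<in> trig_polys UNIV \<Longrightarrow> (\<lambda>x. fourier_exp \<xi> x * f x) \<in> trig_polys UNIV"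
proof (induction rule: trig_polys.induct)
  case (add v f c)
  have "(\<lambda>x. c * fourier_exp (\<xi> + v) x + fourier_exp \<xi> x * f x) \<in> trig_polys UNIV"
    by (rule trig_polys.add) (use add in auto)
  thus ?case by (simp add: fourier_exp_add_left algebra_simps)
qed (simp add: trig_polys.zero)

lemma trig_polys_mult:
  "f \<in> trig_polys UNIV \<Longrightarrow> g \<in> trig_polys UNIV \<Longrightarrow> (\<lambda>x. f x * g x) \<in> trig_polys UNIV"
proof (induction rule: trig_polys.induct)
  case (add v f c)
  have "(\<lambda>x. c * (fourier_exp v x * g x) + f x * g x) \<in> trig_polys UNIV"
    by (intro trig_polys_add trig_polys_scale trig_polys_exp_mult) (use add in auto)
  thus ?case by (simp add: algebra_simps)
qed (simp add: trig_polys.zero)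

lemma trig_polys_continuous: "f \<in> trig_polys \<Lambda> \<Longrightarrow> continuous_on A f"
  by (induction rule: trig_polys.induct) (auto intro!: continuous_intros)

lemma trig_polys_bounded: "f \<in> trig_polys \<Lambda> \<Longrightarrow> \<exists>B. \<forall>x. cmod (f x) \<le> B"
proof (induction rule: trig_polys.induct)
  case (add v f c)
  then obtain B where B: "\<And>x. cmod (f x) \<le> B" by blast
  have "cmod (c * fourier_exp v x + f x) \<le> cmod c + B" for x
    by (rule order.trans[OF norm_triangle_ineq]) (use B in \<open>simp add: norm_mult\<close>)
  thus ?case by blast
qed (auto intro: exI[of _ 0])

lemma trig_polys_sum_form:
  "f \<in> trig_polys \<Lambda> \<Longrightarrow> \<exists>F u. finite F \<and> F \<subseteq> \<Lambda> \<and> f = (\<lambda>x. \<Sum>v\<in>F. u v * fourier_exp v x)"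
proof (induction rule: trig_polys.induct)
  case zero
  show ?case by (rule exI[of _ "{}"]) auto
next
  case (add v f c)
  then obtain F u where F: "finite F" "F \<subseteq> \<Lambda>" "f = (\<lambda>x. \<Sum>v\<in>F. u v * fourier_exp v x)" by blast
  define u' where "u' w = (if w \<in> F then u w else 0) + (if w = v then c else 0)" for w
  have "c * fourier_exp v x + f x = (\<Sum>w\<in>insert v F. u' w * fourier_exp w x)" for x
  proof -
    have "(\<Sum>w\<in>insert v F. u' w * fourier_exp w x)
       = (\<Sum>w\<in>insert v F. (if w \<in> F then u w * fourier_exp w x else 0))
        + (\<Sum>w\<in>insert v F. (if w = v then c * fourier_exp w x else 0))"
      unfolding u'_def by (subst sum.distrib[symmetric]) (auto intro!: sum.cong simp: algebra_simps)
    also have "(\<Sum>w\<in>insert v F. (if w \<in> F then u w * fourier_exp w x else 0)) = f x"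
      unfolding F by (rule sum.mono_neutral_cong_right) (use F in auto)
    finally show ?thesis using F by simp
  qed
  thus ?case using F add by (intro exI[of _ "insert v F"] exI[of _ u']) auto
qed

text \<open>The subset of $L^2$ that the exponentials with frequencies in \<open>\<Lambda>\<close> approximate. Squared norms and
  the inequality $|a+b|^2 \le 2|a|^2 + 2|b|^2$ replace Minkowski's inequality.\<close>

definition trig_closure :: "'a::euclidean_space measure \<Rightarrow> 'a set \<Rightarrow> ('a \<Rightarrow> complex) set" where
  "trig_closure \<mu> \<Lambda> = {f \<in> L2 \<mu>. \<forall>\<epsilon>>0. \<exists>g\<in>trig_polys \<Lambda>. (LINT x|\<mu>. (cmod (f x - g x))\<^sup>2) < \<epsilon>}"

lemma cmod_add_square_le: "(cmod (a + b))\<^sup>2 \<le> 2 * (cmod a)\<^sup>2 + 2 * (cmod b)\<^sup>2"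
proof -
  have "(cmod (a + b))\<^sup>2 \<le> (cmod a + cmod b)\<^sup>2" by (intro power_mono norm_triangle_ineq) auto
  also have "\<dots> \<le> 2 * (cmod a)\<^sup>2 + 2 * (cmod b)\<^sup>2"
    using zero_le_power2[of "cmod a - cmod b"] by (simp add: power2_eq_square algebra_simps)
  finally show ?thesis .
qed

lemma L2_measurable: "f \<in> L2 M \<Longrightarrow> f \<in> borel_measurable M"
  by (simp add: L2_def)

lemma L2_add: assumes "f \<in> L2 M" "g \<in> L2 M" shows "(\<lambda>x. f x + g x) \<in> L2 M"
proof -
  have [measurable]: "f \<in> borel_measurable M" "g \<in> borel_measurable M" using assms by (auto simp: L2_def)
  have "integrable M (\<lambda>x. 2 * (cmod (f x))\<^sup>2 + 2 * (cmod (g x))\<^sup>2)" using assms by (auto simp: L2_def)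
  hence "integrable M (\<lambda>x. (cmod (f x + g x))\<^sup>2)"
    by (rule Bochner_Integration.integrable_bound) (auto simp: cmod_add_square_le)
  thus ?thesis by (auto simp: L2_def)
qed

lemma L2_scale: assumes "f \<in> L2 M" shows "(\<lambda>x. c * f x) \<in> L2 M"
  using assms by (auto simp: L2_def norm_mult power_mult_distrib)

lemma L2_diff: assumes "f \<in> L2 M" "g \<in> L2 M" shows "(\<lambda>x. f x - g x) \<in> L2 M"
  using L2_add[OF assms(1) L2_scale[OF assms(2), of "-1"]] by simp

lemma L2_sq_triangle:
  assumes "f \<in> L2 M" "g \<in> L2 M" "h \<in> L2 M"
  shows "(LINT x|M. (cmod (f x - h x))\<^sup>2) \<le> 2 * (LINT x|M. (cmod (f x - g x))\<^sup>2) + 2 * (LINT x|M. (cmod (g x - h x))\<^sup>2)"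
proof -
  have i: "integrable M (\<lambda>x. (cmod (f x - g x))\<^sup>2)" "integrable M (\<lambda>x. (cmod (g x - h x))\<^sup>2)"
     "integrable M (\<lambda>x. (cmod (f x - h x))\<^sup>2)" using assms L2_diff by (auto simp: L2_def)
  have "(LINT x|M. (cmod (f x - h x))\<^sup>2) \<le> (LINT x|M. 2 * (cmod (f x - g x))\<^sup>2 + 2 * (cmod (g x - h x))\<^sup>2)"
    using i cmod_add_square_le[of "f x - g x" "g x - h x" for x] by (intro integral_mono) auto
  thus ?thesis using i by simp
qed

lemma bounded_L2:
  assumes \<mu>: "borel_prob \<mu>" and [measurable]: "f \<in> borel_measurable borel" and B: "\<And>x. cmod (f x) \<le> B"
  shows "f \<in> L2 \<mu>"
proof -
  have [measurable_cong]: "sets \<mu> = sets borel" using \<mu> by auto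
  interpret prob_space \<mu> using \<mu> by auto
  have "integrable \<mu> (\<lambda>x. (cmod (f x))\<^sup>2)"
    by (rule integrable_const_bound[where B = "B\<^sup>2"]) (auto intro!: power_mono B)
  thus ?thesis by (auto simp: L2_def)
qed

lemma trig_polys_L2: "borel_prob \<mu> \<Longrightarrow> f \<in> trig_polys \<Lambda> \<Longrightarrow> f \<in> L2 \<mu>"
  by (metis trig_polys_bounded bounded_L2 trig_polys_continuous borel_measurable_continuous_onI)

lemma trig_closure_L2: "f \<in> trig_closure \<mu> \<Lambda> \<Longrightarrow> f \<in> L2 \<mu>"
  by (simp add: trig_closure_def)

lemma trig_closure_approx:
  assumes \<mu>: "borel_prob \<mu>" and f: "f \<in> L2 \<mu>"
    and ap: "\<And>\<epsilon>. \<epsilon> > 0 \<Longrightarrow> \<exists>g\<in>trig_closure \<mu> \<Lambda>. (LINT x|\<mu>. (cmod (f x - g x))\<^sup>2) < \<epsilon>"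
  shows "f \<in> trig_closure \<mu> \<Lambda>"
  unfolding trig_closure_def
proof (intro CollectI conjI f allI impI)
  fix \<epsilon> :: real assume "\<epsilon> > 0"
  then obtain g where g: "g \<in> trig_closure \<mu> \<Lambda>" "(LINT x|\<mu>. (cmod (f x - g x))\<^sup>2) < \<epsilon> / 4"
    using ap[of "\<epsilon> / 4"] by auto
  then obtain h where h: "h \<in> trig_polys \<Lambda>" "(LINT x|\<mu>. (cmod (g x - h x))\<^sup>2) < \<epsilon> / 4"
    using \<open>\<epsilon> > 0\<close> unfolding trig_closure_def by (auto dest!: spec[of _ "\<epsilon> / 4"])
  have "(LINT x|\<mu>. (cmod (f x - h x))\<^sup>2) < \<epsilon>"
    using L2_sq_triangle[OF f trig_closure_L2[OF g(1)] trig_polys_L2[OF \<mu> h(1)]] g h by linarith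
  thus "\<exists>g\<in>trig_polys \<Lambda>. (LINT x|\<mu>. (cmod (f x - g x))\<^sup>2) < \<epsilon>" using h by blast
qed

lemma trig_polys_closure: "borel_prob \<mu> \<Longrightarrow> f \<in> trig_polys \<Lambda> \<Longrightarrow> f \<in> trig_closure \<mu> \<Lambda>"
  unfolding trig_closure_def by (auto intro!: trig_polys_L2 bexI[of _ f])

lemma trig_closure_add:
  assumes \<mu>: "borel_prob \<mu>" and f: "f \<in> trig_closure \<mu> \<Lambda>" and g: "g \<in> trig_closure \<mu> \<Lambda>"
  shows "(\<lambda>x. f x + g x) \<in> trig_closure \<mu> \<Lambda>"
  unfolding trig_closure_def
proof (intro CollectI conjI allI impI)
  show "(\<lambda>x. f x + g x) \<in> L2 \<mu>" using f g by (intro L2_add trig_closure_L2)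
next
  fix \<epsilon> :: real assume "\<epsilon> > 0"
  then obtain h k where h: "h \<in> trig_polys \<Lambda>" "(LINT x|\<mu>. (cmod (f x - h x))\<^sup>2) < \<epsilon> / 4"
    and k: "k \<in> trig_polys \<Lambda>" "(LINT x|\<mu>. (cmod (g x - k x))\<^sup>2) < \<epsilon> / 4"
    using f g unfolding trig_closure_def by (fastforce dest!: spec[of _ "\<epsilon> / 4"])
  have m: "f \<in> L2 \<mu>" "g \<in> L2 \<mu>" "h \<in> L2 \<mu>" "k \<in> L2 \<mu>"
    using trig_closure_L2[OF f] trig_closure_L2[OF g] trig_polys_L2[OF \<mu> h(1)] trig_polys_L2[OF \<mu> k(1)]
    by auto
  have "(LINT x|\<mu>. (cmod ((f x + g x) - (h x + k x)))\<^sup>2)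
     \<le> 2 * (LINT x|\<mu>. (cmod ((f x + g x) - (h x + g x)))\<^sup>2) + 2 * (LINT x|\<mu>. (cmod ((h x + g x) - (h x + k x)))\<^sup>2)"
    by (intro L2_sq_triangle L2_add m)
  also have "\<dots> < \<epsilon>" using h k by simp
  finally show "\<exists>l\<in>trig_polys \<Lambda>. (LINT x|\<mu>. (cmod ((f x + g x) - l x))\<^sup>2) < \<epsilon>"
    using trig_polys_add[OF h(1) k(1)] by (auto intro!: bexI[of _ "\<lambda>x. h x + k x"])
qed

lemma trig_closure_scale:
  assumes f: "f \<in> trig_closure \<mu> \<Lambda>"
  shows "(\<lambda>x. c * f x) \<in> trig_closure \<mu> \<Lambda>"
  unfolding trig_closure_def
proof (intro CollectI conjI allI impI)
  show "(\<lambda>x. c * f x) \<in> L2 \<mu>" using f by (intro L2_scale trig_closure_L2)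
next
  fix \<epsilon> :: real assume "\<epsilon> > 0"
  hence e: "\<epsilon> / ((cmod c)\<^sup>2 + 1) > 0" by (auto intro!: divide_pos_pos add_nonneg_pos)
  then obtain h where h: "h \<in> trig_polys \<Lambda>" "(LINT x|\<mu>. (cmod (f x - h x))\<^sup>2) < \<epsilon> / ((cmod c)\<^sup>2 + 1)"
    using f unfolding trig_closure_def by blast
  have "(LINT x|\<mu>. (cmod (c * f x - c * h x))\<^sup>2) = (cmod c)\<^sup>2 * (LINT x|\<mu>. (cmod (f x - h x))\<^sup>2)"
    by (simp add: right_diff_distrib[symmetric] norm_mult power_mult_distrib)
  also have "\<dots> \<le> (cmod c)\<^sup>2 * (\<epsilon> / ((cmod c)\<^sup>2 + 1))"
    by (intro mult_left_mono) (use h in auto)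
  also have "\<dots> < ((cmod c)\<^sup>2 + 1) * (\<epsilon> / ((cmod c)\<^sup>2 + 1))"
    by (intro mult_strict_right_mono e) auto
  also have "\<dots> = \<epsilon>"
    by (simp add: add_nonneg_eq_0_iff)
  finally show "\<exists>l\<in>trig_polys \<Lambda>. (LINT x|\<mu>. (cmod (c * f x - l x))\<^sup>2) < \<epsilon>"
    using trig_polys_scale[OF h(1)] by (auto intro!: bexI[of _ "\<lambda>x. c * h x"])
qed

lemma trig_closure_sum:
  assumes \<mu>: "borel_prob \<mu>" and "finite I" "\<And>i. i \<in> I \<Longrightarrow> f i \<in> trig_closure \<mu> \<Lambda>"
  shows "(\<lambda>x. \<Sum>i\<in>I. f i x) \<in> trig_closure \<mu> \<Lambda>"
  using assms(2,3)
proof (induction I rule: finite_induct)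
  case empty
  show ?case using trig_polys_closure[OF \<mu> trig_polys.zero] by simp
qed (auto intro!: trig_closure_add \<mu>)

text \<open>The domination is by a square-integrable function, because the squared errors are what has to converge
  in mean.\<close>

lemma trig_closure_dominated:
  assumes \<mu>: "borel_prob \<mu>" and s: "\<And>n::nat. s n \<in> trig_closure \<mu> \<Lambda>"
    and lim: "\<And>x. (\<lambda>n. s n x) \<longlonglongrightarrow> f x" and bd: "\<And>n x. cmod (s n x) \<le> w x"
    and w: "integrable \<mu> (\<lambda>x. (w x)\<^sup>2)" and [measurable]: "f \<in> borel_measurable \<mu>"
  shows "f \<in> trig_closure \<mu> \<Lambda>"
proof (rule trig_closure_approx[OF \<mu>])
  have [measurable]: "s n \<in> borel_measurable \<mu>" for n using trig_closure_L2[OF s] by (rule L2_measurable)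
  have fw: "cmod (f x) \<le> w x" for x
    by (rule LIMSEQ_le_const2[OF tendsto_norm[OF lim]]) (use bd in auto)
  have "integrable \<mu> (\<lambda>x. (cmod (f x))\<^sup>2)"
    by (rule Bochner_Integration.integrable_bound[OF w])
       (use fw in \<open>auto intro!: power_mono AE_I2 simp: abs_le_square_iff\<close>)
  thus fL: "f \<in> L2 \<mu>" by (simp add: L2_def)
  have "(\<lambda>n. LINT x|\<mu>. (cmod (f x - s n x))\<^sup>2) \<longlonglongrightarrow> (LINT x|\<mu>. 0)"
  proof (rule integral_dominated_convergence[where w = "\<lambda>x. 4 * (w x)\<^sup>2"])
    show "AE x in \<mu>. (\<lambda>n. (cmod (f x - s n x))\<^sup>2) \<longlonglongrightarrow> 0"
    proof (rule AE_I2)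
      fix x
      have "(\<lambda>n. (cmod (f x - s n x))\<^sup>2) \<longlonglongrightarrow> (cmod (f x - f x))\<^sup>2" by (intro tendsto_intros lim)
      thus "(\<lambda>n. (cmod (f x - s n x))\<^sup>2) \<longlonglongrightarrow> 0" by simp
    qed
    show "AE x in \<mu>. norm ((cmod (f x - s n x))\<^sup>2) \<le> 4 * (w x)\<^sup>2" for n
    proof (rule AE_I2)
      fix x
      have "cmod (f x - s n x) \<le> 2 * w x" using norm_triangle_ineq4[of "f x" "s n x"] fw[of x] bd[of n x] by linarith
      hence "(cmod (f x - s n x))\<^sup>2 \<le> (2 * w x)\<^sup>2" by (intro power_mono) auto
      thus "norm ((cmod (f x - s n x))\<^sup>2) \<le> 4 * (w x)\<^sup>2" by (simp add: power_mult_distrib)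
    qed
  qed (use w in auto)
  hence lim0: "(\<lambda>n. LINT x|\<mu>. (cmod (f x - s n x))\<^sup>2) \<longlonglongrightarrow> 0" by simp
  fix \<epsilon> :: real assume "\<epsilon> > 0"
  then obtain n where "(LINT x|\<mu>. (cmod (f x - s n x))\<^sup>2) < \<epsilon>"
    using order_tendstoD(2)[OF lim0] by (auto simp: eventually_sequentially)
  thus "\<exists>g\<in>trig_closure \<mu> \<Lambda>. (LINT x|\<mu>. (cmod (f x - g x))\<^sup>2) < \<epsilon>" using s by blast
qed

text \<open>Stone--Weierstrass; the character of a small multiple of \<open>x - y\<close> separates \<open>x\<close> and \<open>y\<close>.\<close>

lemma real_trig_polys_dense:
  fixes K :: "'a::euclidean_space set" and g :: "'a \<Rightarrow> real"
  assumes "compact K" "continuous_on K g" "\<epsilon> > 0"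
  shows "\<exists>h. (\<lambda>x. complex_of_real (h x)) \<in> trig_polys UNIV \<and> (\<forall>x\<in>K. \<bar>g x - h x\<bar> < \<epsilon>)"
proof (rule Stone_Weierstrass_HOL[OF assms(1) _ _ _ _ _ assms(2,3)])
  show "(\<lambda>x. complex_of_real c) \<in> trig_polys UNIV" for c
    using trig_polys_exp[of 0 UNIV "of_real c"] by simp
  show "continuous_on K f" if "(\<lambda>x. complex_of_real (f x)) \<in> trig_polys UNIV" for f
    using continuous_on_Re[OF trig_polys_continuous[OF that]] by simp
  show "(\<lambda>x. complex_of_real (f x + g x)) \<in> trig_polys UNIV"
    if "(\<lambda>x. complex_of_real (f x)) \<in> trig_polys UNIV \<and> (\<lambda>x. complex_of_real (g x)) \<in> trig_polys UNIV" for f g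
    using that trig_polys_add by fastforce
  show "(\<lambda>x. complex_of_real (f x * g x)) \<in> trig_polys UNIV"
    if "(\<lambda>x. complex_of_real (f x)) \<in> trig_polys UNIV \<and> (\<lambda>x. complex_of_real (g x)) \<in> trig_polys UNIV" for f g
    using that trig_polys_mult by fastforce
next
  fix x y :: 'a assume "x \<in> K \<and> y \<in> K \<and> x \<noteq> y"
  define \<xi> where "\<xi> = (1 / (4 * ((x - y) \<bullet> (x - y)))) *\<^sub>R (x - y)"
  have "\<xi> \<bullet> (x - y) = 1 / 4" using \<open>x \<in> K \<and> _\<close> by (simp add: \<xi>_def)
  moreover have "(1 / 4 :: real) \<notin> \<int>"
  proof
    assume "(1 / 4 :: real) \<in> \<int>"
    then obtain k :: int where "(1 / 4 :: real) = k" by (auto elim: Ints_cases)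
    hence "1 = 4 * k" by linarith
    thus False by presburger
  qed
  ultimately have "fourier_exp \<xi> (x - y) \<noteq> 1" by (metis fourier_exp_eq_1)
  hence ne: "fourier_exp \<xi> x \<noteq> fourier_exp \<xi> y"
    using fourier_exp_add_right[of \<xi> "x - y" y] norm_fourier_exp[of \<xi> y]
    by (metis add_cancel_left_left diff_add_cancel mult_cancel_right1 norm_zero zero_neq_one)
  have re: "(\<lambda>x. complex_of_real (Re (fourier_exp \<xi> x))) \<in> trig_polys UNIV"
  proof -
    have "(\<lambda>x. (1/2) * fourier_exp \<xi> x + (1/2) * fourier_exp (-\<xi>) x) \<in> trig_polys UNIV"
      by (intro trig_polys.add trig_polys_exp) auto
    moreover have "(1/2) * fourier_exp \<xi> x + (1/2) * fourier_exp (-\<xi>) x = of_real (Re (fourier_exp \<xi> x))" for x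
      unfolding fourier_exp_cnj[symmetric] by (simp add: complex_eq_iff)
    ultimately show ?thesis by simp
  qed
  have im: "(\<lambda>x. complex_of_real (Im (fourier_exp \<xi> x))) \<in> trig_polys UNIV"
  proof -
    have "(\<lambda>x. (-\<i>/2) * fourier_exp \<xi> x + (\<i>/2) * fourier_exp (-\<xi>) x) \<in> trig_polys UNIV"
      by (intro trig_polys.add trig_polys_exp) auto
    moreover have "(-\<i>/2) * fourier_exp \<xi> x + (\<i>/2) * fourier_exp (-\<xi>) x = of_real (Im (fourier_exp \<xi> x))" for x
      unfolding fourier_exp_cnj[symmetric] by (simp add: complex_eq_iff)
    ultimately show ?thesis by simp
  qed
  show "\<exists>f. (\<lambda>x. complex_of_real (f x)) \<in> trig_polys UNIV \<and> f x \<noteq> f y"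
  proof (cases "Re (fourier_exp \<xi> x) = Re (fourier_exp \<xi> y)")
    case True
    hence "Im (fourier_exp \<xi> x) \<noteq> Im (fourier_exp \<xi> y)" using ne complex_eqI by metis
    thus ?thesis using im by (intro exI[of _ "\<lambda>x. Im (fourier_exp \<xi> x)"] conjI)
  next
    case False
    thus ?thesis using re by (intro exI[of _ "\<lambda>x. Re (fourier_exp \<xi> x)"] conjI)
  qed
qed

text \<open>Uniform approximation on the compact support does not control the trigonometric polynomial elsewhere,
  but there the measure vanishes.\<close>

lemma trig_closure_continuous:
  fixes \<mu> :: "'a::euclidean_space measure"
  assumes \<mu>: "borel_prob \<mu>" and cs: "compactly_supported \<mu>" and all: "trig_polys UNIV \<subseteq> trig_closure \<mu> \<Lambda>"
    and g: "continuous_on UNIV g" and B: "\<And>x. \<bar>g x\<bar> \<le> B"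
  shows "(\<lambda>x. complex_of_real (g x)) \<in> trig_closure \<mu> \<Lambda>"
proof -
  have gm [measurable]: "g \<in> borel_measurable borel" by (intro borel_measurable_continuous_onI g)
  have [measurable_cong]: "sets \<mu> = sets borel" using \<mu> by auto
  interpret prob_space \<mu> using \<mu> by auto
  obtain K where K: "compact K" "emeasure \<mu> (- K) = 0" using cs by (auto simp: compactly_supported_def)
  have "- K \<in> null_sets \<mu>" using K \<mu> by (auto simp: null_sets_def borel_closed compact_imp_closed)
  hence AEK: "AE x in \<mu>. x \<in> K" by (auto dest: AE_not_in)
  show ?thesis
  proof (rule trig_closure_approx[OF \<mu>])
    show gL: "(\<lambda>x. complex_of_real (g x)) \<in> L2 \<mu>"
      by (rule bounded_L2[OF \<mu>, where B = B]) (use B in auto)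
    fix \<epsilon> :: real assume e: "\<epsilon> > 0"
    define \<delta> where "\<delta> = sqrt (\<epsilon> / 2)"
    have d: "\<delta> > 0" "\<delta>\<^sup>2 < \<epsilon>" using e by (auto simp: \<delta>_def)
    obtain h where h: "(\<lambda>x. complex_of_real (h x)) \<in> trig_polys UNIV" "\<And>x. x \<in> K \<Longrightarrow> \<bar>g x - h x\<bar> < \<delta>"
      using real_trig_polys_dense[OF K(1) continuous_on_subset[OF g] d(1)] by auto
    have hL: "(\<lambda>x. complex_of_real (h x)) \<in> L2 \<mu>" by (rule trig_polys_L2[OF \<mu> h(1)])
    have "(LINT x|\<mu>. (cmod (of_real (g x) - of_real (h x)))\<^sup>2) \<le> (LINT x|\<mu>. \<delta>\<^sup>2)"
    proof (rule integral_mono_AE)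
      show "integrable \<mu> (\<lambda>x. (cmod (complex_of_real (g x) - complex_of_real (h x)))\<^sup>2)"
        using L2_diff[OF gL hL] by (simp add: L2_def)
      show "AE x in \<mu>. (cmod (complex_of_real (g x) - complex_of_real (h x)))\<^sup>2 \<le> \<delta>\<^sup>2"
        using AEK
      proof eventually_elim
        case (elim x)
        have "\<bar>g x - h x\<bar> \<le> \<delta>" using h(2)[OF elim] by simp
        moreover have "cmod (complex_of_real (g x) - complex_of_real (h x)) = \<bar>g x - h x\<bar>"
          by (metis norm_of_real of_real_diff)
        ultimately show ?case by (simp only: abs_ge_zero power_mono)
      qed
    qed auto
    also have "\<dots> < \<epsilon>" using d by (simp add: prob_space)
    finally show "\<exists>l\<in>trig_closure \<mu> \<Lambda>. (LINT x|\<mu>. (cmod (of_real (g x) - l x))\<^sup>2) < \<epsilon>"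
      by (rule bexI[of _ "\<lambda>x. complex_of_real (h x)"]) (use h all in auto)
  qed
qed

text \<open>Continuous functions of the distance to a closed set decrease to its indicator. From closed sets the
  closure property spreads to Borel sets by Dynkin's theorem, and on to simple and to all
  square-integrable functions by dominated convergence.\<close>

lemma trig_closure_closed_indicator:
  fixes \<mu> :: "'a::euclidean_space measure"
  assumes \<mu>: "borel_prob \<mu>" and cs: "compactly_supported \<mu>" and all: "trig_polys UNIV \<subseteq> trig_closure \<mu> \<Lambda>"
    and A: "closed A"
  shows "(\<lambda>x. complex_of_real (indicator A x)) \<in> trig_closure \<mu> \<Lambda>"
proof (cases "A = {}")
  case True
  thus ?thesis using trig_polys_closure[OF \<mu> trig_polys.zero] by simp
next
  case False
  have [measurable_cong]: "sets \<mu> = sets borel" using \<mu> by auto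
  have [measurable]: "A \<in> sets borel" using A by simp
  interpret prob_space \<mu> using \<mu> by auto
  define g where "g n x = max 0 (1 - real n * infdist x A)" for n :: nat and x
  show ?thesis
  proof (rule trig_closure_dominated[OF \<mu>, where s = "\<lambda>n x. of_real (g n x)" and w = "\<lambda>_. 1"])
    fix n :: nat
    show "(\<lambda>x. complex_of_real (g n x)) \<in> trig_closure \<mu> \<Lambda>"
    proof (rule trig_closure_continuous[OF \<mu> cs all, where B = 1])
      show "continuous_on UNIV (g n)" unfolding g_def by (intro continuous_intros)
      show "\<bar>g n x\<bar> \<le> 1" for x by (auto simp: g_def infdist_nonneg)
    qed
    show "cmod (complex_of_real (g n x)) \<le> 1" for x by (auto simp: g_def infdist_nonneg)
  next
    fix x
    have "(\<lambda>n. g n x) \<longlonglongrightarrow> indicator A x"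
    proof (cases "x \<in> A")
      case True
      thus ?thesis by (simp add: g_def)
    next
      case ne: False
      hence pos: "infdist x A > 0" using A False by (metis in_closed_iff_infdist_zero infdist_pos_not_in_closed)
      obtain N :: nat where N: "1 < real N * infdist x A" using pos reals_Archimedean3 by blast
      have "\<forall>\<^sub>F n in sequentially. g n x = 0"
        unfolding eventually_sequentially
      proof (intro exI[of _ N] allI impI)
        fix n assume "N \<le> n"
        hence "real N * infdist x A \<le> real n * infdist x A" by (intro mult_right_mono) (auto simp: infdist_nonneg)
        thus "g n x = 0" using N by (simp add: g_def)
      qed
      hence "(\<lambda>n. g n x) \<longlonglongrightarrow> 0" by (simp add: tendsto_eventually)
      thus ?thesis using ne by simp
    qed
    thus "(\<lambda>n. complex_of_real (g n x)) \<longlonglongrightarrow> complex_of_real (indicator A x)" by (rule tendsto_of_real)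
  qed auto
qed

lemma trig_closure_indicator:
  fixes \<mu> :: "'a::euclidean_space measure"
  assumes \<mu>: "borel_prob \<mu>" and cs: "compactly_supported \<mu>" and all: "trig_polys UNIV \<subseteq> trig_closure \<mu> \<Lambda>"
    and A: "A \<in> sets borel"
  shows "(\<lambda>x. complex_of_real (indicator A x)) \<in> trig_closure \<mu> \<Lambda>"
proof -
  have [measurable_cong]: "sets \<mu> = sets borel" using \<mu> by auto
  interpret prob_space \<mu> using \<mu> by auto
  have sig: "A \<in> sigma_sets UNIV (Collect closed)" using A by (simp add: borel_eq_closed)
  have bor: "sigma_sets UNIV (Collect closed) = sets (borel :: 'a measure)" by (simp add: borel_eq_closed)
  show ?thesis
  proof (rule sigma_sets_induct_disjoint[OF _ _ sig])
    show "Int_stable (Collect (closed :: 'a set \<Rightarrow> bool))" by (auto simp: Int_stable_def)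
    show "Collect closed \<subseteq> Pow (UNIV :: 'a set)" by auto
    show "(\<lambda>x. complex_of_real (indicator A x)) \<in> trig_closure \<mu> \<Lambda>" if "A \<in> Collect closed" for A
      using that by (intro trig_closure_closed_indicator assms) auto
    show "(\<lambda>x. complex_of_real (indicator {} x)) \<in> trig_closure \<mu> \<Lambda>"
      using trig_polys_closure[OF \<mu> trig_polys.zero] by simp
  next
    fix A :: "'a set" assume "(\<lambda>x. complex_of_real (indicator A x)) \<in> trig_closure \<mu> \<Lambda>"
    note IA = trig_closure_scale[OF this, of "-1"]
    have one: "(\<lambda>x. 1 * fourier_exp 0 x) \<in> trig_closure \<mu> \<Lambda>"
      using subsetD[OF all trig_polys_exp[of 0 UNIV 1]] by simp
    have "(\<lambda>x. 1 * fourier_exp 0 x + (-1) * complex_of_real (indicator A x)) \<in> trig_closure \<mu> \<Lambda>"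
      by (rule trig_closure_add[OF \<mu> one IA])
    moreover have "(\<lambda>x. 1 * fourier_exp 0 x + (-1) * complex_of_real (indicator A x))
        = (\<lambda>x. complex_of_real (indicator (UNIV - A) x))" by (auto simp: indicator_def)
    ultimately show "(\<lambda>x. complex_of_real (indicator (UNIV - A) x)) \<in> trig_closure \<mu> \<Lambda>" by simp
  next
    fix A :: "nat \<Rightarrow> 'a set"
    assume dis: "disjoint_family A" and r: "range A \<subseteq> sigma_sets UNIV (Collect closed)"
      and IH: "\<And>i. (\<lambda>x. complex_of_real (indicator (A i) x)) \<in> trig_closure \<mu> \<Lambda>"
    have [measurable]: "A i \<in> sets borel" for i using r bor by auto
    show "(\<lambda>x. complex_of_real (indicator (\<Union>i. A i) x)) \<in> trig_closure \<mu> \<Lambda>"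
    proof (rule trig_closure_dominated[OF \<mu>, where s = "\<lambda>n x. of_real (indicator (\<Union>i<n. A i) x)" and w = "\<lambda>_. 1"])
      fix n
      have "(\<lambda>x. \<Sum>i<n. complex_of_real (indicator (A i) x)) \<in> trig_closure \<mu> \<Lambda>"
        by (intro trig_closure_sum \<mu> IH) auto
      moreover have "indicator (\<Union>i<n. A i) x = (\<Sum>i<n. indicator (A i) x :: real)" for x
        by (rule indicator_UN_disjoint) (use dis in \<open>auto simp: disjoint_family_on_def\<close>)
      ultimately show "(\<lambda>x. complex_of_real (indicator (\<Union>i<n. A i) x)) \<in> trig_closure \<mu> \<Lambda>" by simp
    next
      fix x
      show "(\<lambda>n. complex_of_real (indicator (\<Union>i<n. A i) x)) \<longlonglongrightarrow> complex_of_real (indicator (\<Union>i. A i) x)"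
        by (intro tendsto_of_real LIMSEQ_indicator_UN)
    qed (auto simp: indicator_def)
  qed
qed

lemma trig_closure_L2_all:
  fixes \<mu> :: "'a::euclidean_space measure"
  assumes \<mu>: "borel_prob \<mu>" and cs: "compactly_supported \<mu>" and all: "trig_polys UNIV \<subseteq> trig_closure \<mu> \<Lambda>"
    and f: "f \<in> L2 \<mu>"
  shows "f \<in> trig_closure \<mu> \<Lambda>"
proof -
  have sb [measurable_cong]: "sets \<mu> = sets borel" using \<mu> by auto
  interpret prob_space \<mu> using \<mu> by auto
  have fm [measurable]: "f \<in> borel_measurable \<mu>" using f by (rule L2_measurable)
  obtain s where s: "\<And>i. simple_function \<mu> (s i)" and lim: "\<And>x. x \<in> space \<mu> \<Longrightarrow> (\<lambda>i. s i x) \<longlonglongrightarrow> f x"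
    and bd: "\<And>i x. x \<in> space \<mu> \<Longrightarrow> dist (s i x) 0 \<le> 2 * dist (f x) 0"
    using borel_measurable_implies_sequence_metric[OF fm, of 0] by blast
  have sp: "space \<mu> = UNIV" using sets_eq_imp_space_eq[OF sb] by simp
  show ?thesis
  proof (rule trig_closure_dominated[OF \<mu>, where s = s and w = "\<lambda>x. 2 * cmod (f x)"])
    fix i
    have fin: "finite (range (s i))" using s[of i] by (simp add: simple_function_def sp)
    have m: "s i -` {y} \<in> sets borel" if "y \<in> range (s i)" for y
      using s[of i] that unfolding simple_function_def sp sb by auto
    have "(\<lambda>x. \<Sum>y\<in>range (s i). y * complex_of_real (indicator (s i -` {y}) x)) \<in> trig_closure \<mu> \<Lambda>"
      by (intro trig_closure_sum \<mu> fin trig_closure_scale trig_closure_indicator cs all m)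
    moreover have "(\<Sum>y\<in>range (s i). y * complex_of_real (indicator (s i -` {y}) x)) = s i x" for x
    proof -
      have "(\<Sum>y\<in>range (s i). y * complex_of_real (indicator (s i -` {y}) x))
          = (\<Sum>y\<in>range (s i). if y = s i x then y else 0)"
        by (rule sum.cong) (auto simp: indicator_def)
      thus ?thesis using fin by simp
    qed
    ultimately show "s i \<in> trig_closure \<mu> \<Lambda>" by simp
    show "cmod (s i x) \<le> 2 * cmod (f x)" for x using bd[of x i] sp by simp
  next
    show "(\<lambda>n. s n x) \<longlonglongrightarrow> f x" for x using lim[of x] sp by simp
    show "integrable \<mu> (\<lambda>x. (2 * cmod (f x))\<^sup>2)" using f by (simp add: L2_def power_mult_distrib)
  qed auto
qed

text \<open>Parseval's identity makes every character the limit of combinations of those in \<open>\<Lambda>\<close>, and all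
  characters together span a dense subspace.\<close>

lemma Parseval_imp_spectrum:
  fixes \<mu> :: "'a::euclidean_space measure"
  assumes \<mu>: "borel_prob \<mu>" and cs: "compactly_supported \<mu>" and "countable \<Lambda>"
    and orth: "\<And>v w. v \<in> \<Lambda> \<Longrightarrow> w \<in> \<Lambda> \<Longrightarrow> v \<noteq> w \<Longrightarrow> fourier_transform \<mu> (v - w) = 0"
    and pars: "\<And>\<xi>. ((\<lambda>v. (cmod (fourier_transform \<mu> (\<xi> + v)))\<^sup>2) has_sum 1) \<Lambda>"
  shows "is_spectrum \<mu> \<Lambda>"
proof -
  have exp: "fourier_exp \<eta> \<in> trig_closure \<mu> \<Lambda>" for \<eta>
    unfolding trig_closure_def
  proof (intro CollectI conjI allI impI)
    show "fourier_exp \<eta> \<in> L2 \<mu>" by (rule bounded_L2[OF \<mu>, where B = 1]) auto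
  next
    fix \<epsilon> :: real assume "\<epsilon> > 0"
    then obtain F where F: "finite F" "F \<subseteq> \<Lambda>" 
        "\<bar>(\<Sum>v\<in>F. (cmod (fourier_transform \<mu> (- \<eta> + v)))\<^sup>2) - 1\<bar> < \<epsilon>"
      using has_sum_finite_approx[OF pars[of "- \<eta>"] \<open>\<epsilon> > 0\<close>] by (metis order_refl)
    let ?u = "\<lambda>v. fourier_transform \<mu> (\<eta> - v)"
    have "(LINT x|\<mu>. (cmod (fourier_exp \<eta> x - (\<Sum>v\<in>F. ?u v * fourier_exp v x)))\<^sup>2)
       = 1 - (\<Sum>v\<in>F. (cmod (fourier_transform \<mu> (- (- \<eta> + v))))\<^sup>2)"
      by (subst character_approximation[OF \<mu> F(1) orth]) (use F in auto)
    also have "\<dots> < \<epsilon>" using F(3) by (simp only: cmod_fourier_transform_uminus)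
    finally have "(LINT x|\<mu>. (cmod (fourier_exp \<eta> x - (\<Sum>v\<in>F. ?u v * fourier_exp v x)))\<^sup>2) < \<epsilon>" .
    moreover have "(\<lambda>x. \<Sum>v\<in>F. ?u v * fourier_exp v x) \<in> trig_polys \<Lambda>"
      using F(1,2) by (induction F rule: finite_induct) (auto intro!: trig_polys.zero trig_polys.add)
    ultimately show "\<exists>g\<in>trig_polys \<Lambda>. (LINT x|\<mu>. (cmod (fourier_exp \<eta> x - g x))\<^sup>2) < \<epsilon>"
      by (rule bexI)
  qed
  have all: "trig_polys UNIV \<subseteq> trig_closure \<mu> \<Lambda>"
  proof
    fix f :: "'a \<Rightarrow> complex" assume "f \<in> trig_polys UNIV"
    thus "f \<in> trig_closure \<mu> \<Lambda>"
    proof (induction rule: trig_polys.induct)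
      case zero
      show ?case by (rule trig_polys_closure[OF \<mu> trig_polys.zero])
    next
      case (add v f c)
      show ?case by (rule trig_closure_add[OF \<mu> trig_closure_scale[OF exp] add.IH])
    qed
  qed
  show ?thesis
    unfolding is_spectrum_def orthonormal_basis_L2_def L2_inner_fourier_exp
  proof (intro conjI ballI allI impI)
    show "countable \<Lambda>" by fact
    show "fourier_exp v \<in> L2 \<mu>" for v using trig_closure_L2[OF exp] .
    show "fourier_transform \<mu> (v - w) = (if v = w then 1 else 0)" if "v \<in> \<Lambda>" "w \<in> \<Lambda>" for v w
      using orth that \<mu> by auto
  next
    fix f and \<epsilon> :: real assume "f \<in> L2 \<mu>" "\<epsilon> > 0"
    hence "f \<in> trig_closure \<mu> \<Lambda>" "\<epsilon>\<^sup>2 > 0" using trig_closure_L2_all[OF \<mu> cs all] by auto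
    then obtain g where g: "g \<in> trig_polys \<Lambda>" "(LINT x|\<mu>. (cmod (f x - g x))\<^sup>2) < \<epsilon>\<^sup>2"
      unfolding trig_closure_def by blast
    obtain F u where "finite F" "F \<subseteq> \<Lambda>" "g = (\<lambda>x. \<Sum>v\<in>F. u v * fourier_exp v x)"
      using trig_polys_sum_form[OF g(1)] by blast
    moreover have "L2_norm \<mu> (\<lambda>x. f x - g x) < \<epsilon>"
      unfolding L2_norm_def using real_sqrt_less_mono[OF g(2)] \<open>\<epsilon> > 0\<close> by simp
    ultimately show "\<exists>F u. finite F \<and> F \<subseteq> \<Lambda> \<and> L2_norm \<mu> (\<lambda>x. f x - (\<Sum>v\<in>F. u v * fourier_exp v x)) < \<epsilon>"
      by blast
  qed
qed

section \<open>The self-affine measure and the zeros of its Fourier transform\<close>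

lemma vec2_eqI: "x $ 1 = y $ 1 \<Longrightarrow> x $ 2 = y $ 2 \<Longrightarrow> x = (y :: real^2)"
  by (simp add: vec_eq_iff forall_2)

lemma inner_vec2: "x \<bullet> y = x $ 1 * y $ 1 + x $ 2 * (y :: real^2) $ 2"
  by (simp add: inner_vec_def sum_2)

lemma norm_vec2_le: "norm (z :: real^2) \<le> \<bar>z $ 1\<bar> + \<bar>z $ 2\<bar>"
  using norm_le_l1_cart[of z] by (simp add: sum_2)

lemma integer_lattice_0 [simp]: "0 \<in> integer_lattice"
  and integer_lattice_add: "x \<in> integer_lattice \<Longrightarrow> y \<in> integer_lattice \<Longrightarrow> x + y \<in> integer_lattice"
  and integer_lattice_diff: "x \<in> integer_lattice \<Longrightarrow> y \<in> integer_lattice \<Longrightarrow> x - y \<in> integer_lattice"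
  by (auto simp: integer_lattice_def)

lemma integer_lattice_iff: "z \<in> integer_lattice \<longleftrightarrow> z $ 1 \<in> \<int> \<and> (z :: real^2) $ 2 \<in> \<int>"
  by (simp add: integer_lattice_def forall_2)

lemma inner_integer_lattice: "x \<in> integer_lattice \<Longrightarrow> y \<in> integer_lattice \<Longrightarrow> x \<bullet> (y :: real^2) \<in> \<int>"
  by (auto simp: integer_lattice_iff inner_vec2)

text \<open>Scaling one coordinate turns a triangular matrix with small diagonal into a contraction.\<close>

lemma triangular_contraction:
  fixes \<alpha> \<gamma> \<delta> :: real
  assumes "0 \<le> \<alpha>" "\<alpha> < 1" "0 \<le> \<gamma>" "\<gamma> < 1"
  obtains K r where "K > 0" "0 < r" "r < 1"
    "\<And>x y. K * \<bar>\<alpha> * x\<bar> + \<bar>\<gamma> * y + \<delta> * x\<bar> \<le> r * (K * \<bar>x\<bar> + \<bar>y\<bar>)"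
proof -
  define r where "r = (1 + max \<alpha> \<gamma>) / 2"
  define K where "K = 1 + \<bar>\<delta>\<bar> / (r - \<alpha>)"
  have r: "0 < r" "r < 1" "\<alpha> < r" "\<gamma> < r" using assms by (auto simp: r_def max_def)
  have K: "K > 0" using r by (simp add: K_def add_pos_nonneg)
  have "K * (r - \<alpha>) = (r - \<alpha>) + \<bar>\<delta>\<bar>" using r by (simp add: K_def distrib_right)
  hence "\<bar>\<delta>\<bar> \<le> K * (r - \<alpha>)" using r by linarith
  have "K * \<bar>\<alpha> * x\<bar> + \<bar>\<gamma> * y + \<delta> * x\<bar> \<le> r * (K * \<bar>x\<bar> + \<bar>y\<bar>)" for x y
  proof -
    have "\<bar>\<gamma> * y + \<delta> * x\<bar> \<le> \<gamma> * \<bar>y\<bar> + \<bar>\<delta>\<bar> * \<bar>x\<bar>"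
      using abs_triangle_ineq[of "\<gamma> * y" "\<delta> * x"] assms by (simp add: abs_mult)
    also have "\<dots> \<le> r * \<bar>y\<bar> + (K * (r - \<alpha>)) * \<bar>x\<bar>"
      by (intro add_mono mult_right_mono) (use r \<open>\<bar>\<delta>\<bar> \<le> _\<close> in auto)
    finally show ?thesis using assms by (simp add: abs_mult algebra_simps)
  qed
  thus ?thesis using that K r by blast
qed

text \<open>\<open>T\<close> is the transpose of the matrix \<open>M\<close>, and \<open>S\<close> is its inverse; \<open>b\<close> and \<open>\<beta>\<close> are the diagonal
  entries of \<open>M\<close>.\<close>

locale self_affine_system =
  fixes p :: nat and a :: "real^2" and D :: "(real^2) set" and b \<beta> c :: real and \<mu> :: "(real^2) measure"
  assumes prime_p: "prime p" and a: "a \<in> calE p"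
    and D: "finite D" "card D = p" "0 \<in> D" "D \<subseteq> integer_lattice"
    and b: "b > 1" and \<beta>: "\<beta> > 1"
    and zeros: "zero_set (fourier_transform (mean_dirac D)) =
           (\<Union>j\<in>{1..p-1}. (\<lambda>k. (real j / real p) *\<^sub>R a + k) ` integer_lattice)"
    and self_affine: "self_affine_measure (upper_triangular (inverse b) (inverse \<beta>) c) D \<mu>"
begin

definition T :: "real^2 \<Rightarrow> real^2" where
  "T z = vector [b * z $ 1, c * z $ 1 + \<beta> * z $ 2]"

definition S :: "real^2 \<Rightarrow> real^2" where
  "S z = vector [z $ 1 / b, (z $ 2 - c * (z $ 1 / b)) / \<beta>]"

lemma T_nth [simp]: "T z $ 1 = b * z $ 1" "T z $ 2 = c * z $ 1 + \<beta> * z $ 2"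
  by (simp_all add: T_def)

lemma S_nth [simp]: "S z $ 1 = z $ 1 / b" "S z $ 2 = (z $ 2 - c * (z $ 1 / b)) / \<beta>"
  by (simp_all add: S_def)

lemma T_add: "T (x + y) = T x + T y" and T_diff: "T (x - y) = T x - T y" and T_0 [simp]: "T 0 = 0"
  and T_uminus: "T (- x) = - T x" and T_scale: "T (t *\<^sub>R x) = t *\<^sub>R T x"
  by (rule vec2_eqI; simp add: algebra_simps)+

lemma S_add: "S (x + y) = S x + S y" and S_diff: "S (x - y) = S x - S y" and S_0 [simp]: "S 0 = 0"
  and S_scale: "S (t *\<^sub>R x) = t *\<^sub>R S x"
  using \<beta> b by (auto intro!: vec2_eqI simp: field_simps)

lemma S_T [simp]: "S (T z) = z" and T_S [simp]: "T (S z) = z"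
  using b \<beta> by (auto intro!: vec2_eqI simp: field_simps)

lemma Tn_add: "(T ^^ n) (x + y) = (T ^^ n) x + (T ^^ n) y"
  and Tn_diff: "(T ^^ n) (x - y) = (T ^^ n) x - (T ^^ n) y"
  and Tn_0 [simp]: "(T ^^ n) 0 = 0"
  by (induction n) (simp_all add: T_add T_diff)

lemma Sn_add: "(S ^^ n) (x + y) = (S ^^ n) x + (S ^^ n) y"
  and Sn_0 [simp]: "(S ^^ n) 0 = 0"
  by (induction n) (simp_all add: S_add S_diff)

lemma Sn_Tn [simp]: "(S ^^ n) ((T ^^ n) z) = z" and Tn_Sn [simp]: "(T ^^ n) ((S ^^ n) z) = z"
proof -
  show "(S ^^ n) ((T ^^ n) z) = z" by (induction n) (simp_all add: funpow_swap1[of S])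
  show "(T ^^ n) ((S ^^ n) z) = z" by (induction n) (simp_all add: funpow_swap1[of T])
qed

lemma Sn_Tn_le: "k \<le> n \<Longrightarrow> (S ^^ k) ((T ^^ n) z) = (T ^^ (n - k)) z"
proof -
  assume "k \<le> n"
  hence "(T ^^ n) z = (T ^^ k) ((T ^^ (n - k)) z)" by (metis le_add_diff_inverse funpow_add comp_apply)
  thus ?thesis by simp
qed

lemma Tn_fst: "(T ^^ n) z $ 1 = b ^ n * z $ 1"
  by (induction n) auto

lemma Sn_fst: "(S ^^ n) z $ 1 = z $ 1 / b ^ n"
  by (induction n) auto

lemma S_measurable [measurable]: "S \<in> borel_measurable borel" and T_measurable [measurable]: "T \<in> borel_measurable borel"
proof -
  have "linear S" by (rule linearI) (simp_all add: S_add S_scale)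
  thus "S \<in> borel_measurable borel"
    by (intro borel_measurable_continuous_onI linear_continuous_on linear_conv_bounded_linear[THEN iffD1])
  have "linear T" by (rule linearI) (simp_all add: T_add T_scale)
  thus "T \<in> borel_measurable borel"
    by (intro borel_measurable_continuous_onI linear_continuous_on linear_conv_bounded_linear[THEN iffD1])
qed

subsection \<open>Iterates of the inverse tend to zero\<close>

lemma S_contraction:
  obtains K r where "K > 0" "0 < r" "r < 1"
    "\<And>z. K * \<bar>S z $ 1\<bar> + \<bar>S z $ 2\<bar> \<le> r * (K * \<bar>z $ 1\<bar> + \<bar>z $ 2\<bar>)"
proof -
  have 1: "0 \<le> 1 / b" "1 / b < 1" "0 \<le> 1 / \<beta>" "1 / \<beta> < 1" using b \<beta> by auto
  obtain K r where "K > 0" "0 < r" "r < 1"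
    and *: "\<And>x y. K * \<bar>1 / b * x\<bar> + \<bar>1 / \<beta> * y + (- c / (b * \<beta>)) * x\<bar> \<le> r * (K * \<bar>x\<bar> + \<bar>y\<bar>)"
    using triangular_contraction[OF 1] by blast
  moreover have "K * \<bar>S z $ 1\<bar> + \<bar>S z $ 2\<bar> \<le> r * (K * \<bar>z $ 1\<bar> + \<bar>z $ 2\<bar>)" for z
  proof -
    have "S z $ 2 = (1 / \<beta>) * z $ 2 + (- c / (b * \<beta>)) * z $ 1" "S z $ 1 = 1 / b * z $ 1"
      by (simp_all add: diff_divide_distrib mult.commute)
    thus ?thesis using *[of "z $ 1" "z $ 2"] by (simp only:)
  qed
  ultimately show thesis using that by blast
qed

lemma Sn_tendsto_0: "(\<lambda>n. (S ^^ n) z) \<longlonglongrightarrow> 0"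
proof -
  obtain K r where K: "K > 0" "0 < r" "r < 1"
    and c: "\<And>z. K * \<bar>S z $ 1\<bar> + \<bar>S z $ 2\<bar> \<le> r * (K * \<bar>z $ 1\<bar> + \<bar>z $ 2\<bar>)" using S_contraction by blast
  define N where "N z = K * \<bar>z $ 1\<bar> + \<bar>z $ 2\<bar>" for z :: "real^2"
  have N: "N ((S ^^ n) z) \<le> r ^ n * N z" for n
  proof (induction n)
    case (Suc n)
    have "N ((S ^^ Suc n) z) \<le> r * N ((S ^^ n) z)" using c by (simp add: N_def)
    also have "\<dots> \<le> r * (r ^ n * N z)" using Suc K by (intro mult_left_mono) auto
    finally show ?case by (simp add: mult_ac)
  qed simp
  have bd: "norm z \<le> (1 + 1 / K) * N z" for z
  proof -
    have "(1 + 1 / K) * N z = K * \<bar>z $ 1\<bar> + \<bar>z $ 2\<bar> + \<bar>z $ 1\<bar> + \<bar>z $ 2\<bar> / K" 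
      using K by (simp add: N_def field_simps)
    moreover have "K * \<bar>z $ 1\<bar> \<ge> 0" "\<bar>z $ 2\<bar> / K \<ge> 0" using K by auto
    ultimately show ?thesis using norm_vec2_le[of z] by linarith
  qed
  have lim: "(\<lambda>n. (1 + 1 / K) * (r ^ n * N z)) \<longlonglongrightarrow> (1 + 1 / K) * (0 * N z)"
    by (intro tendsto_intros LIMSEQ_power_zero) (use K in auto)
  have le: "norm ((S ^^ n) z) \<le> (1 + 1 / K) * (r ^ n * N z)" for n
    by (rule order.trans[OF bd]) (use N K in \<open>auto intro!: mult_left_mono add_nonneg_nonneg\<close>)
  show ?thesis
    by (rule Lim_null_comparison[OF _ lim[simplified]]) (use le in \<open>auto simp: eventually_sequentially\<close>)
qed

subsection \<open>The measure\<close>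

lemma p_gt_1: "p > 1" using prime_p prime_gt_1_nat by auto

definition A :: "real^2 \<Rightarrow> real^2" where
  "A x = matrix_inv (upper_triangular (inverse b) (inverse \<beta>) c) *v x"

lemma A_eq: "A x = vector [(x $ 1 - c * (x $ 2 / \<beta>)) / b, x $ 2 / \<beta>]" (is "_ = ?y")
proof -
  let ?M = "upper_triangular (inverse b) (inverse \<beta>) c"
  have "det ?M \<noteq> 0" using b \<beta> by (simp add: det_2 upper_triangular_def)
  hence inv: "invertible ?M" by (simp add: invertible_det_nz)
  have "?M *v ?y = x"
    using b \<beta> by (auto intro!: vec2_eqI simp: matrix_vector_mult_def sum_2 upper_triangular_def)
  hence "A x = (matrix_inv ?M ** ?M) *v ?y" unfolding A_def by (metis matrix_vector_mul_assoc)
  moreover have "matrix_inv ?M ** ?M = mat 1"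
    using someI_ex[OF inv[unfolded invertible_def]] by (simp add: matrix_inv_def)
  ultimately show ?thesis by simp
qed

lemma A_nth [simp]: "A x $ 1 = (x $ 1 - c * (x $ 2 / \<beta>)) / b" "A x $ 2 = x $ 2 / \<beta>"
  by (simp_all add: A_eq)

lemma A_add: "A (x + y) = A x + A y"
  by (simp add: A_def matrix_vector_right_distrib)

lemma A_measurable [measurable]: "A \<in> borel_measurable borel"
  unfolding A_def by (intro borel_measurable_continuous_onI) (simp add: matrix_vector_mult_linear_continuous_on)

lemma S_adjoint: "S \<xi> \<bullet> x = \<xi> \<bullet> A x"
  using b \<beta> by (simp add: inner_vec2 field_simps)

lemma mu: "borel_prob \<mu>"
  using self_affine by (simp add: self_affine_measure_def)

lemma D_ne: "D \<noteq> {}" using D by auto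

lemma mean_dirac: "borel_prob (mean_dirac D)"
  unfolding mean_dirac_def
  using D D_ne by (auto intro!: prob_space.prob_space_distr prob_space_uniform_count_measure)

text \<open>A random point of \<open>\<mu>\<close> is the image under the inverse of \<open>M\<close> of the sum of a random digit and an
  independent random point of \<open>\<mu>\<close>. In this form the Fourier transform of \<open>\<mu>\<close> factors.\<close>

lemma mu_eq_image: "\<mu> = distr (distr (mean_dirac D \<Otimes>\<^sub>M \<mu>) borel (\<lambda>(x, y). x + y)) borel A"
proof -
  interpret m: prob_space "mean_dirac D" using mean_dirac by auto
  interpret n: prob_space \<mu> using mu by auto
  interpret pair_prob_space "mean_dirac D" \<mu> ..
  have [measurable_cong]: "sets \<mu> = sets borel" using mu by auto
  have [measurable_cong]: "sets (mean_dirac D) = sets borel" using mean_dirac by auto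
  show ?thesis
  proof (rule measure_eqI)
    fix B assume "B \<in> sets \<mu>"
    hence B [measurable]: "B \<in> sets borel" using mu by auto
    define Q where "Q = (\<lambda>(x, y). A (x + y)) -` B \<inter> space (mean_dirac D \<Otimes>\<^sub>M \<mu>)"
    define f where "f x = emeasure \<mu> (Pair x -` Q)" for x
    have "Q \<in> sets (mean_dirac D \<Otimes>\<^sub>M \<mu>)" unfolding Q_def by measurable
    hence fm: "f \<in> borel_measurable (mean_dirac D)"
      unfolding f_def by (rule n.measurable_emeasure_Pair)
    have sp: "space (mean_dirac D) = UNIV" "space \<mu> = UNIV"
      using mean_dirac mu by (auto dest!: sets_eq_imp_space_eq)
    have f_eq: "f x = emeasure (distr \<mu> borel (\<lambda>y. A (y + x))) B" for x
      unfolding f_def Q_def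
      by (subst emeasure_distr) (auto simp: space_pair_measure sp add.commute intro!: arg_cong[where f = "emeasure \<mu>"])
    have "emeasure (distr (distr (mean_dirac D \<Otimes>\<^sub>M \<mu>) borel (\<lambda>(x, y). x + y)) borel A) B
       = emeasure (mean_dirac D \<Otimes>\<^sub>M \<mu>) ((\<lambda>(x, y). A (x + y)) -` B \<inter> space (mean_dirac D \<Otimes>\<^sub>M \<mu>))"
      by (subst distr_distr) (auto simp: emeasure_distr comp_def split_beta')
    also have "\<dots> = (\<integral>\<^sup>+x. f x \<partial>mean_dirac D)"
      unfolding f_def Q_def by (rule n.emeasure_pair_measure_alt) measurable
    also have "\<dots> = (\<integral>\<^sup>+x. f x \<partial>uniform_count_measure D)"
      using fm unfolding mean_dirac_def
      by (intro nn_integral_distr)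
         (auto simp: measurable_def space_uniform_count_measure sets_uniform_count_measure)
    also have "\<dots> = (\<Sum>d\<in>D. ennreal (1 / real p) * f d)"
      unfolding uniform_count_measure_def D(2) by (rule nn_integral_point_measure_finite[OF D(1)])
    also have "\<dots> = (\<Sum>d\<in>D. ennreal (1 / real p) * emeasure (distr \<mu> borel (\<lambda>y. A (y + d))) B)"
      by (simp only: f_eq)
    also have "\<dots> = (\<Sum>d\<in>D. emeasure (distr \<mu> borel (\<lambda>y. A (y + d))) B) / of_nat p"
      unfolding sum_distrib_left[symmetric] using p_gt_1
      by (simp add: divide_ennreal_def inverse_eq_divide[symmetric] mult.commute
           ennreal_of_nat_eq_real_of_nat inverse_ennreal)
    also have "\<dots> = emeasure \<mu> B"
      using self_affine B D(2) unfolding self_affine_measure_def A_def by simp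
    finally show "emeasure \<mu> B = emeasure (distr (distr (mean_dirac D \<Otimes>\<^sub>M \<mu>) borel (\<lambda>(x, y). x + y)) borel A) B" ..
  qed (use mu in auto)
qed

definition m :: "real^2 \<Rightarrow> complex" where "m = fourier_transform (mean_dirac D)"

definition \<phi> :: "real^2 \<Rightarrow> complex" where "\<phi> = fourier_transform \<mu>"

lemma phi_refine: "\<phi> \<xi> = m (S \<xi>) * \<phi> (S \<xi>)"
proof -
  have "\<phi> \<xi> = fourier_transform (distr (mean_dirac D \<Otimes>\<^sub>M \<mu>) borel (\<lambda>(x, y). x + y)) (S \<xi>)"
    unfolding \<phi>_def
    by (subst mu_eq_image, rule fourier_transform_distr_adjoint[OF _ _ S_adjoint])
       (use fourier_transform_convolution(1)[OF mean_dirac mu] in auto)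
  also have "\<dots> = m (S \<xi>) * \<phi> (S \<xi>)"
    unfolding m_def \<phi>_def by (rule fourier_transform_convolution(2)[OF mean_dirac mu])
  finally show ?thesis .
qed

lemma phi_0 [simp]: "\<phi> 0 = 1" and phi_le_1: "cmod (\<phi> \<xi>) \<le> 1" and phi_cont: "continuous_on X \<phi>"
  and m_0 [simp]: "m 0 = 1" and m_le_1: "cmod (m \<xi>) \<le> 1" and m_cont: "continuous_on X m"
  unfolding \<phi>_def m_def using mu mean_dirac
  by (auto intro!: norm_fourier_transform_le continuous_fourier_transform)

text \<open>In a suitable norm all the maps \<open>x \<mapsto> A (x + d)\<close> shrink the excess of a point over the radius \<open>R\<close> by a
  factor \<open>r < 1\<close>. Invariance then bounds the mass with excess above \<open>t\<close> by the mass with excess above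
  \<open>t/r\<close>, and by iteration that mass is zero.\<close>

lemma compactly_supported_mu: "compactly_supported \<mu>"
proof -
  interpret prob_space \<mu> using mu by auto
  have [measurable_cong]: "sets \<mu> = sets borel" using mu by auto
  have 1: "0 \<le> 1 / \<beta>" "1 / \<beta> < 1" "0 \<le> 1 / b" "1 / b < 1" using b \<beta> by auto
  obtain K r where K: "K > 0" "0 < r" "r < 1"
    and *: "\<And>x y. K * \<bar>1 / \<beta> * x\<bar> + \<bar>1 / b * y + (- c / (b * \<beta>)) * x\<bar> \<le> r * (K * \<bar>x\<bar> + \<bar>y\<bar>)"
    using triangular_contraction[OF 1] by blast
  define N where "N z = K * \<bar>z $ 2\<bar> + \<bar>z $ 1\<bar>" for z :: "real^2"
  have NA: "N (A z) \<le> r * N z" for z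
  proof -
    have "(1 / b) * z $ 1 + (- c / (b * \<beta>)) * z $ 2 = A z $ 1"
      using b \<beta> by (simp add: field_simps)
    thus ?thesis using *[of "z $ 2" "z $ 1"] by (simp add: N_def)
  qed
  have Nadd: "N (x + y) \<le> N x + N y" for x y
  proof -
    have "K * \<bar>x $ 2 + y $ 2\<bar> \<le> K * (\<bar>x $ 2\<bar> + \<bar>y $ 2\<bar>)" using K by (intro mult_left_mono) auto
    thus ?thesis using abs_triangle_ineq[of "x $ 1" "y $ 1"] by (simp add: N_def algebra_simps)
  qed
  define C where "C = (\<Sum>d\<in>D. N d)"
  have N0: "N x \<ge> 0" for x using K by (simp add: N_def)
  have NC: "N d \<le> C" if "d \<in> D" for d unfolding C_def using D(1) that N0 by (intro member_le_sum) auto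
  define R where "R = r * C / (1 - r)"
  have R: "R = r * (R + C)" using K by (simp add: R_def field_simps)
  have step: "N (A (x + d)) - R \<le> r * (N x - R)" if "d \<in> D" for x d
  proof -
    have "N (A (x + d)) \<le> r * (N x + C)"
      by (rule order.trans[OF NA], rule mult_left_mono) (use Nadd[of x d] NC[OF that] K in auto)
    thus ?thesis using R by (simp add: algebra_simps)
  qed
  have Ncont: "continuous_on UNIV N" unfolding N_def by (intro continuous_intros)
  have Nm [measurable]: "N \<in> borel_measurable borel" by (intro borel_measurable_continuous_onI Ncont)
  define U where "U t = {x. N x > R + t}" for t
  have U [measurable]: "U t \<in> sets borel" for t unfolding U_def by measurable
  have decay: "measure \<mu> (U t) \<le> measure \<mu> (U (t / r))" for t
  proof -
    have "emeasure \<mu> (U t) = (\<Sum>d\<in>D. emeasure (distr \<mu> borel (\<lambda>x. A (x + d))) (U t)) / of_nat p"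
      using self_affine U D(2) unfolding self_affine_measure_def A_def by simp
    also have "\<dots> \<le> (\<Sum>d\<in>D. emeasure \<mu> (U (t / r))) / of_nat p"
    proof (intro divide_right_mono_ennreal sum_mono)
      fix d assume d: "d \<in> D"
      have "emeasure (distr \<mu> borel (\<lambda>x. A (x + d))) (U t) = emeasure \<mu> ((\<lambda>x. A (x + d)) -` U t \<inter> space \<mu>)"
        by (rule emeasure_distr) auto
      also have "\<dots> \<le> emeasure \<mu> (U (t / r))"
      proof (rule emeasure_mono)
        show "(\<lambda>x. A (x + d)) -` U t \<inter> space \<mu> \<subseteq> U (t / r)"
        proof
          fix x assume "x \<in> (\<lambda>x. A (x + d)) -` U t \<inter> space \<mu>"
          hence "t < r * (N x - R)" using step[OF d, of x] by (auto simp: U_def)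
          thus "x \<in> U (t / r)" using K by (simp add: U_def field_simps)
        qed
      qed auto
      finally show "emeasure (distr \<mu> borel (\<lambda>x. A (x + d))) (U t) \<le> emeasure \<mu> (U (t / r))" .
    qed
    also have "\<dots> = emeasure \<mu> (U (t / r))"
    proof -
      have "(of_nat p :: ennreal) \<noteq> 0" "(of_nat p :: ennreal) \<noteq> \<top>" using p_gt_1 by auto
      thus ?thesis by (simp add: D(2) mult.commute[of "of_nat p"] mult_divide_eq_ennreal)
    qed
    finally show ?thesis by (simp add: emeasure_eq_measure)
  qed
  have "measure \<mu> (U 1) \<le> measure \<mu> (U ((1 / r) ^ n))" for n
  proof (induction n)
    case (Suc n)
    thus ?case using decay[of "(1 / r) ^ n"] by (simp add: field_simps)
  qed simp
  moreover have "(\<lambda>n. measure \<mu> (U ((1 / r) ^ n))) \<longlonglongrightarrow> measure \<mu> (\<Inter>n. U ((1 / r) ^ n))"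
  proof (rule finite_Lim_measure_decseq)
    show "decseq (\<lambda>n. U ((1 / r) ^ n))"
    proof (rule decseq_SucI)
      fix n
      have "(1 / r) ^ n \<le> (1 / r) ^ Suc n" using K by (intro power_increasing) auto
      thus "U ((1 / r) ^ Suc n) \<le> U ((1 / r) ^ n)" unfolding U_def by force
    qed
  qed auto
  moreover have "(\<Inter>n. U ((1 / r) ^ n)) = {}"
  proof -
    have "\<exists>n. N x - R < (1 / r) ^ n" for x using real_arch_pow[of "1 / r" "N x - R"] K by auto
    hence "\<exists>n. x \<notin> U ((1 / r) ^ n)" for x
      unfolding U_def mem_Collect_eq by (metis add.commute less_diff_eq not_less_iff_gr_or_eq diff_less_eq)
    thus ?thesis by blast
  qed
  ultimately have "measure \<mu> (U 1) \<le> 0" by (intro LIMSEQ_le_const) auto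
  hence "emeasure \<mu> (U 1) = 0" by (simp add: emeasure_eq_measure measure_le_0_iff)
  moreover have "- {x. N x \<le> R + 1} = U 1" by (auto simp: U_def)
  moreover have "compact {x. N x \<le> R + 1}"
    unfolding compact_eq_bounded_closed
  proof
    show "closed {x. N x \<le> R + 1}" using Ncont by (intro closed_Collect_le continuous_intros) auto
    have "norm x \<le> (1 + 1 / K) * (R + 1)" if "N x \<le> R + 1" for x
    proof -
      have "norm x \<le> \<bar>x $ 1\<bar> + \<bar>x $ 2\<bar>" by (rule norm_vec2_le)
      also have "\<dots> \<le> (1 + 1 / K) * N x"
      proof -
        have "(1 + 1 / K) * N x = K * \<bar>x $ 2\<bar> + \<bar>x $ 2\<bar> + \<bar>x $ 1\<bar> + \<bar>x $ 1\<bar> / K" 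
          using K by (simp add: N_def field_simps)
        moreover have "K * \<bar>x $ 2\<bar> \<ge> 0" "\<bar>x $ 1\<bar> / K \<ge> 0" using K by auto
        ultimately show ?thesis by linarith
      qed
      also have "\<dots> \<le> (1 + 1 / K) * (R + 1)" using that K by (intro mult_left_mono) auto
      finally show ?thesis .
    qed
    thus "bounded {x. N x \<le> R + 1}" unfolding bounded_iff by blast
  qed
  ultimately show ?thesis unfolding compactly_supported_def by metis
qed

subsection \<open>The mask\<close>

lemma m_eq: "m \<xi> = (\<Sum>d\<in>D. fourier_exp \<xi> d) / of_nat p"
proof -
  have "m \<xi> = (LINT x|uniform_count_measure D. fourier_exp \<xi> x)"
    unfolding m_def fourier_transform_def mean_dirac_def
    by (rule integral_distr[OF _ borel_measurable_fourier_exp])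
       (auto simp: measurable_def space_uniform_count_measure sets_uniform_count_measure)
  also have "\<dots> = (\<Sum>d\<in>D. (1 / real p) *\<^sub>R fourier_exp \<xi> d)"
    unfolding uniform_count_measure_def D(2) by (rule lebesgue_integral_point_measure_finite[OF D(1)]) simp
  finally show ?thesis
    by (simp add: scaleR_conv_of_real sum_divide_distrib)
qed

lemma m_periodic: "k \<in> integer_lattice \<Longrightarrow> m (\<xi> + k) = m \<xi>"
proof -
  assume k: "k \<in> integer_lattice"
  have "fourier_exp k d = 1" if "d \<in> D" for d
    by (intro fourier_exp_Ints inner_integer_lattice k) (use that D in auto)
  thus ?thesis unfolding m_eq fourier_exp_add_left by simp
qed

definition Z0 :: "(real^2) set" where "Z0 = {z. m z = 0}"

lemma Z0_eq: "Z0 = (\<Union>j\<in>{1..p-1}. (\<lambda>k. (real j / real p) *\<^sub>R a + k) ` integer_lattice)"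
  using zeros by (simp add: zero_set_def Z0_def m_def)

lemma Z0_add_lattice: "z \<in> Z0 \<Longrightarrow> k \<in> integer_lattice \<Longrightarrow> z + k \<in> Z0"
  by (simp add: Z0_def m_periodic)

lemma zero_notin_Z0 [simp]: "0 \<notin> Z0" by (simp add: Z0_def)

text \<open>Where the mask has modulus one, all its summands agree with the summand of the digit \<open>0\<close>. Such a
  point is a period of the mask, hence of its zero set.\<close>

lemma m_abs_1:
  assumes "cmod (m z) = 1"
  shows "z \<in> integer_lattice"
proof -
  have p0: "real p > 0" using p_gt_1 by simp
  have "cmod (\<Sum>d\<in>D. fourier_exp z d) = real p"
    using assms p0 unfolding m_eq by (simp add: norm_divide field_simps)
  have one: "fourier_exp z d = 1" if d: "d \<in> D" for d
  proof (cases "d = 0")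
    case False
    let ?r = "\<Sum>x\<in>D - {0} - {d}. fourier_exp z x"
    have "(\<Sum>x\<in>D. fourier_exp z x) = (1 + fourier_exp z d) + ?r"
      using sum.remove[OF D(1) D(3), of "fourier_exp z"]
        sum.remove[of "D - {0}" d "fourier_exp z"] D(1) d False by (simp add: add.assoc)
    hence "real p \<le> cmod (1 + fourier_exp z d) + cmod ?r"
      using \<open>cmod _ = real p\<close> norm_triangle_ineq[of "1 + fourier_exp z d" ?r] by simp
    moreover have "cmod ?r \<le> (\<Sum>x\<in>D - {0} - {d}. 1)" by (rule sum_norm_le) simp
    moreover have "(\<Sum>x\<in>D - {0} - {d}. 1 :: real) = real p - 2"
    proof -
      have "card (D - {0} - {d}) = p - 2" using D d False by (simp add: card_Diff_singleton)
      thus ?thesis using p_gt_1 by (simp add: of_nat_diff)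
    qed
    ultimately have "2 \<le> cmod (1 + fourier_exp z d)" by linarith
    hence "4 \<le> (cmod (1 + fourier_exp z d))\<^sup>2" using power_mono[of 2 "cmod (1 + fourier_exp z d)" 2] by simp
    moreover have n1: "(Re (fourier_exp z d))\<^sup>2 + (Im (fourier_exp z d))\<^sup>2 = 1"
      using norm_fourier_exp[of z d] by (simp add: cmod_power2[symmetric] del: norm_fourier_exp)
    moreover have "(cmod (1 + fourier_exp z d))\<^sup>2 = 1 + 2 * Re (fourier_exp z d) + ((Re (fourier_exp z d))\<^sup>2 + (Im (fourier_exp z d))\<^sup>2)"
      unfolding cmod_power2 by (simp add: power2_eq_square algebra_simps)
    ultimately have "Re (fourier_exp z d) \<ge> 1" by simp
    hence "Re (fourier_exp z d) = 1" using complex_Re_le_cmod[of "fourier_exp z d"] by simp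
    thus ?thesis using n1 by (simp add: complex_eq_iff)
  qed simp
  have per: "m (w + z) = m w" for w
    unfolding m_eq fourier_exp_add_left using one by simp
  have 1: "1 \<in> {1..p-1}" using p_gt_1 by auto
  have "(real 1 / real p) *\<^sub>R a + 0 \<in> Z0" unfolding Z0_eq using 1 by (blast intro: integer_lattice_0)
  hence "(real 1 / real p) *\<^sub>R a + z \<in> Z0" unfolding Z0_def using per by simp
  then obtain j k where j: "j \<in> {1..p-1}" and k: "k \<in> integer_lattice"
     and e: "(real 1 / real p) *\<^sub>R a + z = (real j / real p) *\<^sub>R a + k" unfolding Z0_eq by blast
  show ?thesis
  proof (cases "j = 1")
    case True
    thus ?thesis using e k by simp
  next
    case False
    hence j1: "j - 1 \<in> {1..p-1}" using j by auto
    have "z = (real (j - 1) / real p) *\<^sub>R a + k"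
      using e j by (simp add: of_nat_diff algebra_simps diff_divide_distrib)
    hence "z \<in> Z0" unfolding Z0_eq using j1 k by blast
    thus ?thesis using assms by (simp add: Z0_def)
  qed
qed

text \<open>The vanishing of \<open>m\<close> at the multiples of \<open>a/p\<close> says that their \<open>p\<close> characters are orthogonal on the \<open>p\<close>
  digits. A square matrix with orthogonal rows has orthogonal columns, and the sum of squares is a
  quadratic form in the columns. Concretely, the digits are distinct modulo the kernel of the character
  of \<open>a/p\<close>.\<close>

lemma sum_m_translates: "(\<Sum>j<p. (cmod (m (\<zeta> + (real j / real p) *\<^sub>R a)))\<^sup>2) = 1"
proof -
  have p0: "p \<noteq> 0" using p_gt_1 by simp
  let ?E = "\<lambda>d. \<Sum>j<p. fourier_exp ((real j / real p) *\<^sub>R a) d"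
  have shift: "m ((real j / real p) *\<^sub>R a) = (if j = 0 then 1 else 0)" if "j < p" for j
  proof (cases "j = 0")
    case False
    hence "j \<in> {1..p-1}" using that by auto
    hence "(real j / real p) *\<^sub>R a + 0 \<in> Z0" unfolding Z0_eq by (blast intro: integer_lattice_0)
    thus ?thesis using False by (simp add: Z0_def)
  qed simp
  have aint: "a \<in> integer_lattice"
    using a by (auto simp: calE_def integer_lattice_iff)
  have geo: "?E x = (if fourier_exp ((1 / real p) *\<^sub>R a) x = 1 then of_nat p else 0)" if "x \<in> integer_lattice" for x
  proof -
    let ?q = "fourier_exp ((1 / real p) *\<^sub>R a) x"
    have pw: "fourier_exp ((real j / real p) *\<^sub>R a) x = ?q ^ j" for j
    proof -
      have "?q ^ j = cis (real j * (- 2 * pi * (((1 / real p) *\<^sub>R a) \<bullet> x)))"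
        unfolding fourier_exp_cis by (rule Complex.DeMoivre)
      also have "real j * (- 2 * pi * (((1 / real p) *\<^sub>R a) \<bullet> x)) = - 2 * pi * (((real j / real p) *\<^sub>R a) \<bullet> x)"
        by simp
      finally show ?thesis by (simp only: fourier_exp_cis)
    qed
    have qp: "?q ^ p = 1"
      unfolding pw[symmetric] using p0 inner_integer_lattice[OF aint that] by (simp add: fourier_exp_Ints)
    show ?thesis unfolding pw using qp by (simp add: sum_gp_strict)
  qed
  have E_diff: "?E (d - d') = (if d = d' then of_nat p else 0)" if d: "d \<in> D" "d' \<in> D" for d d'
  proof -
    have "(\<Sum>x\<in>D. ?E (x - d')) = (\<Sum>j<p. \<Sum>x\<in>D. fourier_exp ((real j / real p) *\<^sub>R a) (x - d'))"
      by (rule sum.swap)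
    also have "\<dots> = (\<Sum>j<p. fourier_exp ((real j / real p) *\<^sub>R a) (- d') * (of_nat p * m ((real j / real p) *\<^sub>R a)))"
    proof (rule sum.cong[OF refl])
      fix j
      have "(\<Sum>x\<in>D. fourier_exp ((real j / real p) *\<^sub>R a) (x - d'))
         = (\<Sum>x\<in>D. fourier_exp ((real j / real p) *\<^sub>R a) (- d') * fourier_exp ((real j / real p) *\<^sub>R a) x)"
        by (subst fourier_exp_add_right[symmetric]) simp
      thus "(\<Sum>x\<in>D. fourier_exp ((real j / real p) *\<^sub>R a) (x - d'))
         = fourier_exp ((real j / real p) *\<^sub>R a) (- d') * (of_nat p * m ((real j / real p) *\<^sub>R a))"
        using p0 by (simp add: m_eq sum_distrib_left[symmetric])
    qed
    also have "\<dots> = (\<Sum>j<p. if j = 0 then of_nat p else 0)"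
      by (rule sum.cong[OF refl]) (simp add: shift)
    also have "\<dots> = of_nat p" using p0 by simp
    finally have tot: "(\<Sum>x\<in>D. ?E (x - d')) = of_nat p" .
    let ?X = "{x\<in>D. fourier_exp ((1 / real p) *\<^sub>R a) (x - d') = 1}"
    have "(\<Sum>x\<in>D. ?E (x - d')) = (\<Sum>x\<in>D. if fourier_exp ((1 / real p) *\<^sub>R a) (x - d') = 1 then of_nat p else 0)"
      by (rule sum.cong[OF refl], rule geo, rule integer_lattice_diff) (use d D in auto)
    also have "\<dots> = of_nat (card ?X) * of_nat p"
      using D(1) by (simp add: sum.If_cases Int_def)
    finally have "(of_nat (card ?X) :: complex) = of_nat 1" using tot p0 by simp
    hence "card ?X = 1" by (simp only: of_nat_eq_iff)
    then obtain x where x: "?X = {x}" by (rule card_1_singletonE)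
    have "d' \<in> ?X" using d by simp
    hence "?X = {d'}" unfolding x by simp
    moreover have "d - d' \<in> integer_lattice" by (rule integer_lattice_diff) (use d D in auto)
    ultimately have "fourier_exp ((1 / real p) *\<^sub>R a) (d - d') = 1 \<longleftrightarrow> d = d'" using d(1) by blast
    thus ?thesis using geo[OF \<open>d - d' \<in> integer_lattice\<close>] by simp
  qed
  have "complex_of_real (\<Sum>j<p. (cmod (m (\<zeta> + (real j / real p) *\<^sub>R a)))\<^sup>2)
     = (\<Sum>j<p. m (\<zeta> + (real j / real p) *\<^sub>R a) * cnj (m (\<zeta> + (real j / real p) *\<^sub>R a)))"
    by (simp only: of_real_sum complex_norm_square)
  also have "\<dots> = (\<Sum>j<p. \<Sum>d\<in>D. \<Sum>d'\<in>D. fourier_exp \<zeta> (d - d') * fourier_exp ((real j / real p) *\<^sub>R a) (d - d') / of_nat (p * p))"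
  proof (rule sum.cong[OF refl])
    fix j
    let ?w = "\<zeta> + (real j / real p) *\<^sub>R a"
    have c: "fourier_exp ?w d * cnj (fourier_exp ?w d') = fourier_exp ?w (d - d')" for d d'
      by (simp add: fourier_exp_cis cis_cnj cis_mult inner_diff_right algebra_simps)
    have "m ?w * cnj (m ?w) = (\<Sum>d\<in>D. \<Sum>d'\<in>D. fourier_exp ?w d * cnj (fourier_exp ?w d')) / of_nat (p * p)"
      unfolding m_eq by (simp add: sum_product cnj_sum)
    also have "\<dots> = (\<Sum>d\<in>D. \<Sum>d'\<in>D. fourier_exp \<zeta> (d - d') * fourier_exp ((real j / real p) *\<^sub>R a) (d - d') / of_nat (p * p))"
      unfolding c unfolding fourier_exp_add_left by (simp only: sum_divide_distrib)
    finally show "m ?w * cnj (m ?w) = \<dots>" .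
  qed
  also have "\<dots> = (\<Sum>d\<in>D. \<Sum>d'\<in>D. \<Sum>j<p. fourier_exp \<zeta> (d - d') * fourier_exp ((real j / real p) *\<^sub>R a) (d - d') / of_nat (p * p))"
    by (subst sum.swap, rule sum.cong[OF refl], subst sum.swap, rule refl)
  also have "\<dots> = (\<Sum>d\<in>D. \<Sum>d'\<in>D. fourier_exp \<zeta> (d - d') * ?E (d - d') / of_nat (p * p))"
    by (simp only: sum_divide_distrib sum_distrib_left)
  also have "\<dots> = (\<Sum>d\<in>D. \<Sum>d'\<in>D. if d' = d then 1 / of_nat p else 0)"
    by (intro sum.cong refl) (use p0 in \<open>auto simp: E_diff\<close>)
  also have "\<dots> = 1" using D p0 by simp
  finally show ?thesis by (metis of_real_eq_1_iff)
qed

subsection \<open>The infinite product and its zeros\<close>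

definition mprod :: "nat \<Rightarrow> real^2 \<Rightarrow> complex" where
  "mprod n \<xi> = (\<Prod>k\<in>{1..n}. m ((S ^^ k) \<xi>))"

lemma mprod_0 [simp]: "mprod 0 \<xi> = 1" and mprod_Suc: "mprod (Suc n) \<xi> = mprod n \<xi> * m ((S ^^ Suc n) \<xi>)"
  by (simp_all add: mprod_def prod.nat_ivl_Suc')

lemma phi_iterate: "\<phi> \<xi> = mprod n \<xi> * \<phi> ((S ^^ n) \<xi>)"
proof (induction n)
  case (Suc n)
  have "\<phi> ((S ^^ n) \<xi>) = m ((S ^^ Suc n) \<xi>) * \<phi> ((S ^^ Suc n) \<xi>)" 
    using phi_refine[of "(S ^^ n) \<xi>"] by simp
  thus ?case using Suc by (simp only: mprod_Suc mult.assoc)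
qed simp

lemma phi_Sn_tendsto: "(\<lambda>n. \<phi> ((S ^^ n) \<xi>)) \<longlonglongrightarrow> 1"
proof -
  have "isCont \<phi> 0" using phi_cont[of UNIV] by (simp add: continuous_on_eq_continuous_at)
  from isCont_tendsto_compose[OF this Sn_tendsto_0] show ?thesis by simp
qed

text \<open>The tails \<open>\<phi> (S\<^sup>n \<xi>)\<close> of the product tend to \<open>\<phi> 0 = 1\<close>.\<close>

lemma mprod_tendsto: "(\<lambda>n. mprod n \<xi>) \<longlonglongrightarrow> \<phi> \<xi>"
proof -
  have "\<forall>\<^sub>F n in sequentially. \<phi> ((S ^^ n) \<xi>) \<noteq> 0"
    using tendsto_imp_eventually_ne[OF phi_Sn_tendsto] by simp
  hence ev: "\<forall>\<^sub>F n in sequentially. \<phi> \<xi> / \<phi> ((S ^^ n) \<xi>) = mprod n \<xi>"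
    by eventually_elim (metis phi_iterate nonzero_mult_div_cancel_right)
  have "(\<lambda>n. \<phi> \<xi> / \<phi> ((S ^^ n) \<xi>)) \<longlonglongrightarrow> \<phi> \<xi> / 1"
    by (intro tendsto_intros phi_Sn_tendsto) auto
  thus ?thesis using Lim_transform_eventually[OF _ ev] by simp
qed

lemma mprod_le_1: "cmod (mprod n \<xi>) \<le> 1"
  unfolding mprod_def prod_norm[symmetric] by (intro prod_le_1) (auto simp: m_le_1)

lemma phi_le_phi_Sn: "cmod (\<phi> \<xi>) \<le> cmod (\<phi> ((S ^^ n) \<xi>))"
proof -
  have "cmod (\<phi> \<xi>) = cmod (mprod n \<xi>) * cmod (\<phi> ((S ^^ n) \<xi>))"
    by (subst phi_iterate[of _ n]) (simp add: norm_mult)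
  also have "\<dots> \<le> 1 * cmod (\<phi> ((S ^^ n) \<xi>))" by (intro mult_right_mono mprod_le_1) auto
  finally show ?thesis by simp
qed

lemma phi_Sn_mono: "j \<le> n \<Longrightarrow> cmod (\<phi> ((S ^^ j) \<xi>)) \<le> cmod (\<phi> ((S ^^ n) \<xi>))"
proof -
  assume "j \<le> n"
  hence "(S ^^ (n - j)) ((S ^^ j) \<xi>) = (S ^^ n) \<xi>" by (metis funpow_add comp_apply le_add_diff_inverse2)
  thus ?thesis using phi_le_phi_Sn[of "(S ^^ j) \<xi>" "n - j"] by simp
qed

lemma phi_le_mprod: "cmod (\<phi> \<xi>) \<le> cmod (mprod n \<xi>)"
proof -
  have "cmod (\<phi> \<xi>) = cmod (mprod n \<xi>) * cmod (\<phi> ((S ^^ n) \<xi>))"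
    by (subst phi_iterate[of _ n]) (simp add: norm_mult)
  also have "\<dots> \<le> cmod (mprod n \<xi>) * 1" by (intro mult_left_mono phi_le_1) auto
  finally show ?thesis by simp
qed

lemma phi_Tn_Z0: "k \<ge> 1 \<Longrightarrow> z \<in> Z0 \<Longrightarrow> \<phi> ((T ^^ k) z) = 0"
proof -
  assume k: "k \<ge> 1" and z: "z \<in> Z0"
  have "mprod k ((T ^^ k) z) = 0"
    unfolding mprod_def prod_zero_iff[OF finite_atLeastAtMost] using k z
    by (intro bexI[of _ k]) (auto simp: Z0_def)
  thus ?thesis using phi_iterate[of "(T ^^ k) z" k] by simp
qed

lemma phi_zeroE:
  assumes "\<phi> \<xi> = 0"
  obtains k z where "k \<ge> 1" "z \<in> Z0" "\<xi> = (T ^^ k) z"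
proof -
  have "\<forall>\<^sub>F n in sequentially. \<phi> ((S ^^ n) \<xi>) \<noteq> 0"
    using tendsto_imp_eventually_ne[OF phi_Sn_tendsto] by simp
  then obtain n where "\<phi> ((S ^^ n) \<xi>) \<noteq> 0" by (auto simp: eventually_sequentially)
  hence "mprod n \<xi> = 0" using assms phi_iterate[of \<xi> n] by simp
  then obtain k where "k \<in> {1..n}" "m ((S ^^ k) \<xi>) = 0"
    unfolding mprod_def by (auto simp: prod_zero_iff)
  thus ?thesis using that[of k "(S ^^ k) \<xi>"] by (simp add: Z0_def)
qed

lemma Tn_Z0_ne: "z \<in> Z0 \<Longrightarrow> (T ^^ k) z \<noteq> 0"
  by (metis Sn_Tn Sn_0 zero_notin_Z0)

lemma char_fun_Sn: "char_fun g \<Longrightarrow> char_fun (\<lambda>\<xi>. g ((S ^^ k) \<xi>))"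
proof -
  assume g: "char_fun g"
  have adj: "(S ^^ k) \<xi> \<bullet> x = \<xi> \<bullet> (A ^^ k) x" for \<xi> x
  proof (induction k arbitrary: x)
    case (Suc k)
    have "(S ^^ Suc k) \<xi> \<bullet> x = (S ^^ k) \<xi> \<bullet> A x" by (simp add: S_adjoint)
    also have "\<dots> = \<xi> \<bullet> (A ^^ k) (A x)" by (rule Suc)
    also have "(A ^^ k) (A x) = (A ^^ Suc k) x" by (simp add: funpow_swap1)
    finally show ?case .
  qed simp
  have "(A ^^ k) \<in> borel_measurable borel" by (induction k) (auto simp: comp_def)
  thus ?thesis using char_fun_comp[OF g _ adj] by blast
qed

lemma char_fun_phi: "char_fun \<phi>" and char_fun_m: "char_fun m"
  unfolding \<phi>_def m_def by (intro char_funI mu mean_dirac)+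

lemma char_fun_mprod: "char_fun (mprod n)"
proof -
  have "char_fun (\<lambda>\<xi>. \<Prod>k\<in>{1..n}. m ((S ^^ k) \<xi>))"
    by (intro char_fun_prod char_fun_Sn char_fun_m) auto
  thus ?thesis by (simp add: mprod_def[abs_def])
qed

text \<open>The partial products are Fourier transforms of probability measures, for which frequencies separated at
  a level up to \<open>n\<close> are orthogonal.\<close>

lemma Bessel_mprod:
  assumes "finite F" and "\<And>v w. v \<in> F \<Longrightarrow> w \<in> F \<Longrightarrow> v \<noteq> w \<Longrightarrow> \<exists>k z. 1 \<le> k \<and> k \<le> n \<and> z \<in> Z0 \<and> v - w = (T ^^ k) z"
  shows "(\<Sum>v\<in>F. (cmod (mprod n (\<xi> + v)))\<^sup>2) \<le> 1"
proof (rule Bessel_char_fun[OF char_fun_mprod assms(1)])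
  fix v w assume "v \<in> F" "w \<in> F" "v \<noteq> w"
  then obtain k z where k: "1 \<le> k" "k \<le> n" "z \<in> Z0" "v - w = (T ^^ k) z" using assms(2) by blast
  thus "mprod n (v - w) = 0"
    unfolding mprod_def prod_zero_iff[OF finite_atLeastAtMost] by (intro bexI[of _ k]) (auto simp: Z0_def)
qed

subsection \<open>Building a spectrum level by level\<close>

text \<open>If \<open>\<phi>\<close> has no common zero on any coset of \<open>G\<close>, it is bounded away from zero on suitable
  representatives, uniformly in the coset.\<close>

lemma uniform_nonvanishing:
  assumes K: "compact K" "K \<subseteq> V" and cover: "\<And>\<eta>. \<eta> \<in> V \<Longrightarrow> \<exists>g\<in>G. \<eta> + g \<in> K"
    and Gadd: "\<And>x y. x \<in> G \<Longrightarrow> y \<in> G \<Longrightarrow> x + y \<in> G"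
    and nz: "\<And>\<eta>. \<eta> \<in> V \<Longrightarrow> \<exists>g\<in>G. \<phi> (\<eta> + g) \<noteq> 0"
  obtains \<epsilon> \<delta> where "\<epsilon> > 0" "\<delta> > 0"
    "\<And>\<eta>. \<eta> \<in> V \<Longrightarrow> \<exists>g\<in>G. \<forall>\<zeta>. norm \<zeta> < \<delta> \<longrightarrow> \<epsilon> \<le> cmod (\<phi> (\<eta> + g + \<zeta>))"
proof -
  have "\<exists>g r. g \<in> G \<and> r > 0 \<and> \<phi> (x + g) \<noteq> 0 \<and> (\<forall>y. dist y x < 2 * r \<longrightarrow> cmod (\<phi> (x + g)) / 2 \<le> cmod (\<phi> (y + g)))"
    if xK: "x \<in> K" for x
  proof -
    obtain g where g: "g \<in> G" "\<phi> (x + g) \<noteq> 0" using nz[of x] subsetD[OF K(2) xK] by blast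
    have "isCont \<phi> (x + g)" using phi_cont[of UNIV] by (simp add: continuous_on_eq_continuous_at)
    moreover have "cmod (\<phi> (x + g)) / 2 > 0" using g by simp
    ultimately obtain d where d: "d > 0" "\<And>y. dist y (x + g) < d \<Longrightarrow> dist (\<phi> y) (\<phi> (x + g)) < cmod (\<phi> (x + g)) / 2"
      unfolding continuous_at_eps_delta by blast
    have "cmod (\<phi> (x + g)) / 2 \<le> cmod (\<phi> (y + g))" if "dist y x < 2 * (d / 2)" for y
    proof -
      have "dist (\<phi> (y + g)) (\<phi> (x + g)) < cmod (\<phi> (x + g)) / 2" using d(2)[of "y + g"] that by simp
      thus ?thesis using norm_triangle_ineq2[of "\<phi> (x + g)" "\<phi> (y + g)"] by (simp add: dist_norm norm_minus_commute)
    qed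
    thus ?thesis using g d by (intro exI[of _ g] exI[of _ "d / 2"]) auto
  qed
  then obtain g r where g: "\<And>x. x \<in> K \<Longrightarrow> g x \<in> G" and r: "\<And>x. x \<in> K \<Longrightarrow> r x > (0 :: real)"
    and n: "\<And>x. x \<in> K \<Longrightarrow> \<phi> (x + g x) \<noteq> 0"
    and l: "\<And>x y. x \<in> K \<Longrightarrow> dist y x < 2 * r x \<Longrightarrow> cmod (\<phi> (x + g x)) / 2 \<le> cmod (\<phi> (y + g x))"
    by metis
  obtain C where C: "C \<subseteq> K" "finite C" "K \<subseteq> (\<Union>x\<in>C. ball x (r x))"
  proof (rule compactE_image[OF K(1), of K "\<lambda>x. ball x (r x)"])
    show "K \<subseteq> (\<Union>x\<in>K. ball x (r x))" using r by force
  qed auto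
  define \<epsilon> where "\<epsilon> = Min (insert 1 ((\<lambda>x. cmod (\<phi> (x + g x)) / 2) ` C))"
  define \<delta> where "\<delta> = Min (insert 1 (r ` C))"
  have "\<epsilon> > 0" unfolding \<epsilon>_def using C n by (subst Min_gr_iff) auto
  moreover have "\<delta> > 0" unfolding \<delta>_def using C r by (subst Min_gr_iff) auto
  moreover have "\<exists>h\<in>G. \<forall>\<zeta>. norm \<zeta> < \<delta> \<longrightarrow> \<epsilon> \<le> cmod (\<phi> (\<eta> + h + \<zeta>))" if eV: "\<eta> \<in> V" for \<eta>
  proof -
    obtain h where h: "h \<in> G" "\<eta> + h \<in> K" using cover[OF eV] by blast
    then obtain x where x: "x \<in> C" "dist x (\<eta> + h) < r x" using C by auto
    hence xK: "x \<in> K" using C by auto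
    have "\<epsilon> \<le> cmod (\<phi> (\<eta> + (h + g x) + \<zeta>))" if z: "norm \<zeta> < \<delta>" for \<zeta>
    proof -
      have "\<delta> \<le> r x" unfolding \<delta>_def using C x by (intro Min_le) auto
      hence "dist (\<eta> + h + \<zeta>) x < 2 * r x"
        using x z norm_triangle_ineq[of "\<eta> + h - x" \<zeta>] by (simp add: dist_norm norm_minus_commute algebra_simps)
      hence "cmod (\<phi> (x + g x)) / 2 \<le> cmod (\<phi> (\<eta> + h + \<zeta> + g x))" by (rule l[OF xK])
      moreover have "\<epsilon> \<le> cmod (\<phi> (x + g x)) / 2" unfolding \<epsilon>_def using C x by (intro Min_le) auto
      ultimately show ?thesis by (simp add: algebra_simps)
    qed
    thus ?thesis using Gadd[OF h(1) g[OF xK]] by blast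
  qed
  ultimately show ?thesis using that by blast
qed

lemma Z0_translate_diff:
  assumes "i < p" "j < p" "i \<noteq> j" and k: "k \<in> integer_lattice" "l \<in> integer_lattice"
  shows "((real i / real p) *\<^sub>R a + k) - ((real j / real p) *\<^sub>R a + l) \<in> Z0"
proof (cases "j < i")
  case True
  have "((real i / real p) *\<^sub>R a + k) - ((real j / real p) *\<^sub>R a + l) = (real (i - j) / real p) *\<^sub>R a + (k - l)"
    using True by (simp add: of_nat_diff diff_divide_distrib algebra_simps)
  moreover have "i - j \<in> {1..p-1}" using True assms by auto
  ultimately show ?thesis unfolding Z0_eq using integer_lattice_diff[OF k] by blast
next
  case False
  have ai: "a \<in> integer_lattice" using a by (auto simp: calE_def integer_lattice_iff)
  have "real (p + i - j) / real p = 1 + (real i / real p - real j / real p)"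
    using False assms by (simp add: of_nat_diff field_simps)
  hence "((real i / real p) *\<^sub>R a + k) - ((real j / real p) *\<^sub>R a + l) = (real (p + i - j) / real p) *\<^sub>R a + (k - l - a)"
    by (simp only:) (simp add: algebra_simps)
  moreover have "p + i - j \<in> {1..p-1}" using False assms by auto
  ultimately show ?thesis unfolding Z0_eq using integer_lattice_diff[OF integer_lattice_diff[OF k] ai] by blast
qed

text \<open>The construction: every frequency found so far gets \<open>p - 1\<close> new relatives on each level. The
  translates \<open>W j\<close> make the new ones orthogonal to the old ones. A correction from \<open>G\<close> keeps the tail
  of the infinite product away from zero when a frequency is born; since all factors have modulus at
  most one, the tail never decreases afterwards. The set \<open>V\<close> holds all the arguments of \<open>\<phi>\<close> that
  occur; it may be smaller than the plane, as only its cosets of \<open>G\<close> are required to contain points where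
  \<open>\<phi>\<close> does not vanish, and \<open>K\<close> represents these cosets.\<close>

proposition spectral_from_lattice:
  fixes G V K :: "(real^2) set" and W :: "nat \<Rightarrow> real^2"
  assumes G: "0 \<in> G" "\<And>x y. x \<in> G \<Longrightarrow> y \<in> G \<Longrightarrow> x + y \<in> G" "G \<subseteq> integer_lattice" "\<And>x. x \<in> G \<Longrightarrow> T x \<in> G"
    and W: "W 0 = 0" "\<And>j. j < p \<Longrightarrow> \<exists>k\<in>integer_lattice. W j = (real j / real p) *\<^sub>R a + k"
       "\<And>j. j < p \<Longrightarrow> T (W j) \<in> G"
    and V: "G \<subseteq> V" "\<And>j. j < p \<Longrightarrow> W j \<in> V" "\<And>x y. x \<in> V \<Longrightarrow> y \<in> V \<Longrightarrow> x + y \<in> V" "\<And>x. x \<in> V \<Longrightarrow> S x \<in> V"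
    and K: "compact K" "K \<subseteq> V" "\<And>\<eta>. \<eta> \<in> V \<Longrightarrow> \<exists>g\<in>G. \<eta> + g \<in> K"
    and nz: "\<And>\<eta>. \<eta> \<in> V \<Longrightarrow> \<exists>g\<in>G. \<phi> (\<eta> + g) \<noteq> 0"
  shows "spectral_measure \<mu>"
proof -
  obtain \<epsilon> \<delta> where e: "\<epsilon> > 0" "\<delta> > 0"
    and ex: "\<And>\<eta>. \<eta> \<in> V \<Longrightarrow> \<exists>g\<in>G. \<forall>\<zeta>. norm \<zeta> < \<delta> \<longrightarrow> \<epsilon> \<le> cmod (\<phi> (\<eta> + g + \<zeta>))"
    using uniform_nonvanishing[OF K(1,2,3) G(2) nz] by blast
  then obtain sel where sel: "\<And>\<eta>. \<eta> \<in> V \<Longrightarrow> sel \<eta> \<in> G"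
    "\<And>\<eta> \<zeta>. \<eta> \<in> V \<Longrightarrow> norm \<zeta> < \<delta> \<Longrightarrow> \<epsilon> \<le> cmod (\<phi> (\<eta> + sel \<eta> + \<zeta>))" by metis
  define incr where "incr n v j = W j + (if j = 0 then 0 else sel ((S ^^ Suc n) v + W j))" for n v and j :: nat
  define child where "child n v j = v + (T ^^ Suc n) (incr n v j)" for n v j
  define L where "L = rec_nat {0} (\<lambda>n L. (\<lambda>(v, j). child n v j) ` (L \<times> {..<p}))"
  have L0: "L 0 = {0}" and LS: "L (Suc n) = (\<lambda>(v, j). child n v j) ` (L n \<times> {..<p})" for n
    by (simp_all add: L_def)
  have p0: "0 < p" using p_gt_1 by simp
  have child0: "child n v 0 = v" for n v by (simp add: child_def incr_def W(1))
  have mono1: "L n \<subseteq> L (Suc n)" for n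
  proof
    fix v assume "v \<in> L n"
    hence "child n v 0 \<in> L (Suc n)" unfolding LS using p0 by (intro image_eqI[of _ _ "(v, 0)"]) auto
    thus "v \<in> L (Suc n)" by (simp only: child0)
  qed
  have mono: "i \<le> j \<Longrightarrow> L i \<subseteq> L j" for i j using mono1 by (rule lift_Suc_mono_le)
  have fin: "finite (L n)" for n by (induction n) (auto simp: L0 LS)
  have Tn_G: "(T ^^ n) x \<in> G" if "x \<in> G" for n x using that by (induction n) (auto intro: G(4))
  have Sn_V: "(S ^^ n) x \<in> V" if "x \<in> V" for n x using that by (induction n) (auto intro: V(4))
  have sel_G: "(if j = 0 then 0 else sel ((S ^^ Suc n) v + W j)) \<in> G" if "v \<in> G" "j < p" for n v j
  proof -
    have "(S ^^ Suc n) v + W j \<in> V" by (intro V(3) Sn_V V(2)) (use that V(1) in auto)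
    thus ?thesis using sel(1) G(1) by simp
  qed
  have T_incr: "T (incr n v j) \<in> G" if "v \<in> G" "j < p" for n v j
    unfolding incr_def T_add by (intro G(2) W(3) G(4) sel_G that)
  have Tn_incr: "(T ^^ n') (incr n v j) \<in> G" if "v \<in> G" "j < p" "n' \<ge> 1" for n n' v j
  proof -
    obtain k where "n' = Suc k" using \<open>n' \<ge> 1\<close> by (cases n') auto
    thus ?thesis using Tn_G[OF T_incr[OF that(1,2)], of k n] by (simp add: funpow_swap1)
  qed
  have L_G: "L n \<subseteq> G" for n
  proof (induction n)
    case (Suc n)
    show ?case unfolding LS child_def using Suc by (auto intro!: G(2) Tn_incr simp del: funpow.simps)
  qed (auto simp: L0 G)
  have incr_form: "\<exists>k\<in>integer_lattice. incr n v j = (real j / real p) *\<^sub>R a + k" if vj: "v \<in> G" "j < p" for n v j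
  proof -
    obtain k where "k \<in> integer_lattice" "W j = (real j / real p) *\<^sub>R a + k" using W(2)[OF vj(2)] by blast
    moreover have "(if j = 0 then 0 else sel ((S ^^ Suc n) v + W j)) \<in> integer_lattice"
      using sel_G[OF vj] G(3) by blast
    ultimately show ?thesis
      unfolding incr_def by (intro bexI[of _ "k + (if j = 0 then 0 else sel ((S ^^ Suc n) v + W j))"])
        (auto simp: add.assoc intro: integer_lattice_add)
  qed
  define sep where "sep n x \<longleftrightarrow> (\<exists>k z. 1 \<le> k \<and> k \<le> n \<and> z \<in> Z0 \<and> x = (T ^^ k) z)" for n :: nat and x
  have sep_ne: "x \<noteq> 0" if "sep n x" for n x using that Tn_Z0_ne unfolding sep_def by auto
  have sep_child: "sep (Suc n) (child n v i - child n w j)"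
    if IH: "\<And>v w. v \<in> L n \<Longrightarrow> w \<in> L n \<Longrightarrow> v \<noteq> w \<Longrightarrow> sep n (v - w)"
      and vw: "v \<in> L n" "w \<in> L n" "i < p" "j < p" "(v, i) \<noteq> (w, j)" for n v w i j
  proof (cases "v = w")
    case True
    hence ij: "i \<noteq> j" using vw by auto
    have vG: "v \<in> G" using vw L_G by auto
    obtain k l where "k \<in> integer_lattice" "l \<in> integer_lattice" "incr n v i = (real i / real p) *\<^sub>R a + k"
      "incr n v j = (real j / real p) *\<^sub>R a + l" using incr_form[OF vG] vw by meson
    hence "incr n v i - incr n v j \<in> Z0" using Z0_translate_diff[OF vw(3,4) ij] by simp
    moreover have "child n v i - child n w j = (T ^^ Suc n) (incr n v i - incr n v j)"
      by (simp only: child_def Tn_diff True add_diff_cancel_left)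
    ultimately show ?thesis
      unfolding sep_def by (intro exI[of _ "Suc n"] exI[of _ "incr n v i - incr n v j"]) simp
  next
    case False
    then obtain k z where k: "1 \<le> k" "k \<le> n" "z \<in> Z0" "v - w = (T ^^ k) z" using IH vw unfolding sep_def by blast
    define u where "u = (T ^^ (Suc n - k)) (incr n v i) - (T ^^ (Suc n - k)) (incr n w j)"
    have uk: "(T ^^ k) u = (T ^^ Suc n) (incr n v i) - (T ^^ Suc n) (incr n w j)"
    proof -
      have "(T ^^ k) ((T ^^ (Suc n - k)) y) = (T ^^ Suc n) y" for y
        using k funpow_add[of k "Suc n - k" T] by (simp del: funpow.simps)
      thus ?thesis unfolding u_def Tn_diff by simp
    qed
    have "u \<in> integer_lattice" unfolding u_def
      by (intro integer_lattice_diff subsetD[OF G(3)] Tn_incr) (use vw k L_G in auto)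
    hence "z + u \<in> Z0" by (rule Z0_add_lattice[OF k(3)])
    moreover have "child n v i - child n w j = (T ^^ k) (z + u)"
      unfolding Tn_add uk k(4)[symmetric] child_def by (simp add: algebra_simps)
    ultimately show ?thesis unfolding sep_def using k by (intro exI[of _ k] exI[of _ "z + u"]) auto
  qed
  have sep_L: "sep n (v - w)" if "v \<in> L n" "w \<in> L n" "v \<noteq> w" for n v w
    using that
  proof (induction n arbitrary: v w)
    case (Suc n)
    then obtain v' i w' j where "v' \<in> L n" "i < p" "v = child n v' i" "w' \<in> L n" "j < p" "w = child n w' j"
      unfolding LS by auto
    thus ?case using sep_child[OF Suc.IH, of v' w' i j] Suc.prems(3) by auto
  qed (auto simp: L0)
  have inj: "inj_on (\<lambda>(v, j). child n v j) (L n \<times> {..<p})" for n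
  proof (rule inj_onI, clarify, rule ccontr)
    fix v i w j assume "v \<in> L n" "w \<in> L n" "i < p" "j < p" "child n v i = child n w j" "\<not> (v = w \<and> i = j)"
    thus False using sep_ne[OF sep_child[OF sep_L, of n v w i j]] by auto
  qed
  \<comment> \<open>The \<open>p\<close> relatives of a frequency share its first \<open>n\<close> factors, and their squares of the next factor
    add up to one.\<close>
  have sum1: "(\<Sum>v\<in>L n. (cmod (mprod n (\<xi> + v)))\<^sup>2) = 1" for n \<xi>
  proof (induction n)
    case 0
    show ?case by (simp add: L0)
  next
    case (Suc n)
    have "(\<Sum>v\<in>L (Suc n). (cmod (mprod (Suc n) (\<xi> + v)))\<^sup>2)
       = (\<Sum>(v, j)\<in>L n \<times> {..<p}. (cmod (mprod (Suc n) (\<xi> + child n v j)))\<^sup>2)"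
      unfolding LS by (subst sum.reindex[OF inj]) (simp add: split_beta' comp_def)
    also have "\<dots> = (\<Sum>v\<in>L n. \<Sum>j<p. (cmod (mprod (Suc n) (\<xi> + child n v j)))\<^sup>2)"
      by (rule sum.cartesian_product[symmetric])
    also have "\<dots> = (\<Sum>v\<in>L n. (cmod (mprod n (\<xi> + v)))\<^sup>2 * (\<Sum>j<p. (cmod (m ((S ^^ Suc n) (\<xi> + v) + (real j / real p) *\<^sub>R a)))\<^sup>2))"
    proof (rule sum.cong[OF refl], unfold sum_distrib_left, rule sum.cong[OF refl])
      fix v j assume v: "v \<in> L n" and "j \<in> {..<p}"
      hence j: "j < p" and vG: "v \<in> G" using L_G by auto
      have per: "mprod n (\<xi> + child n v j) = mprod n (\<xi> + v)"
        unfolding mprod_def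
      proof (rule prod.cong[OF refl])
        fix k assume k: "k \<in> {1..n}"
        have "(S ^^ k) (\<xi> + child n v j) = (S ^^ k) (\<xi> + v) + (T ^^ (Suc n - k)) (incr n v j)"
          using k Sn_Tn_le[of k "Suc n" "incr n v j"] by (simp add: child_def Sn_add del: funpow.simps)
        moreover have "(T ^^ (Suc n - k)) (incr n v j) \<in> integer_lattice"
          by (intro subsetD[OF G(3)] Tn_incr vG j) (use k in auto)
        ultimately show "m ((S ^^ k) (\<xi> + child n v j)) = m ((S ^^ k) (\<xi> + v))" by (simp add: m_periodic)
      qed
      obtain k where k: "k \<in> integer_lattice" "incr n v j = (real j / real p) *\<^sub>R a + k" using incr_form[OF vG j] by blast
      have "(S ^^ Suc n) (\<xi> + child n v j) = (S ^^ Suc n) (\<xi> + v) + (real j / real p) *\<^sub>R a + k"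
        unfolding child_def Sn_add Sn_Tn k(2) by (simp add: add.assoc)
      hence "m ((S ^^ Suc n) (\<xi> + child n v j)) = m ((S ^^ Suc n) (\<xi> + v) + (real j / real p) *\<^sub>R a)"
        using m_periodic[OF k(1)] by simp
      thus "(cmod (mprod (Suc n) (\<xi> + child n v j)))\<^sup>2
        = (cmod (mprod n (\<xi> + v)))\<^sup>2 * (cmod (m ((S ^^ Suc n) (\<xi> + v) + (real j / real p) *\<^sub>R a)))\<^sup>2"
        by (simp only: mprod_Suc per norm_mult power_mult_distrib)
    qed
    also have "\<dots> = 1" using Suc by (simp only: sum_m_translates mult_1_right)
    finally show ?case .
  qed
  \<comment> \<open>The correction \<open>sel\<close> enters here: it keeps \<open>\<phi>\<close> away from zero on a whole \<open>\<delta>\<close>-ball around the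
    rescaled new frequency.\<close>
  have birth: "\<epsilon> \<le> cmod (\<phi> ((S ^^ Suc n) v + \<zeta>))" if v: "v \<in> L (Suc n)" "v \<notin> L n" and z: "norm \<zeta> < \<delta>" for n v \<zeta>
  proof -
    obtain w j where w: "w \<in> L n" "j < p" "v = child n w j" using v(1) unfolding LS by auto
    have j: "j \<noteq> 0"
    proof
      assume "j = 0"
      hence "v = w" using w(3) child0 by simp
      thus False using v(2) w(1) by simp
    qed
    have eta: "(S ^^ Suc n) w + W j \<in> V" by (intro V(3) Sn_V V(2)) (use w L_G V(1) in auto)
    have "(S ^^ Suc n) v = (S ^^ Suc n) w + W j + sel ((S ^^ Suc n) w + W j)"
      unfolding w child_def Sn_add Sn_Tn incr_def using j by (simp add: add.assoc)
    thus ?thesis using sel(2)[OF eta z] by simp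
  qed
  define \<Lambda> where "\<Lambda> = (\<Union>n. L n)"
  have common: "\<exists>n. F \<subseteq> L n" if "finite F" "F \<subseteq> \<Lambda>" for F
    using that
  proof (induction F rule: finite_induct)
    case (insert x F)
    then obtain n k where "F \<subseteq> L n" "x \<in> L k" by (auto simp: \<Lambda>_def)
    hence "insert x F \<subseteq> L (max n k)" using mono[of n "max n k"] mono[of k "max n k"] by auto
    thus ?case ..
  qed auto
  have orth: "\<phi> (v - w) = 0" if vw: "v \<in> \<Lambda>" "w \<in> \<Lambda>" "v \<noteq> w" for v w
  proof -
    obtain n where "v \<in> L n" "w \<in> L n" using common[of "{v, w}"] vw by auto
    hence "sep n (v - w)" using vw(3) by (rule sep_L)
    thus ?thesis using phi_Tn_Z0 unfolding sep_def by auto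
  qed
  have pars: "((\<lambda>v. (cmod (\<phi> (\<xi> + v)))\<^sup>2) has_sum 1) \<Lambda>" for \<xi>
  proof (rule has_sum_1I)
    show le: "(\<Sum>v\<in>F. (cmod (\<phi> (\<xi> + v)))\<^sup>2) \<le> 1" if "finite F" "F \<subseteq> \<Lambda>" for F
      by (rule Bessel_char_fun[OF char_fun_phi that(1)]) (use orth that in blast)
    define s where "s n = (\<Sum>v\<in>L n. (cmod (\<phi> (\<xi> + v)))\<^sup>2)" for n
    have s1: "s n \<le> 1" for n unfolding s_def by (rule le) (auto simp: \<Lambda>_def fin)
    have "incseq s" unfolding s_def by (intro incseq_SucI sum_mono2 fin mono1) auto
    then obtain l where l: "s \<longlonglongrightarrow> l" "\<And>n. s n \<le> l" using incseq_convergent[of s 1] s1 by blast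
    obtain n0 where n0: "\<And>n. n \<ge> n0 \<Longrightarrow> norm ((S ^^ n) \<xi>) < \<delta>"
      using LIMSEQ_D[OF Sn_tendsto_0 e(2)] by auto
    have bound: "(cmod (mprod n (\<xi> + v)))\<^sup>2 \<le> (cmod (\<phi> (\<xi> + v)))\<^sup>2 / \<epsilon>\<^sup>2"
      if v: "v \<in> L n" "v \<notin> L n0" for n v
    proof -
      define k where "k = (LEAST k. v \<in> L k)"
      have k: "v \<in> L k" "k \<le> n" unfolding k_def using v(1) by (auto intro: LeastI Least_le)
      hence k0: "n0 < k" using v mono[of k n0] by (meson not_le subsetD)
      then obtain i where i: "k = Suc i" by (cases k) auto
      have "v \<notin> L i" using not_less_Least[of i "\<lambda>k. v \<in> L k"] i k_def by simp
      hence "\<epsilon> \<le> cmod (\<phi> ((S ^^ k) v + (S ^^ k) \<xi>))" using birth[of v i] k(1) i n0[of k] k0 by simp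
      also have "\<dots> \<le> cmod (\<phi> ((S ^^ n) (\<xi> + v)))" using phi_Sn_mono[OF k(2), of "\<xi> + v"] by (simp add: Sn_add add.commute)
      finally have "cmod (mprod n (\<xi> + v)) * \<epsilon> \<le> cmod (mprod n (\<xi> + v)) * cmod (\<phi> ((S ^^ n) (\<xi> + v)))"
        by (intro mult_left_mono) auto
      also have "\<dots> = cmod (\<phi> (\<xi> + v))" by (metis norm_mult phi_iterate)
      finally have "cmod (mprod n (\<xi> + v)) \<le> cmod (\<phi> (\<xi> + v)) / \<epsilon>" using e by (simp add: field_simps)
      thus ?thesis using power_mono[of "cmod (mprod n (\<xi> + v))" "cmod (\<phi> (\<xi> + v)) / \<epsilon>" 2] by (simp add: power_divide)
    qed
    \<comment> \<open>The part of the total mass one of level \<open>n\<close> that is carried by frequencies born after \<open>N\<close> is at most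
      \<open>1/\<epsilon>\<^sup>2\<close> times the corresponding part of the series, which is small for large \<open>N\<close>.\<close>
    have stage: "1 \<le> s N + (l - s N) / \<epsilon>\<^sup>2" if N: "N \<ge> n0" for N
    proof (rule LIMSEQ_le_const)
      show "(\<lambda>n. (\<Sum>v\<in>L N. (cmod (mprod n (\<xi> + v)))\<^sup>2) + (s n - s N) / \<epsilon>\<^sup>2) \<longlonglongrightarrow> s N + (l - s N) / \<epsilon>\<^sup>2"
        unfolding s_def[of N] by (intro tendsto_intros mprod_tendsto l(1)) (use e in auto)
      show "\<exists>M. \<forall>n\<ge>M. 1 \<le> (\<Sum>v\<in>L N. (cmod (mprod n (\<xi> + v)))\<^sup>2) + (s n - s N) / \<epsilon>\<^sup>2"
      proof (intro exI[of _ N] allI impI)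
        fix n assume n: "N \<le> n"
        have "1 = (\<Sum>v\<in>L n. (cmod (mprod n (\<xi> + v)))\<^sup>2)" by (rule sum1[symmetric])
        also have "\<dots> = (\<Sum>v\<in>L N. (cmod (mprod n (\<xi> + v)))\<^sup>2) + (\<Sum>v\<in>L n - L N. (cmod (mprod n (\<xi> + v)))\<^sup>2)"
          using sum.subset_diff[OF mono[OF n] fin] by (simp add: add.commute)
        also have "(\<Sum>v\<in>L n - L N. (cmod (mprod n (\<xi> + v)))\<^sup>2) \<le> (\<Sum>v\<in>L n - L N. (cmod (\<phi> (\<xi> + v)))\<^sup>2 / \<epsilon>\<^sup>2)"
          by (intro sum_mono bound) (use mono[OF N] in auto)
        also have "\<dots> = (s n - s N) / \<epsilon>\<^sup>2"
          unfolding s_def sum_divide_distrib[symmetric] using sum_diff[OF fin mono[OF n], of "\<lambda>v. (cmod (\<phi> (\<xi> + v)))\<^sup>2"]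
          by simp
        finally show "1 \<le> (\<Sum>v\<in>L N. (cmod (mprod n (\<xi> + v)))\<^sup>2) + (s n - s N) / \<epsilon>\<^sup>2" by simp
      qed
    qed
    have "1 \<le> l"
    proof (rule LIMSEQ_le_const)
      have "(\<lambda>N. s N + (l - s N) / \<epsilon>\<^sup>2) \<longlonglongrightarrow> l + (l - l) / \<epsilon>\<^sup>2" by (intro tendsto_intros l(1)) (use e in auto)
      thus "(\<lambda>N. s N + (l - s N) / \<epsilon>\<^sup>2) \<longlonglongrightarrow> l" by simp
      show "\<exists>M. \<forall>n\<ge>M. 1 \<le> s n + (l - s n) / \<epsilon>\<^sup>2" using stage by blast
    qed
    fix \<kappa> :: real assume "\<kappa> > 0"
    hence "\<forall>\<^sub>F n in sequentially. 1 - \<kappa> < s n" using order_tendstoD(1)[OF l(1)] \<open>1 \<le> l\<close> by simp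
    then obtain n where "1 - \<kappa> < s n" by (auto simp: eventually_sequentially)
    thus "\<exists>F. finite F \<and> F \<subseteq> \<Lambda> \<and> 1 - \<kappa> < (\<Sum>v\<in>F. (cmod (\<phi> (\<xi> + v)))\<^sup>2)"
      unfolding s_def using fin by (intro exI[of _ "L n"]) (auto simp: \<Lambda>_def)
  qed auto
  have "countable \<Lambda>" unfolding \<Lambda>_def by (intro countable_UN) (auto intro: countable_finite fin)
  hence "is_spectrum \<mu> \<Lambda>"
    using Parseval_imp_spectrum[OF mu compactly_supported_mu, of \<Lambda>] orth pars unfolding \<phi>_def by blast
  thus ?thesis unfolding spectral_measure_def using mu compactly_supported_mu by blast
qed

section \<open>Frequency sets of a spectral self-affine measure\<close>

text \<open>Parseval's identity is only asked for when the first coordinate of \<open>\<xi>\<close> avoids a countable set. This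
  makes the notion stable under the passage to the subtrees of a frequency set, where \<open>\<xi>\<close> must avoid the
  zeros of a factor of \<open>\<phi>\<close>.\<close>

definition tight :: "(real^2) set \<Rightarrow> bool" where
  "tight \<Lambda> \<longleftrightarrow> countable \<Lambda> \<and> (\<forall>v\<in>\<Lambda>. \<forall>w\<in>\<Lambda>. v \<noteq> w \<longrightarrow> \<phi> (v - w) = 0) \<and>
     (\<exists>C. countable C \<and> (\<forall>\<xi>. \<xi> $ 1 \<notin> C \<longrightarrow> ((\<lambda>v. (cmod (\<phi> (\<xi> + v)))\<^sup>2) has_sum 1) \<Lambda>))"

lemma spectral_imp_tight: "spectral_measure \<mu> \<Longrightarrow> \<exists>\<Lambda>. tight \<Lambda>"
proof -
  assume "spectral_measure \<mu>"
  then obtain \<Lambda> where sp: "is_spectrum \<mu> \<Lambda>" by (auto simp: spectral_measure_def)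
  hence "countable \<Lambda>" by (simp add: is_spectrum_def)
  moreover have "\<forall>v\<in>\<Lambda>. \<forall>w\<in>\<Lambda>. v \<noteq> w \<longrightarrow> \<phi> (v - w) = 0"
    using spectrum_orthogonal[OF sp] unfolding \<phi>_def by blast
  moreover have "((\<lambda>v. (cmod (\<phi> (\<xi> + v)))\<^sup>2) has_sum 1) \<Lambda>" for \<xi>
    using spectrum_imp_Parseval[OF mu sp] unfolding \<phi>_def by blast
  ultimately have "tight \<Lambda>" unfolding tight_def using countable_empty by blast
  thus ?thesis ..
qed

lemma tight_orthogonal: "tight \<Lambda> \<Longrightarrow> v \<in> \<Lambda> \<Longrightarrow> w \<in> \<Lambda> \<Longrightarrow> v \<noteq> w \<Longrightarrow> \<phi> (v - w) = 0"
  by (simp add: tight_def)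

lemma tight_differenceE:
  assumes "tight \<Lambda>" "v \<in> \<Lambda>" "w \<in> \<Lambda>" "v \<noteq> w"
  obtains k z where "k \<ge> 1" "z \<in> Z0" "v - w = (T ^^ k) z"
  using phi_zeroE[OF tight_orthogonal[OF assms]] by blast

lemma tight_nonempty: "tight \<Lambda> \<Longrightarrow> \<Lambda> \<noteq> {}"
proof
  assume t: "tight \<Lambda>" and "\<Lambda> = {}"
  obtain C where C: "countable C" "\<And>\<xi>. \<xi> $ 1 \<notin> C \<Longrightarrow> ((\<lambda>v. (cmod (\<phi> (\<xi> + v)))\<^sup>2) has_sum 1) \<Lambda>"
    using t unfolding tight_def by blast
  obtain x where "x \<notin> C" using C(1) uncountable_UNIV_real by (metis UNIV_eq_I)
  hence "((\<lambda>v. (cmod (\<phi> ((vector [x, 0] :: real^2) + v)))\<^sup>2) has_sum 1) \<Lambda>" by (intro C(2)) simp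
  thus False using \<open>\<Lambda> = {}\<close> by (metis has_sum_empty has_sum_unique zero_neq_one)
qed

lemma tight_Bessel:
  assumes "tight \<Lambda>" "finite F" "F \<subseteq> \<Lambda>"
  shows "(\<Sum>v\<in>F. (cmod (\<phi> (\<xi> + v)))\<^sup>2) \<le> 1"
  by (rule Bessel_char_fun[OF char_fun_phi assms(2)]) (use tight_orthogonal[OF assms(1)] assms(3) in blast)

lemma a_coords: obtains a1 a2 :: int where "a $ 1 = of_int a1" "a $ 2 = of_int a2" "\<not> int p dvd a1" "\<not> int p dvd a2"
proof -
  obtain i j where ij: "a = vector [real i, real j]" "i \<in> {1..p-1}" "j \<in> {1..p-1}"
    using a unfolding calE_def by blast
  have nd: "\<not> int p dvd int i" if "i \<in> {1..p-1}" for i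
    using that by (auto dest!: zdvd_imp_le simp: int_dvd_int_iff dest: dvd_imp_le)
  show ?thesis by (rule that[of "int i" "int j"]) (use ij nd in auto)
qed

definition a1 :: int where "a1 = \<lfloor>a $ 1\<rfloor>"
definition a2 :: int where "a2 = \<lfloor>a $ 2\<rfloor>"

lemma a_nth: "a $ 1 = of_int a1" "a $ 2 = of_int a2" and not_dvd_a: "\<not> int p dvd a1" "\<not> int p dvd a2"
proof -
  obtain x y :: int where xy: "a $ 1 = of_int x" "a $ 2 = of_int y" "\<not> int p dvd x" "\<not> int p dvd y" by (rule a_coords)
  show "a $ 1 = of_int a1" "a $ 2 = of_int a2" "\<not> int p dvd a1" "\<not> int p dvd a2"
    unfolding a1_def a2_def using xy by auto
qed

lemma prime_int_p: "prime (int p)" using prime_p by simp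

lemma p_pos: "real p > 0" using p_gt_1 by simp

text \<open>Numerators of the zeros of the mask: the pairs that are nonzero multiples of \<open>a\<close> modulo \<open>p\<close>.\<close>

definition adm :: "int \<Rightarrow> int \<Rightarrow> bool" where
  "adm n r \<longleftrightarrow> \<not> int p dvd n \<and> int p dvd (a1 * r - a2 * n)"

lemma Z0E:
  assumes "z \<in> Z0"
  obtains n r where "adm n r" "z $ 1 = of_int n / real p" "z $ 2 = of_int r / real p"
proof -
  obtain j k where j: "j \<in> {1..p-1}" and k: "k \<in> integer_lattice" and z: "z = (real j / real p) *\<^sub>R a + k"
    using assms unfolding Z0_eq by blast
  obtain k1 k2 :: int where k12: "k $ 1 = k1" "k $ 2 = k2" using k by (auto simp: integer_lattice_iff elim!: Ints_cases)
  define n where "n = int j * a1 + int p * k1"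
  define r where "r = int j * a2 + int p * k2"
  have "\<not> int p dvd int j" using j p_gt_1 by (auto dest: dvd_imp_le)
  hence "\<not> int p dvd int j * a1" using prime_int_p not_dvd_a by (simp add: prime_dvd_mult_iff)
  hence "\<not> int p dvd n" unfolding n_def by (simp add: dvd_add_left_iff)
  moreover have "a1 * r - a2 * n = int p * (a1 * k2 - a2 * k1)" unfolding n_def r_def by (simp add: algebra_simps)
  ultimately have "adm n r" unfolding adm_def by simp
  moreover have "z $ 1 = of_int n / real p" "z $ 2 = of_int r / real p"
    using p_pos by (simp_all add: z n_def r_def k12 a_nth field_simps)
  ultimately show ?thesis by (rule that)
qed

text \<open>The first coordinates of the zeros of \<open>\<phi>\<close> lie in a countable set, so that generic points avoid
  all relevant zeros.\<close>

lemma generic_point: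
  assumes "countable C" "countable X"
  obtains \<xi> :: "real^2" where "\<xi> $ 1 \<notin> C" "\<And>v. v \<in> X \<Longrightarrow> \<phi> (\<xi> + v) \<noteq> 0"
    "\<And>v k. v \<in> X \<Longrightarrow> (S ^^ k) (\<xi> + v) \<notin> integer_lattice"
proof -
  define Bad where "Bad = C \<union> (\<lambda>(v, k, q). b ^ k * q - v $ 1) ` (X \<times> (UNIV :: nat set) \<times> (\<rat> :: real set))"
  have "countable Bad" unfolding Bad_def
    by (intro countable_Un countable_image countable_SIGMA assms) (auto simp: countable_rat)
  then obtain x where x: "x \<notin> Bad" using uncountable_UNIV_real by (metis UNIV_eq_I)
  define \<xi> where "\<xi> = (vector [x, 0] :: real^2)"
  have x1: "\<xi> $ 1 = x" by (simp add: \<xi>_def)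
  have key: "False" if "v \<in> X" "(\<xi> + v) $ 1 = b ^ k * q" "q \<in> \<rat>" for v k q
  proof -
    have "x = b ^ k * q - v $ 1" using that x1 by simp
    hence "x \<in> Bad" unfolding Bad_def using that by force
    thus False using x by simp
  qed
  have "\<phi> (\<xi> + v) \<noteq> 0" if v: "v \<in> X" for v
  proof
    assume "\<phi> (\<xi> + v) = 0"
    then obtain k z where kz: "k \<ge> 1" "z \<in> Z0" "\<xi> + v = (T ^^ k) z" by (rule phi_zeroE)
    obtain n r where "z $ 1 = of_int n / real p" using Z0E[OF kz(2)] by metis
    hence "(\<xi> + v) $ 1 = b ^ k * (of_int n / real p)" unfolding kz(3) Tn_fst by simp
    moreover have "of_int n / real p \<in> \<rat>" by (intro Rats_divide) auto
    ultimately show False using key v by blast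
  qed
  moreover have "(S ^^ k) (\<xi> + v) \<notin> integer_lattice" if v: "v \<in> X" for v k
  proof
    assume "(S ^^ k) (\<xi> + v) \<in> integer_lattice"
    then obtain l :: int where l: "(S ^^ k) (\<xi> + v) $ 1 = of_int l" by (auto simp: integer_lattice_iff elim: Ints_cases)
    have "(\<xi> + v) $ 1 = b ^ k * ((S ^^ k) (\<xi> + v) $ 1)" unfolding Sn_fst using b by simp
    hence "(\<xi> + v) $ 1 = b ^ k * of_int l" unfolding l .
    thus False using key[OF v _ Rats_of_int] by blast
  qed
  moreover have "\<xi> $ 1 \<notin> C" using x x1 by (simp add: Bad_def)
  ultimately show ?thesis using that by blast
qed

text \<open>If some level never occurred among the differences, the frequencies would already be orthogonal
  for the measure with that factor of the product left out. Bessel's inequality for it leaves a gap in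
  Parseval's identity.\<close>

proposition all_levels_occur:
  assumes t: "tight \<Lambda>" and l: "l \<ge> 1"
  obtains v w z where "v \<in> \<Lambda>" "w \<in> \<Lambda>" "z \<in> Z0" "v - w = (T ^^ l) z"
proof (rule ccontr)
  assume "\<not> thesis"
  hence none: "\<And>v w z. v \<in> \<Lambda> \<Longrightarrow> w \<in> \<Lambda> \<Longrightarrow> z \<in> Z0 \<Longrightarrow> v - w \<noteq> (T ^^ l) z" using that by blast
  obtain l' where l': "l = Suc l'" using l by (cases l) auto
  obtain v0 where v0: "v0 \<in> \<Lambda>" using tight_nonempty[OF t] by blast
  obtain C where C: "countable C" "\<And>\<xi>. \<xi> $ 1 \<notin> C \<Longrightarrow> ((\<lambda>v. (cmod (\<phi> (\<xi> + v)))\<^sup>2) has_sum 1) \<Lambda>"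
    using t unfolding tight_def by blast
  obtain \<xi> where \<xi>: "\<xi> $ 1 \<notin> C" "\<phi> (\<xi> + v0) \<noteq> 0" "(S ^^ l) (\<xi> + v0) \<notin> integer_lattice"
    using generic_point[OF C(1) countable_finite[of "{v0}"]] by (metis finite.emptyI finite_insert singletonI)
  define G where "G \<eta> = mprod l' \<eta> * \<phi> ((S ^^ l) \<eta>)" for \<eta>
  have G: "char_fun G" unfolding G_def by (intro char_fun_mult char_fun_mprod char_fun_Sn char_fun_phi)
  have phiG: "\<phi> \<eta> = m ((S ^^ l) \<eta>) * G \<eta>" for \<eta>
    by (subst phi_iterate[of \<eta> l]) (simp add: l' mprod_Suc G_def del: funpow.simps)
  have orth: "G (v - w) = 0" if vw: "v \<in> \<Lambda>" "w \<in> \<Lambda>" "v \<noteq> w" for v w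
  proof -
    obtain k z where k: "k \<ge> 1" "z \<in> Z0" "v - w = (T ^^ k) z" using tight_differenceE[OF t vw] by blast
    have "k \<noteq> l" using none vw k by blast
    show ?thesis
    proof (cases "k < l")
      case True
      hence "mprod l' (v - w) = 0" unfolding mprod_def prod_zero_iff[OF finite_atLeastAtMost]
        using k l' by (intro bexI[of _ k]) (auto simp: Z0_def)
      thus ?thesis by (simp add: G_def)
    next
      case False
      hence "\<phi> ((S ^^ l) (v - w)) = 0"
        unfolding k(3) using Sn_Tn_le[of l k z] phi_Tn_Z0[of "k - l" z] k \<open>k \<noteq> l\<close> by simp
      thus ?thesis by (simp add: G_def)
    qed
  qed
  define \<delta> where "\<delta> = (1 - (cmod (m ((S ^^ l) (\<xi> + v0))))\<^sup>2) * (cmod (G (\<xi> + v0)))\<^sup>2"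
  have mlt: "cmod (m ((S ^^ l) (\<xi> + v0))) < 1" using m_abs_1 \<xi>(3) m_le_1 by (metis less_le)
  hence "(cmod (m ((S ^^ l) (\<xi> + v0))))\<^sup>2 < 1" by (simp add: power_less_one_iff abs_square_less_1)
  moreover have "G (\<xi> + v0) \<noteq> 0" using \<xi>(2) phiG by auto
  ultimately have "\<delta> > 0" unfolding \<delta>_def by simp
  obtain F0 where F0: "finite F0" "F0 \<subseteq> \<Lambda>"
    "\<forall>F. finite F \<and> F0 \<subseteq> F \<and> F \<subseteq> \<Lambda> \<longrightarrow> \<bar>(\<Sum>v\<in>F. (cmod (\<phi> (\<xi> + v)))\<^sup>2) - 1\<bar> < \<delta>"
    using has_sum_finite_approx[OF C(2)[OF \<xi>(1)] \<open>\<delta> > 0\<close>] by blast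
  define F where "F = insert v0 F0"
  have F: "finite F" "F \<subseteq> \<Lambda>" "v0 \<in> F" "F0 \<subseteq> F" using F0 v0 by (auto simp: F_def)
  have le: "(cmod (\<phi> (\<xi> + v)))\<^sup>2 \<le> (cmod (G (\<xi> + v)))\<^sup>2" for v
  proof -
    have "cmod (\<phi> (\<xi> + v)) \<le> 1 * cmod (G (\<xi> + v))"
      unfolding phiG[of "\<xi> + v"] norm_mult by (intro mult_right_mono m_le_1) auto
    thus ?thesis by (intro power_mono) auto
  qed
  have "(\<Sum>v\<in>F. (cmod (\<phi> (\<xi> + v)))\<^sup>2) = (cmod (\<phi> (\<xi> + v0)))\<^sup>2 + (\<Sum>v\<in>F - {v0}. (cmod (\<phi> (\<xi> + v)))\<^sup>2)"
    by (rule sum.remove[OF F(1,3)])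
  also have "\<dots> \<le> ((cmod (G (\<xi> + v0)))\<^sup>2 - \<delta>) + (\<Sum>v\<in>F - {v0}. (cmod (G (\<xi> + v)))\<^sup>2)"
  proof (intro add_mono sum_mono le)
    show "(cmod (\<phi> (\<xi> + v0)))\<^sup>2 \<le> (cmod (G (\<xi> + v0)))\<^sup>2 - \<delta>"
      unfolding phiG[of "\<xi> + v0"] \<delta>_def norm_mult power_mult_distrib by (simp add: algebra_simps)
  qed
  also have "\<dots> = (\<Sum>v\<in>F. (cmod (G (\<xi> + v)))\<^sup>2) - \<delta>" by (simp only: sum.remove[OF F(1,3), of "\<lambda>v. (cmod (G (\<xi> + v)))\<^sup>2"])
  also have "\<dots> \<le> 1 - \<delta>" using Bessel_char_fun[OF G F(1), of \<xi>] orth F(2) by (auto simp: subset_iff)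
  finally have "(\<Sum>v\<in>F. (cmod (\<phi> (\<xi> + v)))\<^sup>2) \<le> 1 - \<delta>" .
  moreover have "\<bar>(\<Sum>v\<in>F. (cmod (\<phi> (\<xi> + v)))\<^sup>2) - 1\<bar> < \<delta>" using F0(3) F by simp
  ultimately show False by linarith
qed

subsection \<open>Decay of the transform along a nonintegral eigendirection\<close>

text \<open>\<open>f\<close> is a linear functional that is integral on the lattice and is multiplied by \<open>B = u/w\<close> under \<open>T\<close>.
  If all of \<open>f (S\<^sup>k z)\<close> for \<open>k\<close> in a long interval are close to integers, those integers satisfy an exact
  recursion, and the last one is divisible by a high power of the denominator \<open>w\<close>, which exceeds its size.
  So in every long interval some factor of the infinite product is bounded away from one in modulus. An
  interval that ends at a fixed proportion of the logarithm of \<open>|f z|\<close> is long enough, and the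
  argument can be repeated with the remaining tail. The number of small factors thus grows at least like the
  logarithm of the logarithm of \<open>|f z|\<close>.\<close>

lemma eigenfunctional_decay:
  fixes \<alpha> \<gamma> B :: real and u w :: nat
  assumes f: "\<And>z. f z = \<alpha> * z $ 1 + \<gamma> * (z :: real^2) $ 2"
    and fT: "\<And>z. f (T z) = B * f z" and B: "B = real u / real w" "B > 1" and w: "w \<ge> 2" "coprime u w"
    and fL: "\<And>z. z \<in> integer_lattice \<Longrightarrow> f z \<in> \<int>" and e: "B \<le> 2 ^ e"
  obtains \<theta> where "0 < \<theta>" "\<theta> < 1" "\<And>i z. B ^ ((2 * e + 4) ^ i) \<le> \<bar>f z\<bar> \<Longrightarrow> cmod (\<phi> z) \<le> \<theta> ^ i"
proof -
  \<comment> \<open>With this \<open>\<epsilon>\<close>, if \<open>w x = u y\<close> and \<open>x\<close>, \<open>y\<close> are within \<open>\<epsilon>\<close> of the integers \<open>N\<close>, \<open>N'\<close>, then the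
    integer \<open>w N - u N'\<close> has modulus less than one.\<close>
  define \<epsilon> where "\<epsilon> = 1 / (2 * (real u + real w))"
  have ep: "\<epsilon> > 0" "\<epsilon> < 1 / 2" using w(1) by (auto simp: \<epsilon>_def divide_simps)
  define far where "far x \<longleftrightarrow> (\<forall>N::int. \<epsilon> \<le> \<bar>x - of_int N\<bar>)" for x :: real
  have f_add: "f (x + y) = f x + f y" for x y unfolding f by (simp add: algebra_simps)
  \<comment> \<open>Modulo the lattice the points \<open>z\<close> with \<open>f z\<close> far from integers form a compact set without lattice
    points.\<close>
  obtain \<theta> where th: "0 < \<theta>" "\<theta> < 1" "\<And>z. far (f z) \<Longrightarrow> cmod (m z) \<le> \<theta>"
  proof -
    define K where "K = cbox (vector [0, 0]) (vector [1, 1]) \<inter> {z :: real^2. far (f z)}"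
    have fcont: "continuous_on UNIV f" unfolding f[abs_def] by (intro continuous_intros)
    have "closed {z :: real^2. far (f z)}" unfolding far_def
      by (intro closed_Collect_all closed_Collect_le continuous_intros continuous_on_subset[OF fcont]) auto
    hence K: "compact K" unfolding K_def by (intro compact_Int_closed compact_cbox)
    have red: "\<exists>z'\<in>K. m z = m z'" if fz: "far (f z)" for z
    proof -
      define k where "k = (vector [of_int \<lfloor>z $ 1\<rfloor>, of_int \<lfloor>z $ 2\<rfloor>] :: real^2)"
      have kL: "- k \<in> integer_lattice" by (simp add: k_def integer_lattice_iff)
      have "far (f (z - k))"
      proof -
        obtain M :: int where M: "f (- k) = of_int M" using fL[OF kL] by (auto elim: Ints_cases)
        have e: "f (z - k) = f z + of_int M" using f_add[of z "- k"] M by simp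
        have "f (z - k) - of_int N = f z - of_int (N - M)" for N unfolding e by simp
        thus ?thesis using fz unfolding far_def by metis
      qed
      moreover have "z - k \<in> cbox (vector [0, 0]) (vector [1, 1])"
        by (auto simp: mem_box_cart forall_2 k_def) linarith+
      ultimately have "z - k \<in> K" by (simp add: K_def)
      thus ?thesis using m_periodic[OF kL, of z] by (intro bexI[of _ "z - k"]) auto
    qed
    have lt: "cmod (m z) < 1" if "z \<in> K" for z
    proof -
      have "z \<notin> integer_lattice"
      proof
        assume "z \<in> integer_lattice"
        then obtain N :: int where "f z = of_int N" using fL by (auto elim: Ints_cases)
        moreover have "far (f z)" using \<open>z \<in> K\<close> by (simp add: K_def)
        ultimately show False using ep unfolding far_def by (auto dest: spec[of _ N])
      qed
      thus ?thesis using m_abs_1 m_le_1 by (metis less_le)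
    qed
    show ?thesis
    proof (cases "K = {}")
      case True
      thus ?thesis using that[of "1/2"] red by auto
    next
      case False
      have "continuous_on K (\<lambda>z. cmod (m z))" by (intro continuous_intros m_cont)
      then obtain z0 where z0: "z0 \<in> K" "\<And>z. z \<in> K \<Longrightarrow> cmod (m z) \<le> cmod (m z0)"
        using continuous_attains_sup[OF K False] by blast
      show ?thesis
      proof (rule that[of "max (1/2) (cmod (m z0))"])
        show "max (1/2) (cmod (m z0)) < 1" using lt z0 by simp
        fix z assume "far (f z)"
        then obtain z' where "z' \<in> K" "m z = m z'" using red by blast
        thus "cmod (m z) \<le> max (1/2) (cmod (m z0))" using z0(2)[of z'] by simp
      qed simp
    qed
  qed
  have fS: "f ((S ^^ k) z) = f z / B ^ k" for k z
  proof -
    have "f ((T ^^ k) y) = B ^ k * f y" for y by (induction k) (simp_all add: fT)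
    from this[of "(S ^^ k) z"] have "f z = B ^ k * f ((S ^^ k) z)" by simp
    moreover have "B ^ k \<noteq> 0" using B(2) by simp
    ultimately show ?thesis by simp
  qed
  define A where "A = 2 * e + 4"
  have claim: "cmod (\<phi> z) \<le> \<theta> ^ i" if "B ^ (A ^ i) \<le> \<bar>f z\<bar>" for i z
    using that
  proof (induction i arbitrary: z)
    case 0
    show ?case using phi_le_1 by simp
  next
    case (Suc i)
    obtain n where "\<bar>f z\<bar> < B ^ n" using real_arch_pow[OF B(2)] by blast
    define n where "n = (LEAST n. \<bar>f z\<bar> < B ^ n)"
    have n: "\<bar>f z\<bar> < B ^ n" unfolding n_def by (rule LeastI) fact
    have "A ^ Suc i < n" using le_less_trans[OF Suc.prems n] B(2) by simp
    then obtain J where J: "n = Suc J" by (cases n) auto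
    have J2: "B ^ J \<le> \<bar>f z\<bar>" using not_less_Least[of J "\<lambda>n. \<bar>f z\<bar> < B ^ n"] J unfolding n_def by auto
    have AJ: "A ^ Suc i \<le> J" using \<open>A ^ Suc i < n\<close> J by simp
    \<comment> \<open>\<open>|f z|\<close> lies between \<open>B\<^sup>J\<close> and \<open>B\<^sup>J\<^sup>+\<^sup>1\<close>; the interval of length \<open>R\<close> leaves a tail of size about \<open>B\<^sup>h\<close>.\<close>
    define h where "h = J div A"
    define R where "R = J - h"
    have A0: "A > 0" by (simp add: A_def)
    have hA: "A ^ i \<le> h" unfolding h_def using AJ A0 by (simp add: less_eq_div_iff_mult_less_eq mult.commute)
    have h1: "h \<ge> 1" using hA A0 by (metis One_nat_def Suc_leI le_trans zero_less_power)
    have hJ: "A * h \<le> J" unfolding h_def by (rule times_div_less_eq_dividend)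
    have Rh: "R + h = J" unfolding R_def h_def by (simp add: div_le_dividend)
    have R_big: "e * (h + 1) + 2 \<le> R"
    proof -
      have "2 * (e * h) + 4 * h \<le> R + h" using hJ Rh by (simp add: A_def algebra_simps)
      moreover have "e \<le> e * h" using h1 by simp
      moreover have "e * (h + 1) = e * h + e" by simp
      ultimately show ?thesis using h1 by linarith
    qed
    have "\<exists>k\<in>{1..R}. far (f ((S ^^ k) z))"
    proof (rule ccontr)
      assume "\<not> ?thesis"
      hence "\<forall>k\<in>{1..R}. \<exists>N::int. \<bar>f ((S ^^ k) z) - of_int N\<bar> < \<epsilon>" unfolding far_def by (auto simp: not_le)
      then obtain N :: "nat \<Rightarrow> int" where N: "\<And>k. k \<in> {1..R} \<Longrightarrow> \<bar>f ((S ^^ k) z) - of_int (N k)\<bar> < \<epsilon>" by metis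
      have stepN: "int w * N k = int u * N (Suc k)" if k: "1 \<le> k" "Suc k \<le> R" for k
      proof -
        have t: "real w * f ((S ^^ k) z) = real u * f ((S ^^ Suc k) z)"
          unfolding fS using B w by (simp add: field_simps)
        have "\<bar>f ((S ^^ k) z) - of_int (N k)\<bar> < \<epsilon>" "\<bar>f ((S ^^ Suc k) z) - of_int (N (Suc k))\<bar> < \<epsilon>"
          using N[of k] N[of "Suc k"] k by (simp_all del: funpow.simps)
        hence b1: "real w * \<bar>f ((S ^^ k) z) - of_int (N k)\<bar> \<le> real w * \<epsilon>"
          and b2: "real u * \<bar>f ((S ^^ Suc k) z) - of_int (N (Suc k))\<bar> \<le> real u * \<epsilon>"
          by (intro mult_left_mono; simp)+
        have "\<bar>real w * (f ((S ^^ k) z) - of_int (N k)) - real u * (f ((S ^^ Suc k) z) - of_int (N (Suc k)))\<bar>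
             \<le> real w * \<bar>f ((S ^^ k) z) - of_int (N k)\<bar> + real u * \<bar>f ((S ^^ Suc k) z) - of_int (N (Suc k))\<bar>"
          by (rule order.trans[OF abs_triangle_ineq4]) (simp add: abs_mult)
        also have "\<dots> \<le> (real w + real u) * \<epsilon>" using b1 b2 by (simp add: algebra_simps)
        also have "\<dots> < 1" using w(1) by (simp add: \<epsilon>_def divide_simps)
        finally have "\<bar>real w * of_int (N k) - real u * of_int (N (Suc k))\<bar> < 1" using t by (simp add: algebra_simps abs_minus_commute)
        hence "\<bar>of_int (int w * N k - int u * N (Suc k)) :: real\<bar> < 1" by simp
        hence "\<bar>int w * N k - int u * N (Suc k)\<bar> < 1" by linarith
        thus ?thesis by simp
      qed
      have chain: "int w ^ j * N (R - j) = int u ^ j * N R" if "j < R" for j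
        using that
      proof (induction j)
        case (Suc j)
        have "int w * N (R - Suc j) = int u * N (Suc (R - Suc j))" by (rule stepN) (use Suc in auto)
        moreover have "Suc (R - Suc j) = R - j" using Suc by simp
        ultimately have "int w ^ Suc j * N (R - Suc j) = int u * (int w ^ j * N (R - j))" by (simp add: mult_ac)
        thus ?case using Suc by simp
      qed simp
      have "R \<ge> 1" using R_big by simp
      have "int w ^ (R - 1) dvd int u ^ (R - 1) * N R" using chain[of "R - 1"] \<open>R \<ge> 1\<close> by (metis dvd_triv_left diff_less zero_less_one less_le_trans)
      moreover have "coprime (int w ^ (R - 1)) (int u ^ (R - 1))" using w(2) by (simp add: coprime_commute)
      ultimately have dv: "int w ^ (R - 1) dvd N R" by (simp add: coprime_dvd_mult_right_iff)
      have tR: "\<bar>f ((S ^^ R) z)\<bar> = \<bar>f z\<bar> / B ^ R" unfolding fS using B(2) by (simp add: abs_divide)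
      have "B ^ h * B ^ R \<le> \<bar>f z\<bar>" using J2 Rh by (simp add: power_add[symmetric] add.commute)
      hence t_lo: "B ^ h \<le> \<bar>f ((S ^^ R) z)\<bar>" unfolding tR using B(2) by (simp add: field_simps)
      have "B ^ n = B ^ Suc h * B ^ R" unfolding J Rh[symmetric] by (simp add: power_add)
      hence "\<bar>f z\<bar> < B ^ Suc h * B ^ R" using n by simp
      hence t_hi: "\<bar>f ((S ^^ R) z)\<bar> < B ^ Suc h" unfolding tR using B(2) by (simp add: field_simps)
      have "1 < B ^ h" using B(2) h1 by (intro one_less_power) auto
      hence big: "1 < \<bar>f ((S ^^ R) z)\<bar>" using t_lo by simp
      have NR: "\<bar>f ((S ^^ R) z) - of_int (N R)\<bar> < \<epsilon>" using N \<open>R \<ge> 1\<close> by simp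
      have "N R \<noteq> 0" using NR big ep by auto
      hence "int w ^ (R - 1) \<le> \<bar>N R\<bar>" using dv by (simp add: zdvd_imp_le)
      hence "real w ^ (R - 1) \<le> \<bar>of_int (N R)\<bar>" by (metis of_int_abs of_int_le_iff of_int_of_nat_eq of_int_power)
      also have "\<bar>of_int (N R)\<bar> < 2 * \<bar>f ((S ^^ R) z)\<bar>" using NR big ep by linarith
      also have "\<dots> < 2 * B ^ Suc h" using t_hi by simp
      also have "\<dots> \<le> 2 * (2 ^ e) ^ Suc h" using e B(2) by (intro mult_left_mono power_mono) auto
      also have "\<dots> = 2 ^ (e * (h + 1) + 1)" by (simp add: power_mult[symmetric] power_add)
      also have "\<dots> \<le> 2 ^ (R - 1)" using R_big by (intro power_increasing) auto
      also have "\<dots> \<le> real w ^ (R - 1)" using w by (intro power_mono) auto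
      finally show False by simp
    qed
    then obtain k where k: "1 \<le> k" "k \<le> R" "far (f ((S ^^ k) z))" by auto
    then obtain k' where k': "k = Suc k'" by (cases k) auto
    have "B ^ (A ^ i) \<le> B ^ h" using hA B by (intro power_increasing) auto
    also have "B ^ h * B ^ k \<le> \<bar>f z\<bar>"
    proof -
      have "B ^ h * B ^ k \<le> B ^ h * B ^ R" using k B by (intro mult_left_mono power_increasing) auto
      thus ?thesis using J2 Rh by (simp add: power_add[symmetric] add.commute)
    qed
    hence "B ^ h \<le> \<bar>f ((S ^^ k) z)\<bar>" unfolding fS using B(2) by (simp add: abs_divide field_simps)
    finally have IH: "cmod (\<phi> ((S ^^ k) z)) \<le> \<theta> ^ i" by (rule Suc.IH)
    have "cmod (\<phi> z) = cmod (mprod k' z) * cmod (m ((S ^^ k) z)) * cmod (\<phi> ((S ^^ k) z))"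
      by (subst phi_iterate[of z k]) (simp only: k' mprod_Suc norm_mult)
    also have "\<dots> \<le> 1 * \<theta> * \<theta> ^ i"
      by (intro mult_mono mprod_le_1 th(3) k(3) IH) (use th in auto)
    finally show ?case by simp
  qed
  show ?thesis by (rule that[OF th(1,2)]) (use claim in \<open>simp add: A_def\<close>)
qed

text \<open>A frequency set whose level \<open>k\<close> differences have \<open>f\<close>-length at least \<open>C u\<^sup>k\<close>, while \<open>f\<close> shrinks
  only by \<open>B = u/w\<close> per level, is too sparse. Frequencies with \<open>f\<close>-length about \<open>u\<^sup>n\<close> first
  matter at level \<open>n\<close>, where \<open>f (S\<^sup>n v)\<close> is about \<open>w\<^sup>n\<close>; by the decay lemma they contribute little. The
  relative contributions along a geometric sequence of levels have a finite sum, so a positive part of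
  the mass in Parseval's identity is missing.\<close>

proposition no_fast_gaps:
  fixes \<alpha> \<gamma> B C :: real and u w :: nat
  assumes t: "tight \<Lambda>" and f: "\<And>z. f z = \<alpha> * z $ 1 + \<gamma> * (z :: real^2) $ 2"
    and fT: "\<And>z. f (T z) = B * f z" and B: "B = real u / real w" "B > 1" and w: "w \<ge> 2" "coprime u w"
    and fL: "\<And>z. z \<in> integer_lattice \<Longrightarrow> f z \<in> \<int>"
    and C: "C > 0"
    and gaps: "\<And>v x. v \<in> \<Lambda> \<Longrightarrow> x \<in> \<Lambda> \<Longrightarrow> v \<noteq> x \<Longrightarrow>
        \<exists>k z. 1 \<le> k \<and> z \<in> Z0 \<and> v - x = (T ^^ k) z \<and> C * real u ^ k \<le> \<bar>f (v - x)\<bar>"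
  shows False
proof -
  have f_add: "f (x + y) = f x + f y" and f_diff: "f (x - y) = f x - f y" for x y
    unfolding f by (simp_all add: algebra_simps)
  have fTn: "f ((T ^^ k) y) = B ^ k * f y" for y k by (induction k) (simp_all add: fT)
  have fS: "f ((S ^^ k) z) = f z / B ^ k" for k z
  proof -
    have "f z = B ^ k * f ((S ^^ k) z)" using fTn[of k "(S ^^ k) z"] by simp
    moreover have "B ^ k \<noteq> 0" using B(2) by simp
    ultimately show ?thesis by simp
  qed
  obtain e where e: "B < 2 ^ e" using real_arch_pow[of 2 B] by auto
  have e1: "e \<ge> 1" using e B(2) by (cases e) auto
  obtain \<theta> where th: "0 < \<theta>" "\<theta> < 1" and decay: "\<And>i z. B ^ ((2 * e + 4) ^ i) \<le> \<bar>f z\<bar> \<Longrightarrow> cmod (\<phi> z) \<le> \<theta> ^ i"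
    using eigenfunctional_decay[OF f fT B w fL less_imp_le[OF e]] by blast
  define A where "A = 2 * e + 4"
  have A2: "A \<ge> 2" by (simp add: A_def)
  have cL: "countable \<Lambda>" using t by (simp add: tight_def)
  obtain C0 where C0: "countable C0" "\<And>\<xi>. \<xi> $ 1 \<notin> C0 \<Longrightarrow> ((\<lambda>v. (cmod (\<phi> (\<xi> + v)))\<^sup>2) has_sum 1) \<Lambda>"
    using t unfolding tight_def by blast
  obtain \<xi> where \<xi>: "\<xi> $ 1 \<notin> C0" and nz: "\<And>v. v \<in> \<Lambda> \<Longrightarrow> \<phi> (\<xi> + v) \<noteq> 0"
    and "\<And>v k. v \<in> \<Lambda> \<Longrightarrow> (S ^^ k) (\<xi> + v) \<notin> integer_lattice"
    by (rule generic_point[OF C0(1) cL]) (rule that; blast)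
  have uB: "real u = B * real w" using B w by simp
  have u2: "u \<ge> 2"
  proof -
    have "real w < real u" unfolding uB using B(2) w(1) by simp
    thus ?thesis using w(1) by simp
  qed
  \<comment> \<open>Two frequencies in \<open>L n\<close> are separated at a level up to \<open>n\<close>.\<close>
  define L where "L n = {v \<in> \<Lambda>. \<bar>f v\<bar> < C * real u ^ Suc n / 2}" for n
  have L_sub: "L n \<subseteq> \<Lambda>" for n by (auto simp: L_def)
  have L_mono: "L i \<subseteq> L j" if "i \<le> j" for i j
  proof -
    have "C * real u ^ Suc i / 2 \<le> C * real u ^ Suc j / 2"
      using that u2 C by (intro divide_right_mono mult_left_mono power_increasing) auto
    thus ?thesis by (auto simp: L_def)
  qed
  have lev: "\<exists>k z. 1 \<le> k \<and> k \<le> n \<and> z \<in> Z0 \<and> v - x = (T ^^ k) z" if vx: "v \<in> L n" "x \<in> L n" "v \<noteq> x" for v x n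
  proof -
    obtain k z where k: "1 \<le> k" "z \<in> Z0" "v - x = (T ^^ k) z" "C * real u ^ k \<le> \<bar>f (v - x)\<bar>"
      using gaps[OF subsetD[OF L_sub vx(1)] subsetD[OF L_sub vx(2)] vx(3)] by blast
    have "\<bar>f (v - x)\<bar> < C * real u ^ Suc n" using vx(1,2) unfolding f_diff L_def by auto
    hence "C * real u ^ k < C * real u ^ Suc n" using k by linarith
    hence "real u ^ k < real u ^ Suc n" using C by simp
    hence "k < Suc n" using u2 by (simp add: power_less_imp_less_exp del: power_Suc)
    thus ?thesis using k by (intro exI[of _ k] exI[of _ z]) auto
  qed
  \<comment> \<open>Outside \<open>L n\<close> the value \<open>f (S\<^sup>k v)\<close> is still at least about \<open>w\<^sup>n / B\<^sup>k\<^sup>-\<^sup>n\<close>. As \<open>B < 2\<^sup>e\<close> and \<open>w \<ge> 2\<close>, this is large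
    even for \<open>k\<close> slightly greater than \<open>n\<close>.\<close>
  obtain N where N: "4 / (C * real u) < 2 ^ N" using real_arch_pow[of 2 "4 / (C * real u)"] by auto
  obtain N' where N': "4 * \<bar>f \<xi>\<bar> / C < 2 ^ N'" using real_arch_pow[of 2 "4 * \<bar>f \<xi>\<bar> / C"] by auto
  define n3 where "n3 = max (4 * N) N'"
  have far: "cmod (\<phi> ((S ^^ k) (\<xi> + v))) \<le> \<theta> ^ i"
    if n': "n3 \<le> n" "4 * e * A ^ i \<le> n" "k \<le> n + n div (2 * e)" and v: "v \<in> \<Lambda>" "v \<notin> L n" for i n k v
  proof (rule decay[folded A_def])
    have n: "max (4 * N) N' \<le> n" "4 * e * A ^ i \<le> n" "k \<le> n + n div (2 * e)" using n' by (auto simp: n3_def)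
    have "(2 :: real) ^ N' \<le> 2 ^ n" using n by (intro power_increasing) auto
    hence "4 * \<bar>f \<xi>\<bar> / C \<le> 2 ^ n" using N' by linarith
    also have "\<dots> \<le> real u ^ n" using u2 by (intro power_mono) auto
    also have "\<dots> \<le> real u ^ Suc n" using u2 by (intro power_increasing) auto
    finally have x1: "\<bar>f \<xi>\<bar> \<le> C * real u ^ Suc n / 4" using C by (simp add: field_simps)
    have "C * real u ^ Suc n / 2 \<le> \<bar>f v\<bar>" using v by (auto simp: L_def)
    hence x2: "C * real u ^ Suc n / 4 \<le> \<bar>f (\<xi> + v)\<bar>" unfolding f_add using x1 by linarith
    have q1: "e * (n div (2 * e)) \<le> n div 2"
    proof -
      have "2 * (e * (n div (2 * e))) \<le> n" using times_div_less_eq_dividend[of "2 * e" n] by (simp add: mult.assoc)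
      thus ?thesis by linarith
    qed
    have "B ^ k \<le> B ^ (n + n div (2 * e))" using n B by (intro power_increasing) auto
    also have "\<dots> \<le> B ^ n * (2 ^ e) ^ (n div (2 * e))"
      unfolding power_add using B(2) e by (intro mult_left_mono power_mono) auto
    also have "(2 ^ e :: real) ^ (n div (2 * e)) = 2 ^ (e * (n div (2 * e)))" by (simp add: power_mult)
    also have "B ^ n * 2 ^ (e * (n div (2 * e))) \<le> B ^ n * 2 ^ (n div 2)"
      using q1 B by (intro mult_left_mono power_increasing) auto
    finally have Bk: "B ^ k \<le> B ^ n * 2 ^ (n div 2)" .
    have "B ^ (A ^ i) \<le> (2 ^ e) ^ (A ^ i)" using e B by (intro power_mono) auto
    also have "\<dots> = 2 ^ (e * A ^ i)" by (simp add: power_mult)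
    also have "\<dots> \<le> 2 ^ (n div 4)" using n(2) by (intro power_increasing) auto
    finally have BA: "B ^ (A ^ i) \<le> 2 ^ (n div 4)" .
    have "4 / (C * real u) \<le> 2 ^ (n div 4)"
    proof -
      have "N \<le> n div 4" using n(1) by auto
      hence "(2 :: real) ^ N \<le> 2 ^ (n div 4)" by (intro power_increasing) auto
      thus ?thesis using N by linarith
    qed
    hence CU: "1 \<le> C * real u / 4 * 2 ^ (n div 4)" using C u2 by (simp add: field_simps)
    have "B ^ (A ^ i) * B ^ k \<le> 2 ^ (n div 4) * (B ^ n * 2 ^ (n div 2))"
      by (intro mult_mono BA Bk) (use B in auto)
    also have "\<dots> \<le> (C * real u / 4 * 2 ^ (n div 4)) * (2 ^ (n div 4) * (B ^ n * 2 ^ (n div 2)))"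
      using CU mult_right_mono[OF CU, of "2 ^ (n div 4) * (B ^ n * 2 ^ (n div 2))"] B by simp
    also have "\<dots> = C * real u / 4 * B ^ n * 2 ^ (n div 4 + n div 4 + n div 2)"
      by (simp add: power_add algebra_simps)
    also have "\<dots> \<le> C * real u / 4 * B ^ n * 2 ^ n"
      using C B by (intro mult_left_mono power_increasing) auto
    also have "\<dots> \<le> C * real u / 4 * B ^ n * real w ^ n"
      using C B w by (intro mult_left_mono power_mono) auto
    also have "\<dots> = C * real u ^ Suc n / 4" unfolding uB by (simp add: power_mult_distrib)
    also have "\<dots> \<le> \<bar>f (\<xi> + v)\<bar>" by (rule x2)
    finally have "B ^ (A ^ i) * B ^ k \<le> \<bar>f (\<xi> + v)\<bar>" .
    thus "B ^ (A ^ i) \<le> \<bar>f ((S ^^ k) (\<xi> + v))\<bar>"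
      unfolding fS using B(2) by (simp add: abs_divide field_simps)
  qed
  \<comment> \<open>\<open>g F n\<close> is the mass that is missing when only frequencies from \<open>L n\<close> are counted. On the way from \<open>n\<close> to
    \<open>s n\<close> at most the fraction \<open>\<theta>\<^sup>i\<close> of it can be filled, by Bessel's inequality for \<open>s n\<close> factors.\<close>
  define g where "g F n = 1 - (\<Sum>v\<in>F \<inter> L n. (cmod (\<phi> (\<xi> + v)))\<^sup>2)" for F n
  define s where "s n = n + n div (2 * e)" for n
  have g0: "g F n \<ge> 0" if "finite F" "F \<subseteq> \<Lambda>" for F n
    unfolding g_def using tight_Bessel[OF t, of "F \<inter> L n" \<xi>] that by auto
  have step: "(1 - \<theta> ^ i) * g F n \<le> g F (s n)"
    if F: "finite F" "F \<subseteq> \<Lambda>" and n: "n3 \<le> n" "4 * e * A ^ i \<le> n" for F n i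
  proof -
    define X where "X = F \<inter> L n"
    define Y where "Y = F \<inter> L (s n) - X"
    have XY: "F \<inter> L (s n) = X \<union> Y" "X \<inter> Y = {}" "finite X" "finite Y"
      using L_mono[of n "s n"] F(1) by (auto simp: X_def Y_def s_def)
    have bes: "(\<Sum>v\<in>X \<union> Y. (cmod (mprod (s n) (\<xi> + v)))\<^sup>2) \<le> 1"
    proof (rule Bessel_mprod)
      fix v w assume vw: "v \<in> X \<union> Y" "w \<in> X \<union> Y" "v \<noteq> w"
      hence "v \<in> L (s n)" "w \<in> L (s n)" using XY(1) by auto
      thus "\<exists>k z. 1 \<le> k \<and> k \<le> s n \<and> z \<in> Z0 \<and> v - w = (T ^^ k) z" using vw(3) by (rule lev)
    qed (use XY in auto)
    have "(\<Sum>v\<in>Y. (cmod (\<phi> (\<xi> + v)))\<^sup>2) \<le> (\<Sum>v\<in>Y. \<theta> ^ i * (cmod (mprod (s n) (\<xi> + v)))\<^sup>2)"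
    proof (rule sum_mono)
      fix v assume v: "v \<in> Y"
      have d: "cmod (\<phi> ((S ^^ s n) (\<xi> + v))) \<le> \<theta> ^ i"
        by (rule far[OF n]) (use v F in \<open>auto simp: s_def X_def Y_def\<close>)
      have "(cmod (\<phi> ((S ^^ s n) (\<xi> + v))))\<^sup>2 \<le> \<theta> ^ i * 1"
        unfolding power2_eq_square by (intro mult_mono d phi_le_1) (use th in auto)
      hence "(cmod (mprod (s n) (\<xi> + v)))\<^sup>2 * (cmod (\<phi> ((S ^^ s n) (\<xi> + v))))\<^sup>2 \<le> (cmod (mprod (s n) (\<xi> + v)))\<^sup>2 * \<theta> ^ i"
        by (intro mult_left_mono) auto
      moreover have "(cmod (\<phi> (\<xi> + v)))\<^sup>2 = (cmod (mprod (s n) (\<xi> + v)))\<^sup>2 * (cmod (\<phi> ((S ^^ s n) (\<xi> + v))))\<^sup>2"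
        by (subst phi_iterate[of "\<xi> + v" "s n"]) (simp add: norm_mult power_mult_distrib)
      ultimately show "(cmod (\<phi> (\<xi> + v)))\<^sup>2 \<le> \<theta> ^ i * (cmod (mprod (s n) (\<xi> + v)))\<^sup>2" by (simp add: mult.commute)
    qed
    also have "\<dots> = \<theta> ^ i * (\<Sum>v\<in>Y. (cmod (mprod (s n) (\<xi> + v)))\<^sup>2)" by (simp add: sum_distrib_left)
    also have "\<dots> \<le> \<theta> ^ i * g F n"
    proof (intro mult_left_mono)
      have "(\<Sum>v\<in>X. (cmod (\<phi> (\<xi> + v)))\<^sup>2) \<le> (\<Sum>v\<in>X. (cmod (mprod (s n) (\<xi> + v)))\<^sup>2)"
        by (intro sum_mono power_mono phi_le_mprod) auto
      thus "(\<Sum>v\<in>Y. (cmod (mprod (s n) (\<xi> + v)))\<^sup>2) \<le> g F n"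
        using bes XY unfolding g_def X_def[symmetric] by (simp add: sum.union_disjoint)
    qed (use th in auto)
    finally have Yb: "(\<Sum>v\<in>Y. (cmod (\<phi> (\<xi> + v)))\<^sup>2) \<le> \<theta> ^ i * g F n" .
    have "g F (s n) = g F n - (\<Sum>v\<in>Y. (cmod (\<phi> (\<xi> + v)))\<^sup>2)"
      unfolding g_def XY(1) X_def[symmetric] using XY by (simp add: sum.union_disjoint)
    thus ?thesis using Yb by (simp add: algebra_simps)
  qed
  \<comment> \<open>A bounded number \<open>h\<close> of such steps multiplies \<open>n\<close> by \<open>A\<close>, after which \<open>i\<close> may be raised by one. The
    fractions lost are therefore dominated by a geometric series.\<close>
  define r where "r = 1 + 1 / (4 * real e)"
  have r1: "r > 1" using e1 by (simp add: r_def)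
  obtain h where h: "real A < r ^ h" using real_arch_pow[OF r1] by blast
  have s_grow: "r * real n \<le> real (s n)" if "4 * e \<le> n" for n
  proof -
    have "real n / (2 * real e) < real (n div (2 * e)) + 1"
    proof -
      have "n < 2 * e * (n div (2 * e) + 1)" using e1 dividend_less_times_div[of "2 * e" n] by simp
      hence "real n < real (2 * e * (n div (2 * e) + 1))" by (simp only: of_nat_less_iff)
      thus ?thesis using e1 by (simp add: field_simps)
    qed
    moreover have "1 \<le> real n / (4 * real e)"
    proof -
      have "real (4 * e) \<le> real n" using that by (simp only: of_nat_le_iff)
      thus ?thesis using e1 by (simp add: field_simps)
    qed
    moreover have "real n / (2 * real e) = real n / (4 * real e) + real n / (4 * real e)" by (simp add: field_simps)
    ultimately have "real n / (4 * real e) \<le> real (n div (2 * e))" by linarith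
    thus ?thesis by (simp add: r_def s_def algebra_simps)
  qed
  have iter: "n \<le> (s ^^ j) n \<and> r ^ j * real n \<le> real ((s ^^ j) n) \<and> (1 - \<theta> ^ i) ^ j * g F n \<le> g F ((s ^^ j) n)"
    if F: "finite F" "F \<subseteq> \<Lambda>" and n: "n3 \<le> n" "4 * e * A ^ i \<le> n" for F n i j
  proof (induction j)
    case (Suc j)
    let ?k = "(s ^^ j) n"
    have k: "n \<le> ?k" "r ^ j * real n \<le> real ?k" "(1 - \<theta> ^ i) ^ j * g F n \<le> g F ?k" using Suc by auto
    have "4 * e * 1 \<le> 4 * e * A ^ i" using A2 by (intro mult_le_mono) auto
    hence "4 * e \<le> ?k" using n k by linarith
    hence "r * real ?k \<le> real (s ?k)" by (rule s_grow)
    moreover have "r * (r ^ j * real n) \<le> r * real ?k" using k r1 by (intro mult_left_mono) auto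
    ultimately have 1: "r ^ Suc j * real n \<le> real (s ?k)" by (simp add: mult.assoc)
    have th1: "0 \<le> 1 - \<theta> ^ i" using th by (simp add: power_le_one)
    have "(1 - \<theta> ^ i) * ((1 - \<theta> ^ i) ^ j * g F n) \<le> (1 - \<theta> ^ i) * g F ?k" using k th1 by (intro mult_left_mono) auto
    also have "\<dots> \<le> g F (s ?k)" by (rule step[OF F]) (use n k in auto)
    finally have 2: "(1 - \<theta> ^ i) ^ Suc j * g F n \<le> g F (s ?k)" by (simp add: mult.assoc)
    have "n \<le> s ?k" using k(1) by (simp add: s_def)
    thus ?case using 1 2 by simp
  qed auto
  define sh where "sh = s ^^ h"
  have block: "A * n \<le> sh n \<and> (1 - real h * \<theta> ^ i) * g F n \<le> g F (sh n)"
    if F: "finite F" "F \<subseteq> \<Lambda>" and n: "n3 \<le> n" "4 * e * A ^ i \<le> n" for F n i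
  proof -
    note it = iter[OF F n, of h]
    have "real A * real n \<le> r ^ h * real n" using h by (intro mult_right_mono) auto
    hence "real (A * n) \<le> real (sh n)" using it by (simp add: sh_def)
    hence 1: "A * n \<le> sh n" by (simp only: of_nat_le_iff)
    have "1 + real h * (- (\<theta> ^ i)) \<le> (1 + - (\<theta> ^ i)) ^ h"
      by (rule Bernoulli_inequality) (use th in \<open>simp add: power_le_one\<close>)
    hence "(1 - real h * \<theta> ^ i) * g F n \<le> (1 - \<theta> ^ i) ^ h * g F n"
      using g0[OF F] by (intro mult_right_mono) auto
    thus ?thesis using 1 it by (simp add: sh_def)
  qed
  obtain i1 where i1: "\<theta> ^ i1 < (1 - \<theta>) / (2 * (real h + 1))"
    using real_arch_pow_inv[of "(1 - \<theta>) / (2 * (real h + 1))" \<theta>] th by auto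
  define i0 where "i0 = max i1 n3"
  have "\<theta> ^ i0 \<le> \<theta> ^ i1" using th by (intro power_decreasing) (auto simp: i0_def)
  hence "\<theta> ^ i0 \<le> (1 - \<theta>) / (2 * (real h + 1))" using i1 by linarith
  hence "(real h + 1) * \<theta> ^ i0 \<le> (real h + 1) * ((1 - \<theta>) / (2 * (real h + 1)))" by (intro mult_left_mono) auto
  also have "\<dots> = (1 - \<theta>) / 2"
  proof -
    have "real h + 1 \<noteq> 0" by linarith
    thus ?thesis by (metis divide_divide_eq_left' nonzero_mult_div_cancel_left times_divide_eq_right)
  qed
  finally have "(real h + 1) * \<theta> ^ i0 \<le> (1 - \<theta>) / 2" .
  moreover have "real h * \<theta> ^ i0 \<le> (real h + 1) * \<theta> ^ i0" using th by (intro mult_right_mono) auto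
  ultimately have i0: "real h * \<theta> ^ i0 \<le> (1 - \<theta>) / 2" by linarith
  have Apow: "i \<le> 4 * e * A ^ i" for i
  proof -
    have "i \<le> 2 ^ i" by (simp add: less_imp_le)
    also have "\<dots> \<le> A ^ i" using A2 by (intro power_mono) auto
    also have "\<dots> \<le> 4 * e * A ^ i" using e1 by simp
    finally show ?thesis .
  qed
  define N where "N j = (sh ^^ j) (4 * e * A ^ i0)" for j
  have N_big: "4 * e * A ^ (i0 + j) \<le> N j" for j
  proof (induction j)
    case (Suc j)
    have "n3 \<le> N j" using Suc Apow[of "i0 + j"] by (simp add: i0_def)
    hence "A * N j \<le> sh (N j)" using block[of "{}" "N j" "i0 + j"] Suc by simp
    moreover have "A * (4 * e * A ^ (i0 + j)) \<le> A * N j" using Suc by (intro mult_le_mono) auto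
    moreover have "4 * e * A ^ (i0 + Suc j) = A * (4 * e * A ^ (i0 + j))" by simp
    moreover have "N (Suc j) = sh (N j)" by (simp add: N_def)
    ultimately show ?case by linarith
  qed (simp add: N_def)
  have N_n3: "n3 \<le> N j" for j using N_big[of j] Apow[of "i0 + j"] by (simp add: i0_def)
  have NS: "N (Suc j) = sh (N j)" for j by (simp add: N_def)
  have geo: "(\<Sum>i<j. real h * \<theta> ^ (i0 + i)) \<le> 1 / 2" for j
  proof -
    have "(\<Sum>i<j. real h * \<theta> ^ (i0 + i)) = (real h * \<theta> ^ i0) * (\<Sum>i<j. \<theta> ^ i)"
      by (simp add: power_add sum_distrib_left mult_ac)
    also have "\<dots> \<le> (1 - \<theta>) / 2 * (\<Sum>i<j. \<theta> ^ i)" using i0 th by (intro mult_right_mono sum_nonneg) auto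
    also have "\<dots> = (1 - \<theta> ^ j) / 2" by (simp add: one_diff_power_eq)
    also have "\<dots> \<le> 1 / 2" using th by simp
    finally show ?thesis .
  qed
  have total: "(1 - (\<Sum>i<j. real h * \<theta> ^ (i0 + i))) * g F (N 0) \<le> g F (N j)" if F: "finite F" "F \<subseteq> \<Lambda>" for F j
  proof (induction j)
    case (Suc j)
    let ?x = "real h * \<theta> ^ (i0 + j)" and ?S = "\<Sum>i<j. real h * \<theta> ^ (i0 + i)"
    have S0: "0 \<le> ?S" "0 \<le> ?x" using th by (auto intro!: sum_nonneg)
    have x1: "?x \<le> 1" using geo[of "Suc j"] S0 by simp
    have "1 - (X + x) \<le> (1 - x) * (1 - X)" if "0 \<le> X" "0 \<le> x" for X x :: real
      using mult_nonneg_nonneg[OF that] by (simp add: algebra_simps)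
    hence "(1 - (?S + ?x)) * g F (N 0) \<le> ((1 - ?x) * (1 - ?S)) * g F (N 0)"
      using S0 g0[OF F] by (intro mult_right_mono) blast+
    also have "\<dots> = (1 - ?x) * ((1 - ?S) * g F (N 0))" by simp
    also have "\<dots> \<le> (1 - ?x) * g F (N j)" using Suc x1 by (intro mult_left_mono) auto
    also have "\<dots> \<le> g F (N (Suc j))" unfolding NS using block[OF F N_n3 N_big] by blast
    finally show ?case by simp
  qed simp
  \<comment> \<open>Some mass is missing at the start, because differences of high levels leave \<open>L (N 0)\<close>.\<close>
  obtain x0 where x0: "x0 \<in> \<Lambda>" "x0 \<notin> L (N 0)"
  proof (rule ccontr)
    assume "\<not> thesis"
    hence all: "\<Lambda> \<subseteq> L (N 0)" using that by blast
    obtain l0 where l0: "real p * C * real u ^ Suc (N 0) < B ^ l0" using real_arch_pow[OF B(2)] by blast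
    define l where "l = Suc l0"
    have l: "real p * C * real u ^ Suc (N 0) < B ^ l" "l \<ge> 1"
    proof -
      have "B ^ l0 \<le> B ^ l" using B(2) by (intro power_increasing) (auto simp: l_def)
      thus "real p * C * real u ^ Suc (N 0) < B ^ l" using l0 by linarith
    qed (simp add: l_def)
    obtain v x z where vx: "v \<in> \<Lambda>" "x \<in> \<Lambda>" "z \<in> Z0" "v - x = (T ^^ l) z" by (rule all_levels_occur[OF t l(2)])
    have "v \<noteq> x" using vx Tn_Z0_ne by auto
    then obtain k where "C * real u ^ k \<le> \<bar>f (v - x)\<bar>" using gaps vx by blast
    moreover have "0 < C * real u ^ k" using C u2 by simp
    ultimately have "f z \<noteq> 0" unfolding vx(4) fTn by auto
    obtain n r' where "adm n r'" and nr: "z $ 1 = of_int n / real p" "z $ 2 = of_int r' / real p"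
      by (rule Z0E[OF vx(3)])
    have "real p * f z = f (vector [of_int n, of_int r'])" unfolding f nr using p_pos by (simp add: field_simps)
    also have "\<dots> \<in> \<int>" by (rule fL) (simp add: integer_lattice_iff)
    finally have "1 \<le> \<bar>real p * f z\<bar>" using \<open>f z \<noteq> 0\<close> p_pos by (intro Ints_nonzero_abs_ge1) auto
    hence "B ^ l * 1 \<le> B ^ l * \<bar>real p * f z\<bar>" using B by (intro mult_left_mono) auto
    also have "\<dots> = real p * \<bar>f (v - x)\<bar>" unfolding vx(4) fTn using B(2) by (simp add: abs_mult)
    also have "\<dots> < real p * (C * real u ^ Suc (N 0))"
    proof -
      have "v \<in> L (N 0)" "x \<in> L (N 0)" using all vx by auto
      hence "\<bar>f (v - x)\<bar> < C * real u ^ Suc (N 0)" unfolding f_diff L_def by auto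
      thus ?thesis using p_pos by simp
    qed
    finally show False using l(1) by (simp add: mult.assoc)
  qed
  define c0 where "c0 = (cmod (\<phi> (\<xi> + x0)))\<^sup>2"
  have c0: "c0 > 0" using nz[OF x0(1)] by (simp add: c0_def)
  have bound: "(\<Sum>v\<in>F. (cmod (\<phi> (\<xi> + v)))\<^sup>2) \<le> 1 - c0 / 2" if F: "finite F" "F \<subseteq> \<Lambda>" for F
  proof -
    have "\<exists>j. F \<subseteq> L (N j)"
      using F
    proof (induction F rule: finite_induct)
      case (insert v F)
      then obtain j where j: "F \<subseteq> L (N j)" by auto
      obtain i where i: "2 * \<bar>f v\<bar> / C < real u ^ i" using real_arch_pow[of "real u" "2 * \<bar>f v\<bar> / C"] u2 by auto
      have "2 * \<bar>f v\<bar> < C * real u ^ i" using i C by (simp add: field_simps)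
      also have "\<dots> \<le> C * real u ^ Suc i" using u2 C by (intro mult_left_mono power_increasing) auto
      finally have vi: "v \<in> L i" using insert.prems by (simp add: L_def)
      have Nj: "j \<le> N j" for j using N_big[of j] Apow[of "i0 + j"] by simp
      have Nmono: "N j \<le> N (j + d)" for d
      proof (induction d)
        case (Suc d)
        have "N (j + d) \<le> A * N (j + d)" using A2 by simp
        also have "\<dots> \<le> sh (N (j + d))" using block[of "{}" "N (j + d)" "i0 + (j + d)"] N_n3 N_big by simp
        finally show ?case using Suc NS[of "j + d"] by simp
      qed simp
      have "F \<subseteq> L (N (j + i))" using j L_mono[OF Nmono] by blast
      moreover have "v \<in> L (N (j + i))" using vi L_mono[of i "N (j + i)"] Nj[of "j + i"] by auto
      ultimately show ?case by blast
    qed auto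
    then obtain j where j: "F \<subseteq> L (N j)" ..
    have "c0 + (\<Sum>v\<in>F \<inter> L (N 0). (cmod (\<phi> (\<xi> + v)))\<^sup>2) = (\<Sum>v\<in>insert x0 (F \<inter> L (N 0)). (cmod (\<phi> (\<xi> + v)))\<^sup>2)"
      using x0 F by (simp add: c0_def)
    also have "\<dots> \<le> 1" by (rule tight_Bessel[OF t]) (use F x0 in auto)
    finally have gc: "c0 \<le> g F (N 0)" by (simp add: g_def)
    have "c0 / 2 \<le> (1 - (\<Sum>i<j. real h * \<theta> ^ (i0 + i))) * g F (N 0)"
    proof -
      have "(1 / 2) * c0 \<le> (1 - (\<Sum>i<j. real h * \<theta> ^ (i0 + i))) * g F (N 0)"
        by (rule mult_mono) (use geo[of j] gc c0 in auto)
      thus ?thesis by simp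
    qed
    also have "\<dots> \<le> g F (N j)" by (rule total[OF F])
    also have "g F (N j) = 1 - (\<Sum>v\<in>F. (cmod (\<phi> (\<xi> + v)))\<^sup>2)" using j by (simp add: g_def Int_absorb2)
    finally show ?thesis by simp
  qed
  obtain F0 where F0: "finite F0" "F0 \<subseteq> \<Lambda>" "\<bar>(\<Sum>v\<in>F0. (cmod (\<phi> (\<xi> + v)))\<^sup>2) - 1\<bar> < c0 / 2"
    using has_sum_finite_approx[OF C0(2)[OF \<xi>], of "c0 / 2"] c0 by auto
  show False using bound[OF F0(1,2)] F0(3) by linarith
qed

end

section \<open>Powers of a real number modulo a prime\<close>

definition ieval :: "real \<Rightarrow> int poly \<Rightarrow> real" where
  "ieval b q = poly (map_poly of_int q) b"

lemma ieval_0 [simp]: "ieval b 0 = 0" and ieval_1 [simp]: "ieval b 1 = 1"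
  and ieval_pCons [simp]: "ieval b (pCons x q) = of_int x + b * ieval b q"
  by (simp_all add: ieval_def map_poly_pCons)

lemma ieval_add [simp]: "ieval b (q + r) = ieval b q + ieval b r"
  by (induction q r rule: poly_induct2) (simp_all add: algebra_simps)

lemma ieval_smult [simp]: "ieval b (smult x q) = of_int x * ieval b q"
  by (induction q rule: pCons_induct) (simp_all add: algebra_simps)

lemma ieval_minus [simp]: "ieval b (- q) = - ieval b q"
  using ieval_smult[of b "-1" q] by simp

lemma ieval_diff [simp]: "ieval b (q - r) = ieval b q - ieval b r"
  using ieval_add[of b q "- r"] by simp

lemma ieval_mult [simp]: "ieval b (q * r) = ieval b q * ieval b r"
  by (induction q rule: pCons_induct) (simp_all add: algebra_simps)

lemma ieval_monom [simp]: "ieval b (monom x k) = of_int x * b ^ k"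
  by (induction k) (simp_all add: monom_0 monom_Suc)

text \<open>A form of Gauss's lemma.\<close>

lemma primitive_dvd_smult:
  fixes P f q :: "int poly"
  assumes "content P = 1" "x \<noteq> 0" "smult x f = P * q"
  shows "P dvd f"
proof -
  have "smult x f = smult (content (smult x f)) (primitive_part (smult x f))"
    by (simp only: content_times_primitive_part)
  have c: "primitive_part (smult x f) = P * primitive_part q"
    unfolding assms(3) primitive_part_mult using assms(1) content_times_primitive_part[of P] by simp
  have "primitive_part (smult x f) = smult (unit_factor x) (primitive_part f)"
    by (rule primitive_part_smult)
  hence "smult (unit_factor x) (smult (unit_factor x) (primitive_part f)) = smult (unit_factor x) (P * primitive_part q)"
    using c by simp
  moreover have "unit_factor x * unit_factor x = 1" using assms(2) by (simp add: sgn_if)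
  ultimately have "primitive_part f = smult (unit_factor x) (P * primitive_part q)" by simp
  hence "P dvd primitive_part f" by (simp add: dvd_smult)
  hence "P dvd smult (content f) (primitive_part f)" by (rule dvd_smult)
  thus ?thesis by (simp only: content_times_primitive_part)
qed

text \<open>A polynomial of least degree divides the others over the rationals, and its primitive part does so over
  the integers.\<close>

lemma minimal_integer_polynomial:
  fixes b :: real
  assumes "ieval b T = 0" "T \<noteq> 0"
  obtains P where "P \<noteq> 0" "ieval b P = 0" "\<And>f. ieval b f = 0 \<Longrightarrow> P dvd f"
proof -
  define Q where "Q f \<longleftrightarrow> f \<noteq> 0 \<and> ieval b f = 0" for f
  have "Q T" using assms by (simp add: Q_def)
  define P0 where "P0 = arg_min degree Q"
  have P0: "Q P0" "\<And>f. Q f \<Longrightarrow> degree P0 \<le> degree f"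
    using arg_min_nat_lemma[of Q T degree] \<open>Q T\<close> unfolding P0_def by auto
  define P where "P = primitive_part P0"
  have cP: "content P0 \<noteq> 0" using P0(1) by (simp add: Q_def)
  have eP: "ieval b P0 = of_int (content P0) * ieval b P"
    by (subst content_times_primitive_part[of P0, symmetric]) (simp only: ieval_smult P_def)
  have P: "P \<noteq> 0" "ieval b P = 0" "content P = 1" "degree P = degree P0"
    using P0(1) cP eP unfolding Q_def P_def by auto
  have "P dvd f" if f: "ieval b f = 0" for f
  proof -
    obtain x q where xq: "x \<noteq> 0" "smult x f = P * q + pseudo_mod f P"
      using pseudo_mod(1)[OF P(1), of f] by blast
    have "ieval b (smult x f) = ieval b (P * q + pseudo_mod f P)" using xq by simp
    hence "ieval b (pseudo_mod f P) = 0" using f P(2) by simp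
    hence "pseudo_mod f P = 0"
      using pseudo_mod(2)[OF P(1), of f] P0(2)[of "pseudo_mod f P"] P(4) unfolding Q_def by fastforce
    thus ?thesis using primitive_dvd_smult[OF P(3) xq(1), of f q] xq by simp
  qed
  thus ?thesis using that P by blast
qed

text \<open>If \<open>b\<close> is a root of an integer polynomial whose extreme coefficients are prime to \<open>p\<close>, then \<open>b\<close> is a
  unit at \<open>p\<close>: no power of \<open>b\<close> is \<open>p\<close> times an integer combination of powers of \<open>b\<close>. Otherwise the
  variable to the power \<open>k\<close>, minus \<open>p f\<close>, would be a multiple of the minimal integer polynomial \<open>P\<close> of \<open>b\<close>,
  which modulo \<open>p\<close> has two different nonzero extreme terms and so does not divide a power of the variable.\<close>

lemma power_not_multiple_of_prime:
  fixes b :: real and p :: int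
  assumes p: "prime p" and T: "ieval b T = 0" "\<not> p dvd lead_coeff T" "\<not> p dvd coeff T 0"
  shows "b ^ k \<noteq> of_int p * ieval b f"
proof
  assume eq: "b ^ k = of_int p * ieval b f"
  have "T \<noteq> 0" using T by auto
  then obtain P where P: "P \<noteq> 0" "ieval b P = 0" "\<And>f. ieval b f = 0 \<Longrightarrow> P dvd f"
    using minimal_integer_polynomial[OF T(1)] by blast
  define g where "g = monom 1 k - smult p f"
  have "ieval b g = 0" using eq by (simp add: g_def)
  then obtain B where B: "g = P * B" using P(3) by (auto simp: dvd_def)
  obtain A where A: "T = P * A" using P(3)[OF T(1)] by (auto simp: dvd_def)
  have lc: "\<not> p dvd lead_coeff P" using T(2) unfolding A lead_coeff_mult by auto
  have c0: "\<not> p dvd coeff P 0" using T(3) unfolding A coeff_mult_0 by (metis dvd_mult2)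
  have gk: "p dvd coeff g i \<longleftrightarrow> i \<noteq> k" for i
  proof (cases "i = k")
    case True
    have "\<not> p dvd 1 - p * coeff f k" using p by (metis dvd_add_right_iff dvd_triv_left diff_add_cancel not_prime_unit add.commute)
    thus ?thesis using True by (simp add: g_def)
  qed (simp add: g_def)
  define I where "I = {i. \<not> p dvd coeff B i}"
  have "I \<subseteq> {..degree B}" unfolding I_def by (auto simp: not_less intro: ccontr) (metis coeff_eq_0 dvd_0_right not_less)
  hence finI: "finite I" by (rule finite_subset) simp
  have neI: "I \<noteq> {}"
  proof
    assume "I = {}"
    hence "p dvd coeff g k" unfolding B coeff_mult by (intro dvd_sum) (auto simp: I_def)
    thus False using gk by simp
  qed
  define i where "i = Min I"
  define j where "j = Max I"
  have ij: "i \<in> I" "j \<in> I" "i \<le> j" unfolding i_def j_def using finI neI by auto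
  have imin: "p dvd coeff B l" if "l < i" for l
    using that finI unfolding i_def I_def[symmetric] by (metis (mono_tags, lifting) I_def Min_le mem_Collect_eq not_le)
  have jmax: "p dvd coeff B l" if "l > j" for l
    using that finI unfolding j_def by (metis (mono_tags, lifting) I_def Max_ge mem_Collect_eq not_le)
  have "\<not> p dvd coeff g i"
  proof -
    have "coeff g i = (\<Sum>l\<le>i. coeff B l * coeff P (i - l))" unfolding B by (subst mult.commute) (rule coeff_mult)
    also have "\<dots> = coeff B i * coeff P 0 + (\<Sum>l<i. coeff B l * coeff P (i - l))"
      by (simp add: lessThan_Suc_atMost[symmetric])
    finally have e: "coeff g i = coeff B i * coeff P 0 + (\<Sum>l<i. coeff B l * coeff P (i - l))" .
    have "p dvd (\<Sum>l<i. coeff B l * coeff P (i - l))" by (intro dvd_sum) (auto intro: imin dvd_mult2)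
    moreover have "\<not> p dvd coeff B i * coeff P 0" using ij c0 p by (simp add: I_def prime_dvd_mult_iff)
    ultimately show ?thesis unfolding e by (simp add: dvd_add_left_iff)
  qed
  moreover have "\<not> p dvd coeff g (degree P + j)"
  proof -
    have "coeff g (degree P + j) = (\<Sum>l\<le>degree P + j. coeff B l * coeff P (degree P + j - l))"
      unfolding B by (subst mult.commute) (rule coeff_mult)
    also have "\<dots> = coeff B j * coeff P (degree P) + (\<Sum>l\<in>{..degree P + j} - {j}. coeff B l * coeff P (degree P + j - l))"
      by (subst sum.remove[of _ j]) auto
    finally have e: "coeff g (degree P + j) = coeff B j * coeff P (degree P) + (\<Sum>l\<in>{..degree P + j} - {j}. coeff B l * coeff P (degree P + j - l))" .
    have "p dvd (\<Sum>l\<in>{..degree P + j} - {j}. coeff B l * coeff P (degree P + j - l))"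
    proof (intro dvd_sum)
      fix l assume "l \<in> {..degree P + j} - {j}"
      hence "l < j \<or> j < l" by auto
      thus "p dvd coeff B l * coeff P (degree P + j - l)"
        using jmax by (auto simp: coeff_eq_0)
    qed
    moreover have "\<not> p dvd coeff B j * coeff P (degree P)" using ij lc p by (simp add: I_def prime_dvd_mult_iff)
    ultimately show ?thesis unfolding e by (simp add: dvd_add_left_iff)
  qed
  ultimately have "i = k" "degree P + j = k" using gk by auto
  hence "degree P = 0" using ij by simp
  then obtain x where "P = [:x:]" by (rule degree_eq_zeroE)
  thus False using P(1,2) by simp
qed

lemma inverse_mod_prime:
  fixes p n :: int
  assumes "prime p" "\<not> p dvd n"
  obtains u e where "u * n = 1 + p * e"
proof -
  have "coprime n p" using assms by (metis coprime_commute prime_imp_coprime)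
  then obtain u v where "u * n + v * p = 1" using bezout_int[of n p] by auto
  thus ?thesis using that[of u "- v"] by (simp add: algebra_simps)
qed

text \<open>Infinitely many reals cannot all differ by multiples \<open>n b\<^sup>k\<close>, with \<open>n\<close> prime to \<open>p\<close>, of powers of such a
  \<open>b\<close>: modulo \<open>p\<close> the integer polynomials in \<open>b\<close> take only finitely many values, and two of the reals would
  be congruent.\<close>

lemma no_unit_polynomial:
  fixes b :: real and p :: int and X :: "real set"
  assumes p: "prime p" and inf: "infinite X"
    and X: "\<And>x y. x \<in> X \<Longrightarrow> y \<in> X \<Longrightarrow> x \<noteq> y \<Longrightarrow> \<exists>k n. \<not> p dvd n \<and> x - y = of_int n * b ^ k"
    and T: "ieval b T = 0" "\<not> p dvd lead_coeff T" "\<not> p dvd coeff T 0"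
  shows False
proof -
  define d where "d = degree T"
  define J where "J r = (\<Sum>i<d. of_int (r i) * b ^ i)" for r :: "nat \<Rightarrow> int"
  have d0: "d > 0"
  proof (rule ccontr)
    assume "\<not> d > 0"
    then obtain x where x: "T = [:x:]" unfolding d_def by (auto elim: degree_eq_zeroE)
    thus False using T by simp
  qed
  have J_add: "J (\<lambda>i. r i + s i) = J r + J s" for r s by (simp add: J_def sum.distrib algebra_simps)
  have J_scale: "J (\<lambda>i. x * r i) = of_int x * J r" for r x by (simp add: J_def sum_distrib_left mult_ac)
  obtain u e where ue: "u * lead_coeff T = 1 + p * e" using inverse_mod_prime[OF p T(2)] by blast
  have top: "b ^ d = J (\<lambda>i. - u * coeff T i) + of_int p * ieval b (monom (- e) d)"
  proof -
    have "ieval b T = (\<Sum>i\<le>d. of_int (coeff T i) * b ^ i)"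
      unfolding ieval_def poly_altdef d_def by (simp add: coeff_map_poly degree_map_poly)
    also have "\<dots> = (\<Sum>i<d. of_int (coeff T i) * b ^ i) + of_int (lead_coeff T) * b ^ d"
      by (simp add: lessThan_Suc_atMost[symmetric] d_def)
    finally have "of_int u * ((\<Sum>i<d. of_int (coeff T i) * b ^ i) + of_int (lead_coeff T) * b ^ d) = 0" using T by simp
    hence "of_int u * (\<Sum>i<d. of_int (coeff T i) * b ^ i) + of_int (u * lead_coeff T) * b ^ d = 0"
      by (simp add: algebra_simps)
    moreover have "J (\<lambda>i. - u * coeff T i) = - of_int u * (\<Sum>i<d. of_int (coeff T i) * b ^ i)"
      by (simp add: J_def sum_distrib_left mult.assoc sum_negf)
    ultimately show ?thesis unfolding ue by (simp add: algebra_simps)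
  qed
  have red: "\<exists>r w. ieval b f = J r + of_int p * ieval b w" for f
  proof (induction f rule: pCons_induct)
    case 0
    show ?case by (rule exI[of _ "\<lambda>_. 0"], rule exI[of _ 0]) (simp add: J_def)
  next
    case (pCons x f)
    then obtain r w where rw: "ieval b f = J r + of_int p * ieval b w" by blast
    obtain d' where d': "d = Suc d'" using d0 by (cases d) auto
    define sh where "sh i = (case i of 0 \<Rightarrow> x | Suc i' \<Rightarrow> r i')" for i
    have "of_int x + b * J r = J sh + of_int (r d') * b ^ d"
    proof -
      have "J sh = of_int x + (\<Sum>i<d'. of_int (r i) * b ^ Suc i)"
        unfolding J_def d' by (subst sum.lessThan_Suc_shift) (simp add: sh_def)
      moreover have "b * J r = (\<Sum>i<d'. of_int (r i) * b ^ Suc i) + of_int (r d') * b ^ d"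
        unfolding J_def d' by (simp add: algebra_simps sum_distrib_left)
      ultimately show ?thesis by simp
    qed
    also have "\<dots> = J sh + J (\<lambda>i. r d' * (- u * coeff T i)) + of_int p * ieval b (smult (r d') (monom (- e) d))"
      unfolding J_scale ieval_smult top by (simp add: algebra_simps)
    finally have "ieval b (pCons x f) = J (\<lambda>i. sh i + r d' * (- u * coeff T i)) + of_int p * ieval b (smult (r d') (monom (- e) d) + pCons 0 w)"
      unfolding J_add using rw by (simp add: algebra_simps)
    thus ?case by blast
  qed
  have red': "\<exists>r\<in>{..<d} \<rightarrow>\<^sub>E {0..<p}. \<exists>w. ieval b f = J r + of_int p * ieval b w" for f
  proof -
    obtain r w where rw: "ieval b f = J r + of_int p * ieval b w" using red by blast
    define s where "s = restrict (\<lambda>i. r i mod p) {..<d}"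
    have "J r = J s + of_int p * ieval b (\<Sum>i<d. monom (r i div p) i)"
    proof -
      have "ieval b (\<Sum>i\<in>I. monom (r i div p) i) = (\<Sum>i\<in>I. of_int (r i div p) * b ^ i)" if "finite I" for I
        using that by (induction I rule: finite_induct) auto
      hence "J s + of_int p * ieval b (\<Sum>i<d. monom (r i div p) i)
          = (\<Sum>i<d. (of_int (r i mod p) + of_int p * of_int (r i div p)) * b ^ i)"
        by (simp add: J_def s_def sum_distrib_left sum.distrib algebra_simps)
      also have "\<dots> = J r"
        unfolding J_def of_int_mult[symmetric] of_int_add[symmetric] by simp
      finally show ?thesis by simp
    qed
    hence "ieval b f = J s + of_int p * ieval b ((\<Sum>i<d. monom (r i div p) i) + w)" using rw by (simp add: algebra_simps)
    moreover have "s \<in> {..<d} \<rightarrow>\<^sub>E {0..<p}" using prime_gt_0_int[OF p] by (auto simp: s_def)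
    ultimately show ?thesis by blast
  qed
  obtain x0 where x0: "x0 \<in> X" using inf by (metis finite.emptyI ex_in_conv)
  have "\<exists>f. x - x0 = ieval b f" if x: "x \<in> X" for x
  proof (cases "x = x0")
    case True
    thus ?thesis by (intro exI[of _ 0]) simp
  next
    case False
    then obtain k n where "x - x0 = of_int n * b ^ k" using X x x0 by blast
    thus ?thesis by (intro exI[of _ "monom n k"]) simp
  qed
  hence "\<forall>x\<in>X. \<exists>r\<in>{..<d} \<rightarrow>\<^sub>E {0..<p}. \<exists>w. x - x0 = J r + of_int p * ieval b w" using red' by metis
  then obtain r w where r: "\<And>x. x \<in> X \<Longrightarrow> r x \<in> {..<d} \<rightarrow>\<^sub>E {0..<p}"
    and w: "\<And>x. x \<in> X \<Longrightarrow> x - x0 = J (r x) + of_int p * ieval b (w x)" by metis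
  have "finite ({..<d} \<rightarrow>\<^sub>E {0..<p})" by (rule finite_PiE) auto
  hence "finite (r ` X)" by (rule finite_subset[rotated]) (use r in auto)
  hence "\<not> inj_on r X" using inf finite_imageD by blast
  then obtain x y where xy: "x \<in> X" "y \<in> X" "x \<noteq> y" "r x = r y" by (auto simp: inj_on_def)
  have diff: "x - y = of_int p * ieval b (w x - w y)" using w[OF xy(1)] w[OF xy(2)] xy(4) by (simp add: algebra_simps)
  obtain k n where n: "\<not> p dvd n" "x - y = of_int n * b ^ k" using X xy by blast
  obtain v e where ve: "v * n = 1 + p * e" using inverse_mod_prime[OF p n(1)] by blast
  have "of_int (v * n) * b ^ k = of_int p * ieval b (smult v (w x - w y))"
  proof -
    have "of_int (v * n) * b ^ k = of_int v * (x - y)" unfolding n(2) by simp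
    also have "\<dots> = of_int p * ieval b (smult v (w x - w y))" unfolding diff ieval_smult by simp
    finally show ?thesis .
  qed
  hence "b ^ k = of_int p * ieval b (smult v (w x - w y) - monom e k)" unfolding ve by (simp add: algebra_simps)
  thus False using power_not_multiple_of_prime[OF p T] by blast
qed

context self_affine_system begin

section \<open>The first diagonal entry\<close>

lemma Z0_uminus: "z \<in> Z0 \<Longrightarrow> - z \<in> Z0"
  unfolding Z0_def m_def by (simp add: fourier_transform_uminus)

lemma level_fst:
  assumes "z \<in> Z0"
  obtains n :: int where "\<not> int p dvd n" "real p * ((T ^^ k) z) $ 1 = of_int n * b ^ k"
proof -
  obtain n r where nr: "adm n r" "z $ 1 = of_int n / real p" "z $ 2 = of_int r / real p" by (rule Z0E[OF assms])
  have "real p * ((T ^^ k) z) $ 1 = of_int n * b ^ k" unfolding Tn_fst nr(2) using p_pos by simp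
  moreover have "\<not> int p dvd n" using nr(1) by (simp add: adm_def)
  ultimately show ?thesis by (intro that)
qed

lemma tight_fst_difference:
  assumes "tight \<Lambda>" "v \<in> \<Lambda>" "w \<in> \<Lambda>" "v \<noteq> w"
  obtains k n where "k \<ge> 1" "\<not> int p dvd n" "real p * (v - w) $ 1 = of_int n * b ^ k"
proof -
  obtain k z where kz: "k \<ge> 1" "z \<in> Z0" "v - w = (T ^^ k) z" by (rule tight_differenceE[OF assms])
  obtain n :: int where "\<not> int p dvd n" "real p * ((T ^^ k) z) $ 1 = of_int n * b ^ k" by (rule level_fst[OF kz(2)])
  thus ?thesis using that kz by simp
qed

lemma tight_fst_level:
  assumes "tight \<Lambda>" "l \<ge> 1"
  obtains v w n where "v \<in> \<Lambda>" "w \<in> \<Lambda>" "v \<noteq> w" "\<not> int p dvd n" "real p * (v - w) $ 1 = of_int n * b ^ l"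
proof -
  obtain v w z where vw: "v \<in> \<Lambda>" "w \<in> \<Lambda>" "z \<in> Z0" "v - w = (T ^^ l) z" by (rule all_levels_occur[OF assms])
  obtain n :: int where n: "\<not> int p dvd n" "real p * ((T ^^ l) z) $ 1 = of_int n * b ^ l" by (rule level_fst[OF vw(3)])
  have "v \<noteq> w" using vw Tn_Z0_ne by auto
  moreover have "real p * (v - w) $ 1 = of_int n * b ^ l" unfolding vw(4) by (rule n(2))
  ultimately show ?thesis using vw(1,2) n(1) by (intro that)
qed

lemma not_dvd_ne_0: "\<not> int p dvd n \<Longrightarrow> n \<noteq> 0" by auto

text \<open>The differences of high levels are arbitrarily large.\<close>

lemma tight_fst_infinite:
  assumes t: "tight \<Lambda>"
  shows "infinite ((\<lambda>v. real p * v $ 1) ` \<Lambda>)"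
proof
  let ?X = "(\<lambda>v. real p * v $ 1) ` \<Lambda>"
  assume fin: "finite ?X"
  define M where "M = Max (insert 0 ((\<lambda>(x, y). \<bar>x - y\<bar>) ` (?X \<times> ?X)))"
  obtain l0 where l0: "M < b ^ l0" using real_arch_pow[OF b] by blast
  have "b ^ l0 \<le> b ^ Suc l0" using b by (intro power_increasing) auto
  hence l: "M < b ^ Suc l0" using l0 by linarith
  obtain v w n where vw: "v \<in> \<Lambda>" "w \<in> \<Lambda>" "v \<noteq> w" "\<not> int p dvd n" "real p * (v - w) $ 1 = of_int n * b ^ Suc l0"
    by (rule tight_fst_level[OF t, of "Suc l0"]) simp
  have "1 \<le> \<bar>of_int n :: real\<bar>" using not_dvd_ne_0[OF vw(4)] by (simp flip: of_int_abs)
  hence "1 * b ^ Suc l0 \<le> \<bar>of_int n\<bar> * b ^ Suc l0" using b by (intro mult_right_mono) auto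
  also have "\<dots> = \<bar>real p * v $ 1 - real p * w $ 1\<bar>" using vw(5) b by (simp add: abs_mult right_diff_distrib)
  also have "\<dots> \<le> M" unfolding M_def
  proof (rule Max_ge)
    have "(real p * v $ 1, real p * w $ 1) \<in> ?X \<times> ?X" using vw(1,2) by blast
    thus "\<bar>real p * v $ 1 - real p * w $ 1\<bar> \<in> insert 0 ((\<lambda>(x, y). \<bar>x - y\<bar>) ` (?X \<times> ?X))"
      by (intro insertI2 image_eqI[of _ _ "(real p * v $ 1, real p * w $ 1)"]) auto
  qed (use fin in auto)
  finally show False using l by simp
qed

lemma tight_no_unit_polynomial:
  assumes t: "tight \<Lambda>" and P: "ieval b P = 0" "\<not> int p dvd lead_coeff P" "\<not> int p dvd coeff P 0"
  shows False
proof (rule no_unit_polynomial[OF prime_int_p tight_fst_infinite[OF t] _ P])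
  fix x y assume "x \<in> (\<lambda>v. real p * v $ 1) ` \<Lambda>" "y \<in> (\<lambda>v. real p * v $ 1) ` \<Lambda>" "x \<noteq> y"
  then obtain v w where vw: "v \<in> \<Lambda>" "w \<in> \<Lambda>" "x = real p * v $ 1" "y = real p * w $ 1" "v \<noteq> w" by auto
  obtain k n where "k \<ge> 1" "\<not> int p dvd n" "real p * (v - w) $ 1 = of_int n * b ^ k"
    by (rule tight_fst_difference[OF t vw(1,2,5)])
  thus "\<exists>k n. \<not> int p dvd n \<and> x - y = of_int n * b ^ k" using vw by (auto simp: right_diff_distrib)
qed

lemma no_unit_trinomial:
  assumes t: "tight \<Lambda>" and e: "e1 < e2" "e2 < e3" and n: "\<not> int p dvd n1" "\<not> int p dvd n3"
    and eq: "of_int n1 * b ^ e1 + of_int n2 * b ^ e2 + of_int n3 * b ^ e3 = 0"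
  shows False
proof -
  define P where "P = monom n1 0 + monom n2 (e2 - e1) + monom n3 (e3 - e1)"
  have "b ^ e1 * ieval b P = of_int n1 * b ^ e1 + of_int n2 * (b ^ e1 * b ^ (e2 - e1)) + of_int n3 * (b ^ e1 * b ^ (e3 - e1))"
    by (simp add: P_def algebra_simps)
  also have "\<dots> = 0" using eq e by (simp add: power_add[symmetric])
  finally have 1: "ieval b P = 0" using b by simp
  have "degree (monom n1 0 + monom n2 (e2 - e1)) < e3 - e1"
    using e by (intro le_less_trans[OF degree_add_le_max]) (auto simp: degree_monom_le intro: le_less_trans[OF degree_monom_le])
  moreover have "degree (monom n3 (e3 - e1)) = e3 - e1" using n(2) by (intro degree_monom_eq) auto
  ultimately have "degree P = e3 - e1" unfolding P_def by (metis degree_add_eq_right)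
  hence "lead_coeff P = n3" using e by (simp add: P_def)
  moreover have "coeff P 0 = n1" using e by (simp add: P_def)
  ultimately show False using tight_no_unit_polynomial[OF t 1] n by simp
qed

text \<open>If \<open>b\<^sup>k / b\<^sup>j\<close> is irrational, the level of the third side of the triangle differs from \<open>k\<close> and \<open>j\<close>. The
  relation between the sides is then a trinomial in \<open>b\<close> with extreme coefficients prime to \<open>p\<close>.\<close>

lemma triangle_ratio_rational:
  assumes t: "tight \<Lambda>" and vwx: "v \<in> \<Lambda>" "w \<in> \<Lambda>" "x \<in> \<Lambda>"
    and n: "\<not> int p dvd n" "real p * (v - w) $ 1 = of_int n * b ^ k"
    and n': "\<not> int p dvd n'" "real p * (w - x) $ 1 = of_int n' * b ^ j"
  shows "b ^ k / b ^ j \<in> \<rat>"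
proof (rule ccontr)
  assume irr: "b ^ k / b ^ j \<notin> \<rat>"
  have b0: "b \<noteq> 0" using b by simp
  have ratI: False if "of_int c * b ^ k = of_int d * b ^ j" "c \<noteq> 0" for c d :: int
  proof -
    have "b ^ k / b ^ j = of_int d / of_int c" using that b0 by (simp add: field_simps)
    thus False using irr by (metis Rats_divide Rats_of_int)
  qed
  have kj: "k \<noteq> j" using irr b0 by auto
  have ne: "n \<noteq> 0" "n' \<noteq> 0" using n n' by auto
  have sum: "real p * (v - x) $ 1 = of_int n * b ^ k + of_int n' * b ^ j" using n(2) n'(2) by (simp add: algebra_simps)
  have "v \<noteq> x"
  proof
    assume "v = x"
    hence "of_int n * b ^ k = of_int (- n') * b ^ j" using sum by simp
    thus False using ratI ne by blast
  qed
  then obtain i m where i: "\<not> int p dvd m" "real p * (v - x) $ 1 = of_int m * b ^ i"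
    using tight_fst_difference[OF t vwx(1,3)] by metis
  have eq: "of_int n * b ^ k + of_int n' * b ^ j + of_int (- m) * b ^ i = 0" using sum i(2) by simp
  have "i \<noteq> k"
  proof
    assume "i = k"
    hence e: "of_int (n - m) * b ^ k = of_int (- n') * b ^ j" using eq by (simp add: algebra_simps)
    have "n - m \<noteq> 0" using e ne b0 by auto
    thus False using ratI e by blast
  qed
  moreover have "i \<noteq> j"
  proof
    assume "i = j"
    hence e: "of_int n * b ^ k = of_int (m - n') * b ^ j" using eq by (simp add: algebra_simps)
    thus False using ratI ne by blast
  qed
  ultimately consider "k < j" "j < i" | "k < i" "i < j" | "j < k" "k < i" | "j < i" "i < k" | "i < k" "k < j" | "i < j" "j < k"
    using kj by linarith
  moreover have nm: "\<not> int p dvd - m" using i by simp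
  ultimately show False
  proof cases
    case 1
    show ?thesis by (rule no_unit_trinomial[OF t 1 n(1) nm, where ?n2.0 = n']) (use eq in linarith)
  next
    case 2
    show ?thesis by (rule no_unit_trinomial[OF t 2 n(1) n'(1), where ?n2.0 = "- m"]) (use eq in linarith)
  next
    case 3
    show ?thesis by (rule no_unit_trinomial[OF t 3 n'(1) nm, where ?n2.0 = n]) (use eq in linarith)
  next
    case 4
    show ?thesis by (rule no_unit_trinomial[OF t 4 n'(1) n(1), where ?n2.0 = "- m"]) (use eq in linarith)
  next
    case 5
    show ?thesis by (rule no_unit_trinomial[OF t 5 nm n'(1), where ?n2.0 = n]) (use eq in linarith)
  next
    case 6
    show ?thesis by (rule no_unit_trinomial[OF t 6 nm n(1), where ?n2.0 = n']) (use eq in linarith)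
  qed
qed

text \<open>Triangles link a difference of level one with a difference of level two.\<close>

lemma b_rational:
  assumes t: "tight \<Lambda>"
  shows "b \<in> \<rat>"
proof -
  have b0: "b \<noteq> 0" using b by simp
  obtain v w n where vw: "v \<in> \<Lambda>" "w \<in> \<Lambda>" "v \<noteq> w" "\<not> int p dvd n" "real p * (v - w) $ 1 = of_int n * b ^ 1"
    by (rule tight_fst_level[OF t, of 1]) simp
  obtain x y n' where xy: "x \<in> \<Lambda>" "y \<in> \<Lambda>" "x \<noteq> y" "\<not> int p dvd n'" "real p * (x - y) $ 1 = of_int n' * b ^ 2"
    by (rule tight_fst_level[OF t, of 2]) simp
  have "b ^ 1 / b ^ 2 \<in> \<rat>"
  proof (cases "w = x")
    case True
    show ?thesis by (rule triangle_ratio_rational[OF t vw(1,2) xy(2) vw(4,5)]) (use xy True in auto)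
  next
    case False
    then obtain r m where r: "\<not> int p dvd m" "real p * (w - x) $ 1 = of_int m * b ^ r"
      using tight_fst_difference[OF t vw(2) xy(1)] by metis
    have "b ^ 1 / b ^ r \<in> \<rat>" by (rule triangle_ratio_rational[OF t vw(1,2) xy(1) vw(4,5) r])
    moreover have "b ^ r / b ^ 2 \<in> \<rat>" by (rule triangle_ratio_rational[OF t vw(2) xy(1,2) r xy(4,5)])
    ultimately have "(b ^ 1 / b ^ r) * (b ^ r / b ^ 2) \<in> \<rat>" by (rule Rats_mult)
    thus ?thesis using b0 by simp
  qed
  hence "inverse (b ^ 1 / b ^ 2) \<in> \<rat>" by (rule Rats_inverse)
  thus ?thesis using b by (simp add: power2_eq_square)
qed

text \<open>Let \<open>b = s/q\<close> with \<open>p\<close> dividing exactly one of \<open>s\<close> and \<open>q\<close>. Clearing denominators in a relation between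
  three levels makes all terms but one extreme one divisible by \<open>p\<close>. Hence an extreme level of a triangle
  of frequencies, the highest if \<open>p\<close> divides \<open>q\<close> and the lowest if \<open>p\<close> divides \<open>s\<close>, occurs twice.\<close>

lemma power_clear_denominator:
  fixes s q :: int
  assumes "of_int q * b = of_int s" "i \<le> N"
  shows "of_int q ^ N * b ^ i = of_int (s ^ i * q ^ (N - i))"
proof -
  have "of_int q ^ N * b ^ i = (of_int q * b) ^ i * of_int q ^ (N - i)"
    using assms(2) by (simp add: power_mult_distrib power_add[symmetric])
  thus ?thesis unfolding assms(1) by simp
qed

lemma no_lower_combination:
  fixes n n1 n2 s q :: int
  assumes sq: "of_int q * b = of_int s" "int p dvd q" "\<not> int p dvd s"
    and n: "\<not> int p dvd n" "i < L" "j < L"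
  shows "of_int n * b ^ L \<noteq> of_int n1 * b ^ i + of_int n2 * b ^ j"
proof
  assume eq: "of_int n * b ^ L = of_int n1 * b ^ i + of_int n2 * b ^ j"
  obtain N where N: "L = Suc N" using n(2) by (cases L) auto
  define x where "x = n1 * (s ^ i * q ^ (N - i)) + n2 * (s ^ j * q ^ (N - j))"
  have "of_int n * (of_int q ^ L * b ^ L) = of_int q ^ L * (of_int n1 * b ^ i + of_int n2 * b ^ j)"
    unfolding eq[symmetric] by simp
  also have "\<dots> = of_int q * (of_int n1 * (of_int q ^ N * b ^ i) + of_int n2 * (of_int q ^ N * b ^ j))"
    by (simp add: N algebra_simps)
  also have "\<dots> = of_int q * of_int x"
    using power_clear_denominator[OF sq(1), of i N] power_clear_denominator[OF sq(1), of j N] n(2,3)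
    by (simp add: x_def N less_Suc_eq_le)
  finally have "of_int (n * s ^ L) = (of_int (q * x) :: real)"
    using power_clear_denominator[OF sq(1), of L L] by simp
  hence "n * s ^ L = q * x" by (simp only: of_int_eq_iff)
  hence "int p dvd n * s ^ L" using sq(2) by (simp add: dvd_mult2)
  thus False using n(1) sq(3) prime_int_p prime_dvd_power[OF prime_int_p, of s L]
    by (auto simp: prime_dvd_mult_iff)
qed

lemma no_higher_combination:
  fixes n n1 n2 s q :: int
  assumes sq: "of_int q * b = of_int s" "int p dvd s" "\<not> int p dvd q"
    and n: "\<not> int p dvd n" "L < i" "L < j"
  shows "of_int n * b ^ L \<noteq> of_int n1 * b ^ i + of_int n2 * b ^ j"
proof
  assume eq: "of_int n * b ^ L = of_int n1 * b ^ i + of_int n2 * b ^ j"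
  define N where "N = max i j"
  define x where "x = n1 * (s ^ (i - L - 1) * q ^ (N - i)) + n2 * (s ^ (j - L - 1) * q ^ (N - j))"
  have q0: "q \<noteq> 0" using sq(3) by auto
  hence "of_int q * b \<noteq> 0" using b by simp
  hence s0: "s \<noteq> 0" unfolding sq(1) by simp
  have "of_int n * (of_int q ^ N * b ^ L) = of_int q ^ N * (of_int n1 * b ^ i + of_int n2 * b ^ j)"
    unfolding eq[symmetric] by simp
  also have "\<dots> = of_int n1 * (of_int q ^ N * b ^ i) + of_int n2 * (of_int q ^ N * b ^ j)"
    by (simp add: algebra_simps)
  also have "\<dots> = of_int (n1 * (s ^ i * q ^ (N - i)) + n2 * (s ^ j * q ^ (N - j)))"
    using power_clear_denominator[OF sq(1), of i N] power_clear_denominator[OF sq(1), of j N]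
    by (simp add: N_def)
  finally have "of_int (n * (s ^ L * q ^ (N - L))) = (of_int (n1 * (s ^ i * q ^ (N - i)) + n2 * (s ^ j * q ^ (N - j))) :: real)"
    using power_clear_denominator[OF sq(1), of L N] n(2) by (simp add: N_def)
  hence e: "n * (s ^ L * q ^ (N - L)) = n1 * (s ^ i * q ^ (N - i)) + n2 * (s ^ j * q ^ (N - j))"
    by (simp only: of_int_eq_iff)
  have "s ^ i = s ^ L * (s * s ^ (i - L - 1))" "s ^ j = s ^ L * (s * s ^ (j - L - 1))"
    using n(2,3) by (simp_all add: power_add[symmetric] power_Suc[symmetric] del: power_Suc)
  hence "s ^ L * (n * q ^ (N - L)) = s ^ L * (s * x)"
    using e unfolding x_def by (simp add: algebra_simps)
  hence "n * q ^ (N - L) = s * x" using s0 by simp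
  hence "int p dvd n * q ^ (N - L)" using sq(2) by (simp add: dvd_mult2)
  thus False using n(1) sq(3) prime_int_p prime_dvd_power[OF prime_int_p, of q "N - L"]
    by (auto simp: prime_dvd_mult_iff)
qed

text \<open>If \<open>p\<close> divided the denominator, then together with a frequency at a high level \<open>L'\<close> from one of them, two
  frequencies at level one from each other would form a triangle whose other two sides both have level
  \<open>L'\<close>. So \<open>n' b = m b\<^sup>L\<^sup>'\<close> for the numerator \<open>n'\<close> of the short side and an integer \<open>m\<close>, which is
  impossible for large \<open>L'\<close> since \<open>n'\<close> is fixed and not zero.\<close>

lemma denominator_not_dvd:
  fixes s q :: int
  assumes t: "tight \<Lambda>" and sq: "of_int q * b = of_int s" "\<not> int p dvd s"
  shows "\<not> int p dvd q"
proof
  assume pq: "int p dvd q"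
  note H = no_lower_combination[OF sq(1) pq sq(2)]
  have abs_ge_1: "1 \<le> \<bar>of_int n :: real\<bar>" if "n \<noteq> 0" for n using that by (simp flip: of_int_abs)
  obtain v w n' where vw: "v \<in> \<Lambda>" "w \<in> \<Lambda>" "v \<noteq> w" "\<not> int p dvd n'" "real p * (v - w) $ 1 = of_int n' * b ^ 1"
    by (rule tight_fst_level[OF t, of 1]) simp
  obtain L0 where L0: "\<bar>of_int n'\<bar> < b ^ L0" using real_arch_pow[OF b] by blast
  define L where "L = L0 + 2"
  have small: False if h: "of_int n' * b ^ 1 = of_int m * b ^ L'" "L \<le> L'" for m L'
  proof -
    obtain L1 where L1: "L' = Suc L1" "L0 \<le> L1" using h(2) by (cases L') (auto simp: L_def)
    have e: "of_int n' = of_int m * b ^ L1" using h(1) b by (simp add: L1)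
    have "m \<noteq> 0" using e vw(4) by auto
    have "b ^ L0 \<le> 1 * b ^ L1" using L1 b by (simp add: power_increasing)
    also have "\<dots> \<le> \<bar>of_int m\<bar> * b ^ L1" using abs_ge_1[OF \<open>m \<noteq> 0\<close>] b by (intro mult_right_mono) auto
    also have "\<dots> = \<bar>of_int n'\<bar>" unfolding e using b by (simp add: abs_mult)
    finally show False using L0 by simp
  qed
  obtain x y n where xy: "x \<in> \<Lambda>" "y \<in> \<Lambda>" "x \<noteq> y" "\<not> int p dvd n" "real p * (x - y) $ 1 = of_int n * b ^ L"
    by (rule tight_fst_level[OF t, of L]) (simp add: L_def)
  have "\<exists>z\<in>\<Lambda>. \<exists>L' m. L \<le> L' \<and> \<not> int p dvd m \<and> real p * (z - w) $ 1 = of_int m * b ^ L'"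
  proof (cases "x = w \<or> y = w")
    case True
    thus ?thesis
    proof
      assume "y = w"
      thus ?thesis using xy by blast
    next
      assume "x = w"
      hence "real p * (y - w) $ 1 = of_int (- n) * b ^ L" using xy(5) by (simp add: algebra_simps)
      thus ?thesis using xy(2,4) by (metis dvd_minus_iff order_refl)
    qed
  next
    case False
    obtain i n1 where i: "\<not> int p dvd n1" "real p * (x - w) $ 1 = of_int n1 * b ^ i"
      using tight_fst_difference[OF t xy(1) vw(2)] False by metis
    obtain j n2 where j: "\<not> int p dvd n2" "real p * (y - w) $ 1 = of_int n2 * b ^ j"
      using tight_fst_difference[OF t xy(2) vw(2)] False by metis
    have "of_int n * b ^ L = of_int n1 * b ^ i + of_int (- n2) * b ^ j"
      using i(2) j(2) xy(5) by (simp add: algebra_simps)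
    hence "\<not> (i < L \<and> j < L)" using H[OF xy(4)] by blast
    thus ?thesis using i j xy(1,2) by (meson not_less)
  qed
  then obtain z L' m where z: "z \<in> \<Lambda>" "L \<le> L'" "\<not> int p dvd m" "real p * (z - w) $ 1 = of_int m * b ^ L'" by blast
  show False
  proof (cases "z = v")
    case True
    thus False using small[of m L'] z vw(5) by simp
  next
    case False
    then obtain i l where i: "\<not> int p dvd l" "real p * (z - v) $ 1 = of_int l * b ^ i"
      using tight_fst_difference[OF t z(1) vw(1)] by metis
    have eq: "of_int m * b ^ L' = of_int l * b ^ i + of_int n' * b ^ 1" using i(2) z(4) vw(5) by (simp add: algebra_simps)
    have "1 < L'" using z(2) by (simp add: L_def)
    have "\<not> i < L'" using H[OF z(3) _ \<open>1 < L'\<close>] eq by blast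
    moreover have "\<not> L' < i"
    proof
      assume "L' < i"
      moreover have "of_int l * b ^ i = of_int m * b ^ L' + of_int (- n') * b ^ 1" using eq by simp
      ultimately show False using H[OF i(1)] \<open>1 < L'\<close> by (meson less_trans)
    qed
    ultimately have "i = L'" by simp
    hence "of_int n' * b ^ 1 = of_int (m - l) * b ^ L'" using eq by (simp add: algebra_simps)
    thus False using small z(2) by blast
  qed
qed

text \<open>If \<open>p\<close> divides the numerator, the lowest level in a triangle occurs twice. Since level one occurs
  somewhere, every frequency \<open>w\<close> has a neighbour \<open>x'\<close> at level one. If \<open>v\<close> is at a higher level from \<open>w\<close>, it
  must be at level one from \<open>x'\<close>.\<close>

lemma level_one_split:
  fixes s q :: int
  assumes sq: "of_int q * b = of_int s" "int p dvd s" "\<not> int p dvd q" and t: "tight \<Lambda>"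
    and vw: "v \<in> \<Lambda>" "w \<in> \<Lambda>" "2 \<le> k" "z \<in> Z0" "v - w = (T ^^ k) z"
  obtains y y' where "y \<in> Z0" "y' \<in> Z0" "(T ^^ k) z = T (y + y')"
proof -
  note H = no_higher_combination[OF sq]
  have k1: "1 < k" using vw by simp
  obtain n :: int where n: "\<not> int p dvd n" "real p * ((T ^^ k) z) $ 1 = of_int n * b ^ k" by (rule level_fst[OF vw(4)])
  obtain x y z1 where xy: "x \<in> \<Lambda>" "y \<in> \<Lambda>" "z1 \<in> Z0" "x - y = (T ^^ 1) z1" by (rule all_levels_occur[OF t, of 1]) simp
  have "\<exists>x'\<in>\<Lambda>. \<exists>z2\<in>Z0. x' - w = (T ^^ 1) z2"
  proof (cases "x = w \<or> y = w")
    case True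
    thus ?thesis
    proof
      assume "y = w"
      thus ?thesis using xy by blast
    next
      assume "x = w"
      hence "y - w = (T ^^ 1) (- z1)" using xy(4) by (simp add: T_uminus) (metis minus_diff_eq)
      thus ?thesis using xy(2) Z0_uminus[OF xy(3)] by blast
    qed
  next
    case False
    obtain i zx where i: "i \<ge> 1" "zx \<in> Z0" "x - w = (T ^^ i) zx"
      using tight_differenceE[OF t xy(1) vw(2)] False by metis
    obtain j zy where j: "j \<ge> 1" "zy \<in> Z0" "y - w = (T ^^ j) zy"
      using tight_differenceE[OF t xy(2) vw(2)] False by metis
    obtain n0 :: int where n0: "\<not> int p dvd n0" "real p * ((T ^^ 1) z1) $ 1 = of_int n0 * b ^ 1" by (rule level_fst[OF xy(3)])
    obtain n1 :: int where n1: "\<not> int p dvd n1" "real p * ((T ^^ i) zx) $ 1 = of_int n1 * b ^ i" by (rule level_fst[OF i(2)])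
    obtain n2 :: int where n2: "\<not> int p dvd n2" "real p * ((T ^^ j) zy) $ 1 = of_int n2 * b ^ j" by (rule level_fst[OF j(2)])
    have "(T ^^ 1) z1 = (T ^^ i) zx - (T ^^ j) zy" unfolding xy(4)[symmetric] i(3)[symmetric] j(3)[symmetric] by simp
    hence "real p * ((T ^^ 1) z1) $ 1 = real p * ((T ^^ i) zx) $ 1 - real p * ((T ^^ j) zy) $ 1"
      by (simp only: vector_minus_component right_diff_distrib)
    hence "of_int n0 * b ^ 1 = of_int n1 * b ^ i + of_int (- n2) * b ^ j" unfolding n0 n1 n2 by simp
    hence "\<not> (1 < i \<and> 1 < j)" using H[OF n0(1)] by blast
    hence "i = 1 \<or> j = 1" using i(1) j(1) by linarith
    thus ?thesis using i j xy(1,2) by blast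
  qed
  then obtain x' z2 where x': "x' \<in> \<Lambda>" "z2 \<in> Z0" "x' - w = (T ^^ 1) z2" by blast
  obtain n2 :: int where n2: "\<not> int p dvd n2" "real p * ((T ^^ 1) z2) $ 1 = of_int n2 * b ^ 1" by (rule level_fst[OF x'(2)])
  have "v \<noteq> x'"
  proof
    assume "v = x'"
    hence "(T ^^ 1) z2 = (T ^^ k) z" using x'(3) vw(5) by simp
    hence "of_int n2 * b ^ 1 = of_int n * b ^ k + of_int 0 * b ^ k" using n n2 by simp
    thus False using H[OF n2(1) k1 k1] by blast
  qed
  then obtain i z3 where i: "i \<ge> 1" "z3 \<in> Z0" "v - x' = (T ^^ i) z3"
    using tight_differenceE[OF t vw(1) x'(1)] by metis
  obtain n3 :: int where n3: "\<not> int p dvd n3" "real p * ((T ^^ i) z3) $ 1 = of_int n3 * b ^ i" by (rule level_fst[OF i(2)])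
  have sum: "(T ^^ k) z = (T ^^ i) z3 + (T ^^ 1) z2" unfolding vw(5)[symmetric] i(3)[symmetric] x'(3)[symmetric] by simp
  hence "real p * ((T ^^ k) z) $ 1 = real p * ((T ^^ i) z3) $ 1 + real p * ((T ^^ 1) z2) $ 1"
    by (simp only: vector_add_component distrib_left)
  hence "of_int n2 * b ^ 1 = of_int n * b ^ k + of_int (- n3) * b ^ i" unfolding n n2 n3 by simp
  hence "\<not> 1 < i" using H[OF n2(1) k1] by blast
  hence "i = 1" using i(1) by simp
  hence "(T ^^ k) z = T (z3 + z2)" using sum by (simp add: T_add)
  thus ?thesis using i(2) x'(2) by (intro that)
qed

text \<open>With \<open>b = s/q\<close> in lowest terms, splitting a difference of level \<open>k\<close> into two of level one shows that
  \<open>q\<^sup>k\<^sup>-\<^sup>1\<close> divides its numerator. If \<open>q > 1\<close> the frequencies then lie too far apart.\<close>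

proposition b_multiple_of_p:
  assumes t: "tight \<Lambda>"
  obtains b' :: int where "b = of_int (int p * b')"
proof -
  obtain s q :: nat where q0: "q \<noteq> 0" and bs: "\<bar>b\<bar> = real s / real q" and cop: "coprime s q"
    by (rule Rats_abs_nat_div_natE[OF b_rational[OF t]])
  have bsq: "b = real s / real q" using bs b by simp
  have qb: "of_int (int q) * b = of_int (int s)" using bsq q0 by simp
  have "p dvd s \<or> p dvd q"
  proof (rule ccontr)
    assume nd: "\<not> (p dvd s \<or> p dvd q)"
    have q1: "lead_coeff [:- int s, int q:] = int q" using q0 by simp
    have "ieval b [:- int s, int q:] = 0" using qb by (simp add: mult.commute)
    thus False using tight_no_unit_polynomial[OF t, of "[:- int s, int q:]"] nd q1 by simp
  qed
  moreover have "\<not> p dvd q" if "\<not> p dvd s" using denominator_not_dvd[OF t qb] that by simp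
  ultimately have ps: "int p dvd int s" by auto
  hence pq: "\<not> int p dvd int q" using cop p_gt_1 by (metis coprime_common_divisor_nat int_dvd_int_iff nat_neq_iff)
  have gap: "\<exists>k z. 1 \<le> k \<and> z \<in> Z0 \<and> v - w = (T ^^ k) z \<and> 1 / (real p * real q) * real s ^ k \<le> \<bar>(v - w) $ 1\<bar>"
    if vw: "v \<in> \<Lambda>" "w \<in> \<Lambda>" "v \<noteq> w" for v w
  proof -
    obtain k z where kz: "k \<ge> 1" "z \<in> Z0" "v - w = (T ^^ k) z" by (rule tight_differenceE[OF t vw])
    obtain n :: int where n: "\<not> int p dvd n" "real p * (v - w) $ 1 = of_int n * b ^ k"
      unfolding kz(3) by (rule level_fst[OF kz(2)])
    have "int q ^ (k - 1) dvd n"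
    proof (cases "k = 1")
      case False
      hence k2: "2 \<le> k" using kz by simp
      obtain y y' where y: "y \<in> Z0" "y' \<in> Z0" "(T ^^ k) z = T (y + y')"
        by (rule level_one_split[OF qb ps pq t vw(1,2) k2 kz(2,3)])
      obtain m where "real p * ((T ^^ 0) y) $ 1 = of_int m * b ^ 0" by (rule level_fst[OF y(1)])
      moreover obtain m' where "real p * ((T ^^ 0) y') $ 1 = of_int m' * b ^ 0" by (rule level_fst[OF y(2)])
      ultimately have "real p * T (y + y') $ 1 = b * of_int (m + m')" by (simp add: algebra_simps)
      moreover have "of_int n * b ^ k = real p * T (y + y') $ 1" using n(2) by (simp only: kz(3) y(3))
      ultimately have "of_int n * b ^ k = b * of_int (m + m')" by (simp only:)
      moreover have "b ^ k = b * b ^ (k - 1)" using k2 by (simp add: power_Suc[symmetric] del: power_Suc)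
      ultimately have "of_int n * b ^ (k - 1) = of_int (m + m')" using b by simp
      hence "of_int n * (of_int (int q) ^ (k - 1) * b ^ (k - 1)) = of_int (int q) ^ (k - 1) * of_int (m + m')" by simp
      hence "of_int (n * int s ^ (k - 1)) = (of_int (int q ^ (k - 1) * (m + m')) :: real)"
        by (simp only: power_clear_denominator[OF qb order.refl]) simp
      hence "n * int s ^ (k - 1) = int q ^ (k - 1) * (m + m')" by (simp only: of_int_eq_iff)
      hence "int q ^ (k - 1) dvd n * int s ^ (k - 1)" by simp
      moreover have "coprime (int q ^ (k - 1)) (int s ^ (k - 1))" using cop by (simp add: coprime_commute)
      ultimately show ?thesis by (simp add: coprime_dvd_mult_left_iff)
    qed simp
    hence "int q ^ (k - 1) \<le> \<bar>n\<bar>" using not_dvd_ne_0[OF n(1)] by (simp add: zdvd_imp_le)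
    hence nq: "real q ^ (k - 1) \<le> \<bar>of_int n\<bar>" by (metis of_int_abs of_int_le_iff of_int_of_nat_eq of_int_power)
    have "real s ^ k = real q ^ k * b ^ k" using qb by (simp add: power_mult_distrib[symmetric])
    also have "\<dots> = real q * (real q ^ (k - 1) * b ^ k)" using kz(1) by (simp add: power_Suc[symmetric] mult.assoc[symmetric] del: power_Suc)
    also have "\<dots> \<le> real q * (\<bar>of_int n\<bar> * b ^ k)" using nq b by (intro mult_left_mono mult_right_mono) auto
    also have "\<bar>of_int n\<bar> * b ^ k = real p * \<bar>(v - w) $ 1\<bar>"
      using arg_cong[OF n(2), of abs] b p_pos by (simp add: abs_mult del: vector_minus_component)
    finally have "1 / (real p * real q) * real s ^ k \<le> \<bar>(v - w) $ 1\<bar>"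
      using p_pos q0 by (simp add: field_simps)
    thus ?thesis using kz by blast
  qed
  have "q = 1"
  proof (rule ccontr)
    assume "q \<noteq> 1"
    show False
    proof (rule no_fast_gaps[OF t, of "\<lambda>z. z $ 1" 1 0 b s q "1 / (real p * real q)"])
      show "b = real s / real q" by (rule bsq)
      show "2 \<le> q" using q0 \<open>q \<noteq> 1\<close> by simp
    qed (use b cop p_pos q0 gap in \<open>auto simp: integer_lattice_iff\<close>)
  qed
  moreover obtain x where "s = p * x" using ps by auto
  ultimately show ?thesis using that[of "int x"] bsq by simp
qed

section \<open>Subtrees of a frequency set and the second coordinate\<close>

lemma Z0_not_lattice: "z \<in> Z0 \<Longrightarrow> z \<notin> integer_lattice"
  using m_periodic[of z 0] by (auto simp: Z0_def)

lemma adm_sum_lattice: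
  assumes z: "z \<in> Z0" "y \<in> Z0" and p: "real p * (z + y) $ 1 = of_int (int p * N)"
  shows "z + y \<in> integer_lattice"
proof -
  obtain n r where nr: "adm n r" "z $ 1 = of_int n / real p" "z $ 2 = of_int r / real p" by (rule Z0E[OF z(1)])
  obtain n' r' where nr': "adm n' r'" "y $ 1 = of_int n' / real p" "y $ 2 = of_int r' / real p" by (rule Z0E[OF z(2)])
  have "real p * (z + y) $ 1 = of_int (n + n')" using nr(2) nr'(2) p_pos by (simp add: field_simps)
  hence n: "n + n' = int p * N" using p by (simp only: of_int_eq_iff)
  have "a1 * (r + r') = (a1 * r - a2 * n) + (a1 * r' - a2 * n') + a2 * (n + n')" by (simp add: algebra_simps)
  hence "int p dvd a1 * (r + r')" using nr(1) nr'(1) n by (simp add: adm_def)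
  hence "int p dvd r + r'" using prime_int_p not_dvd_a(1) by (simp add: prime_dvd_mult_iff)
  then obtain R where R: "r + r' = int p * R" by blast
  have "(z + y) $ 1 = of_int (n + n') / real p" "(z + y) $ 2 = of_int (r + r') / real p"
    using nr nr' by (simp_all add: add_divide_distrib)
  hence "(z + y) $ 1 = of_int N" "(z + y) $ 2 = of_int R" unfolding n R using p_pos by simp_all
  thus ?thesis by (simp only: integer_lattice_iff Ints_of_int simp_thms)
qed

text \<open>Over an integral \<open>b\<close> a difference of level \<open>k \<ge> 2\<close> is \<open>T (y + y')\<close> with zeros \<open>y\<close>, \<open>y'\<close> of the mask.
  The first coordinate of \<open>y + y'\<close> is an integer; as the numerators of \<open>y\<close> and \<open>y'\<close> are multiples of \<open>a\<close>
  modulo \<open>p\<close>, the second one must be an integer, too.\<close>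

lemma level_integral_step:
  assumes b': "b = of_int (int p * b')" and t: "tight \<Lambda>"
    and vw: "v \<in> \<Lambda>" "w \<in> \<Lambda>" "2 \<le> k" "z \<in> Z0" "v - w = (T ^^ k) z"
  shows "(T ^^ (k - 1)) z \<in> integer_lattice"
proof -
  have k1: "1 < k" using vw by simp
  have sq: "of_int 1 * b = of_int (int p * b')" "int p dvd int p * b'" "\<not> int p dvd 1"
    using b' p_gt_1 by simp_all
  obtain y y' where y: "y \<in> Z0" "y' \<in> Z0" "(T ^^ k) z = T (y + y')"
    by (rule level_one_split[OF sq t vw])
  have Sk: "(T ^^ (k - 1)) z = y + y'" using Sn_Tn_le[of 1 k z] k1 y(3) by simp
  obtain n :: int where n: "real p * ((T ^^ (k - 1)) z) $ 1 = of_int n * b ^ (k - 1)" by (rule level_fst[OF vw(4)])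
  have "real p * (y + y') $ 1 = of_int n * b ^ (k - 1)" using n by (simp only: Sk)
  also have "\<dots> = of_int (int p * (b' * (n * (int p * b') ^ (k - 2))))"
  proof -
    have "b ^ (k - 1) = b * b ^ (k - 2)" using k1 by (simp add: power_Suc[symmetric] Suc_diff_Suc numeral_2_eq_2 del: power_Suc)
    thus ?thesis unfolding b' by simp
  qed
  finally show ?thesis unfolding Sk by (rule adm_sum_lattice[OF y(1,2)])
qed

text \<open>The first factor of the infinite product is constant on the classes of frequencies that agree up to
  level one. Parseval's identity thus splits into a convex combination of the class sums, which are
  at most one, and forces each class sum with a positive weight to be one. At a generic point this applies
  to the class of \<open>w\<close>, which becomes the subtree after translation by \<open>w\<close> and rescaling by \<open>S\<close>.\<close>

proposition tight_subtree:
  assumes b': "b = of_int (int p * b')" and t: "tight \<Lambda>" and w: "w \<in> \<Lambda>"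
  shows "tight ((\<lambda>v. S (v - w)) ` \<Lambda> \<inter> integer_lattice)" (is "tight ?L")
proof -
  define y where "y v = S (v - w)" for v
  have y_diff: "y v - y x = S (v - x)" for v x by (simp add: y_def S_diff)
  have inj: "inj y" unfolding y_def inj_def by (metis T_S diff_add_cancel)
  have "\<exists>j l. j < p \<and> l \<in> integer_lattice \<and> y v = (real j / real p) *\<^sub>R a + l" if v: "v \<in> \<Lambda>" for v
  proof (cases "v = w")
    case True
    thus ?thesis using p_gt_1 by (intro exI[of _ 0]) (simp add: y_def)
  next
    case False
    obtain k z where kz: "k \<ge> 1" "z \<in> Z0" "v - w = (T ^^ k) z" by (rule tight_differenceE[OF t v w False])
    show ?thesis
    proof (cases "k = 1")
      case True
      hence "y v \<in> Z0" using kz by (simp add: y_def)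
      then obtain j l where "j \<in> {1..p-1}" "l \<in> integer_lattice" "y v = (real j / real p) *\<^sub>R a + l"
        unfolding Z0_eq by blast
      moreover have "j < p" using \<open>j \<in> {1..p-1}\<close> p_gt_1 by auto
      ultimately show ?thesis by blast
    next
      case False
      hence "(T ^^ (k - 1)) z \<in> integer_lattice" using kz by (intro level_integral_step[OF b' t v w]) auto
      moreover have "y v = (T ^^ (k - 1)) z" using Sn_Tn_le[of 1 k z] kz by (simp add: y_def)
      ultimately show ?thesis using p_gt_1 by (intro exI[of _ 0] exI[of _ "y v"]) simp
    qed
  qed
  then obtain cl l where cl: "\<And>v. v \<in> \<Lambda> \<Longrightarrow> cl v < p" "\<And>v. v \<in> \<Lambda> \<Longrightarrow> l v \<in> integer_lattice"
    "\<And>v. v \<in> \<Lambda> \<Longrightarrow> y v = (real (cl v) / real p) *\<^sub>R a + l v" by metis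
  have orth: "\<phi> (y v - y x) = 0" if vx: "v \<in> \<Lambda>" "x \<in> \<Lambda>" "v \<noteq> x" "y v - y x \<in> integer_lattice" for v x
  proof -
    obtain k z where kz: "k \<ge> 1" "z \<in> Z0" "v - x = (T ^^ k) z" by (rule tight_differenceE[OF t vx(1-3)])
    have "k \<noteq> 1"
    proof
      assume "k = 1"
      hence "y v - y x = z" using kz by (simp add: y_diff)
      thus False using vx(4) Z0_not_lattice[OF kz(2)] by simp
    qed
    moreover have "y v - y x = (T ^^ (k - 1)) z" using Sn_Tn_le[of 1 k z] kz by (simp add: y_diff)
    ultimately show ?thesis using phi_Tn_Z0[of "k - 1" z] kz by simp
  qed
  have cl_diff: "y v - y x \<in> integer_lattice" if "v \<in> \<Lambda>" "x \<in> \<Lambda>" "cl v = cl x" for v x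
    using cl(2)[OF that(1)] cl(2)[OF that(2)] unfolding cl(3)[OF that(1)] cl(3)[OF that(2)] that(3)
    by (simp add: integer_lattice_diff)
  have cl0: "y v \<in> integer_lattice" if "v \<in> \<Lambda>" "cl v = 0" for v
    using cl(2)[OF that(1)] unfolding cl(3)[OF that(1)] that(2) by simp
  have L: "?L = y ` \<Lambda> \<inter> integer_lattice" by (simp add: y_def)
  have orthL: "\<phi> (u - u') = 0" if u: "u \<in> ?L" "u' \<in> ?L" "u \<noteq> u'" for u u'
  proof -
    obtain v v' where v: "v \<in> \<Lambda>" "v' \<in> \<Lambda>" "u = y v" "u' = y v'" using u(1,2) unfolding L by blast
    have "y v - y v' \<in> integer_lattice" using u(1,2) v(3,4) by (auto intro: integer_lattice_diff)
    moreover have "v \<noteq> v'" using u(3) v by auto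
    ultimately show ?thesis using orth v by simp
  qed
  obtain C where C: "countable C" "\<And>\<xi>. \<xi> $ 1 \<notin> C \<Longrightarrow> ((\<lambda>v. (cmod (\<phi> (\<xi> + v)))\<^sup>2) has_sum 1) \<Lambda>"
    using t unfolding tight_def by blast
  define C' where "C' = (\<lambda>c. (c + w $ 1) / b) ` C \<union> \<rat>"
  have "countable C'" unfolding C'_def using C(1) by (intro countable_Un countable_image) (auto simp: countable_rat)
  moreover have "((\<lambda>v. (cmod (\<phi> (\<xi> + v)))\<^sup>2) has_sum 1) ?L" if xi: "\<xi> $ 1 \<notin> C'" for \<xi>
  proof (rule has_sum_1I)
    show "(\<Sum>v\<in>F. (cmod (\<phi> (\<xi> + v)))\<^sup>2) \<le> 1" if F: "finite F" "F \<subseteq> ?L" for F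
      by (rule Bessel_char_fun[OF char_fun_phi F(1)], rule orthL) (use F in auto)
  next
    fix \<epsilon> :: real assume e: "\<epsilon> > 0"
    define M where "M j = (cmod (m (\<xi> + (real j / real p) *\<^sub>R a)))\<^sup>2" for j :: nat
    have "m \<xi> \<noteq> 0"
    proof
      assume "m \<xi> = 0"
      hence "\<xi> \<in> Z0" by (simp add: Z0_def)
      then obtain n r where "\<xi> $ 1 = of_int n / real p" by (metis Z0E)
      hence "\<xi> $ 1 \<in> \<rat>" by (simp add: Rats_divide)
      thus False using xi by (simp add: C'_def)
    qed
    hence M0: "M 0 > 0" by (simp add: M_def)
    have Mn: "M j \<ge> 0" for j by (simp add: M_def)
    have Msum: "(\<Sum>j<p. M j) = 1" unfolding M_def by (rule sum_m_translates)
    define \<xi>' where "\<xi>' = T \<xi> - w"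
    have "\<xi>' $ 1 \<notin> C"
    proof
      assume "\<xi>' $ 1 \<in> C"
      hence "(\<xi>' $ 1 + w $ 1) / b \<in> C'" unfolding C'_def by (intro UnI1 imageI)
      moreover have "(\<xi>' $ 1 + w $ 1) / b = \<xi> $ 1" using b by (simp add: \<xi>'_def)
      ultimately show False using xi by simp
    qed
    hence hs: "((\<lambda>v. (cmod (\<phi> (\<xi>' + v)))\<^sup>2) has_sum 1) \<Lambda>" by (rule C(2))
    have "\<epsilon> * M 0 > 0" using e M0 by simp
    from has_sum_finite_approx[OF hs this] obtain F where F: "finite F" "F \<subseteq> \<Lambda>"
      "\<bar>(\<Sum>v\<in>F. (cmod (\<phi> (\<xi>' + v)))\<^sup>2) - 1\<bar> < \<epsilon> * M 0" by blast
    have term_eq: "(cmod (\<phi> (\<xi>' + v)))\<^sup>2 = M (cl v) * (cmod (\<phi> (\<xi> + y v)))\<^sup>2" if v: "v \<in> \<Lambda>" for v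
    proof -
      have "\<xi>' + v = T \<xi> + (v - w)" by (simp add: \<xi>'_def)
      hence S: "S (\<xi>' + v) = \<xi> + y v" by (simp only: S_add S_T y_def)
      have "m (\<xi> + y v) = m (\<xi> + (real (cl v) / real p) *\<^sub>R a)"
        using m_periodic[OF cl(2)[OF v], of "\<xi> + (real (cl v) / real p) *\<^sub>R a"] cl(3)[OF v] by (simp add: add.assoc)
      thus ?thesis unfolding phi_refine[of "\<xi>' + v"] S by (simp add: M_def norm_mult power_mult_distrib)
    qed
    define B where "B j = (\<Sum>v\<in>{v\<in>F. cl v = j}. (cmod (\<phi> (\<xi> + y v)))\<^sup>2)" for j
    have B1: "B j \<le> 1" for j
    proof -
      have "B j = (\<Sum>u\<in>y ` {v\<in>F. cl v = j}. (cmod (\<phi> (\<xi> + u)))\<^sup>2)"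
        unfolding B_def by (subst sum.reindex) (auto intro: inj_on_subset[OF inj])
      also have "\<dots> \<le> 1"
      proof (rule Bessel_char_fun[OF char_fun_phi])
        fix u u' assume "u \<in> y ` {v\<in>F. cl v = j}" "u' \<in> y ` {v\<in>F. cl v = j}" and ne: "u \<noteq> u'"
        then obtain v0 v1 where v01: "v0 \<in> {v\<in>F. cl v = j}" "u = y v0" "v1 \<in> {v\<in>F. cl v = j}" "u' = y v1" by blast
        define v v' where "v = v0" and "v' = v1"
        have v: "v \<in> \<Lambda>" "v' \<in> \<Lambda>" "cl v = cl v'" "u = y v" "u' = y v'" using v01 F(2) by (auto simp: v_def v'_def)
        thus "\<phi> (u - u') = 0" using orth[OF v(1,2)] cl_diff[OF v(1-3)] ne by auto
      qed (use F in auto)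
      finally show ?thesis .
    qed
    have "(\<Sum>v\<in>F. (cmod (\<phi> (\<xi>' + v)))\<^sup>2) = (\<Sum>v\<in>F. M (cl v) * (cmod (\<phi> (\<xi> + y v)))\<^sup>2)"
      by (rule sum.cong[OF refl]) (use term_eq F(2) in auto)
    also have "\<dots> = (\<Sum>j<p. \<Sum>v\<in>{v\<in>F. cl v = j}. M (cl v) * (cmod (\<phi> (\<xi> + y v)))\<^sup>2)"
      by (rule sum.group[symmetric]) (use F cl(1) in auto)
    also have "\<dots> = (\<Sum>j<p. M j * B j)" unfolding B_def sum_distrib_left by (intro sum.cong refl) auto
    also have "\<dots> = M 0 * B 0 + (\<Sum>j\<in>{..<p} - {0}. M j * B j)" using p_gt_1 by (intro sum.remove) auto
    also have "\<dots> \<le> M 0 * B 0 + (\<Sum>j\<in>{..<p} - {0}. M j * 1)"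
      by (intro add_mono sum_mono mult_left_mono B1 Mn) auto
    also have "\<dots> = M 0 * B 0 + (1 - M 0)" using p_gt_1 Msum sum.remove[of "{..<p}" 0 M] by simp
    finally have "1 - \<epsilon> * M 0 < M 0 * B 0 + (1 - M 0)" using F(3) by linarith
    hence "M 0 * (1 - \<epsilon>) < M 0 * B 0" by (simp add: algebra_simps)
    hence "1 - \<epsilon> < B 0" using M0 by simp
    also have "B 0 = (\<Sum>u\<in>y ` {v\<in>F. cl v = 0}. (cmod (\<phi> (\<xi> + u)))\<^sup>2)"
      unfolding B_def by (subst sum.reindex) (auto intro: inj_on_subset[OF inj])
    finally have "1 - \<epsilon> < (\<Sum>u\<in>y ` {v\<in>F. cl v = 0}. (cmod (\<phi> (\<xi> + u)))\<^sup>2)" .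
    moreover have "y ` {v\<in>F. cl v = 0} \<subseteq> ?L" unfolding L using F(2) cl0 by auto
    ultimately show "\<exists>F. finite F \<and> F \<subseteq> ?L \<and> 1 - \<epsilon> < (\<Sum>u\<in>F. (cmod (\<phi> (\<xi> + u)))\<^sup>2)"
      using F(1) by (intro exI[of _ "y ` {v\<in>F. cl v = 0}"]) auto
  qed auto
  moreover have "countable ?L" using t by (auto simp: tight_def intro: countable_Int1)
  ultimately show ?thesis unfolding tight_def using orthL by blast
qed

text \<open>A difference of level \<open>k\<close> in \<open>\<Lambda>\<close> is one of level \<open>k - 1\<close> in a subtree.\<close>

lemma level_integral:
  assumes b': "b = of_int (int p * b')"
  shows "tight \<Lambda> \<Longrightarrow> v \<in> \<Lambda> \<Longrightarrow> w \<in> \<Lambda> \<Longrightarrow> z \<in> Z0 \<Longrightarrow> v - w = (T ^^ k) z \<Longrightarrow> 1 \<le> j \<Longrightarrow> j < k \<Longrightarrow>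
    (T ^^ j) z \<in> integer_lattice"
proof (induction k arbitrary: \<Lambda> v w)
  case (Suc k)
  have step: "(T ^^ k) z \<in> integer_lattice"
    using level_integral_step[OF b' Suc.prems(1-3) _ Suc.prems(4,5)] Suc.prems(6,7) by simp
  show ?case
  proof (cases "j = k")
    case True
    thus ?thesis using step by simp
  next
    case False
    let ?L = "(\<lambda>v. S (v - w)) ` \<Lambda> \<inter> integer_lattice"
    have Sv: "S (v - w) = (T ^^ k) z" using Suc.prems(5) by simp
    have "tight ?L" by (rule tight_subtree[OF b' Suc.prems(1,3)])
    moreover have "S (v - w) \<in> ?L"
    proof (intro IntI)
      show "S (v - w) \<in> (\<lambda>v. S (v - w)) ` \<Lambda>" using Suc.prems(2) by (rule imageI)
      show "S (v - w) \<in> integer_lattice" unfolding Sv by (rule step)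
    qed
    moreover have "S (w - w) \<in> ?L" using Suc.prems(3) by (intro IntI imageI) auto
    moreover have "S (v - w) - S (w - w) = (T ^^ k) z" using Sv by simp
    ultimately show ?thesis using Suc.IH[of ?L "S (v - w)" "S (w - w)"] Suc.prems(4,6,7) False by simp
  qed
qed simp

lemma integral_chain:
  assumes b': "b = of_int (int p * b')" and t: "tight \<Lambda>"
  obtains z n r where "z \<in> Z0" "adm n r" "z $ 1 = of_int n / real p" "z $ 2 = of_int r / real p"
    "\<forall>j. 1 \<le> j \<and> j \<le> K \<longrightarrow> (T ^^ j) z \<in> integer_lattice"
proof -
  obtain v w z where vw: "v \<in> \<Lambda>" "w \<in> \<Lambda>" "z \<in> Z0" "v - w = (T ^^ Suc K) z"
    by (rule all_levels_occur[OF t, of "Suc K"]) auto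
  obtain n r where nr: "adm n r" "z $ 1 = of_int n / real p" "z $ 2 = of_int r / real p" by (rule Z0E[OF vw(3)])
  have "(T ^^ j) z \<in> integer_lattice" if "1 \<le> j" "j \<le> K" for j
    by (rule level_integral[OF b' t vw]) (use that in auto)
  thus ?thesis by (intro that[OF vw(3) nr]) blast
qed

text \<open>The second coordinate of the integral point \<open>T z\<close> is \<open>(c n + b r)/p\<close>, and \<open>b\<close> is a multiple of \<open>p\<close>.\<close>

lemma necessary_c:
  assumes b': "b = of_int (int p * b')" and t: "tight \<Lambda>" and eq: "\<beta> = b"
  obtains n N :: int where "\<not> int p dvd n" "c * of_int n = of_int (int p * N)"
proof -
  obtain z n r where z: "z \<in> Z0" "adm n r" "z $ 1 = of_int n / real p" "z $ 2 = of_int r / real p"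
    "\<forall>j. 1 \<le> j \<and> j \<le> 1 \<longrightarrow> (T ^^ j) z \<in> integer_lattice" by (rule integral_chain[OF b' t, of 1])
  have "T z \<in> integer_lattice" using z(5)[rule_format, of 1] by simp
  then obtain N :: int where "T z $ 2 = of_int N" by (auto simp: integer_lattice_iff elim: Ints_cases)
  hence "real p * T z $ 2 = of_int (int p * N)" by simp
  moreover have "real p * T z $ 2 = c * of_int n + \<beta> * of_int r" using z(3,4) p_pos by (simp add: field_simps)
  ultimately have "c * of_int n + b * of_int r = of_int (int p * N)" unfolding eq by simp
  hence "c * of_int n = of_int (int p * (N - b' * r))" unfolding b' by (simp add: algebra_simps)
  moreover have "\<not> int p dvd n" using z(2) by (simp add: adm_def)
  ultimately show ?thesis by (intro that)
qed

text \<open>Put \<open>\<kappa> = c / (b - \<beta>)\<close>. Multiplied by \<open>p\<close>, the second coordinate of \<open>T\<^sup>j z\<close> is \<open>s\<^sub>j = \<beta>\<^sup>j y + \<kappa> b\<^sup>j n\<close>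
  with \<open>y = r - \<kappa> n\<close>. This sequence satisfies a linear recursion of order two, and its consecutive Hankel
  determinants \<open>s\<^sub>j s\<^sub>j\<^sub>+\<^sub>2 - s\<^sub>j\<^sub>+\<^sub>1\<^sup>2\<close> have the ratio \<open>b \<beta>\<close>. Four integers \<open>s\<^sub>0, \<dots>, s\<^sub>3\<close> hence make \<open>\<beta>\<close>
  rational, unless the determinants vanish because \<open>y = 0\<close> or \<open>\<kappa> = 0\<close>.\<close>

lemma necessary_rational:
  assumes b': "b = of_int (int p * b')" and t: "tight \<Lambda>" and ne: "\<beta> \<noteq> b" and \<kappa>: "c = \<kappa> * (b - \<beta>)"
  shows "(\<exists>n r. adm n r \<and> \<kappa> = of_int r / of_int n) \<or> (\<kappa> \<in> \<rat> \<and> \<beta> \<in> \<rat>)"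
proof -
  obtain z n r where z: "z \<in> Z0" and ad: "adm n r" and z12: "z $ 1 = of_int n / real p" "z $ 2 = of_int r / real p"
    and lat: "\<forall>j. 1 \<le> j \<and> j \<le> 3 \<longrightarrow> (T ^^ j) z \<in> integer_lattice" by (rule integral_chain[OF b' t, of 3])
  define y where "y = of_int r - \<kappa> * of_int n"
  define s where "s j = \<beta> ^ j * y + \<kappa> * b ^ j * of_int n" for j
  have nr: "n \<noteq> 0" "r \<noteq> 0"
  proof -
    show "n \<noteq> 0" using ad by (auto simp: adm_def)
    have "int p dvd a2 * n" if "r = 0" using ad that by (simp add: adm_def)
    thus "r \<noteq> 0" using ad prime_int_p not_dvd_a by (auto simp: adm_def prime_dvd_mult_iff)
  qed
  have s: "real p * ((T ^^ j) z) $ 2 = s j" for j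
  proof (induction j)
    case 0
    show ?case using z12 p_pos by (simp add: s_def y_def)
  next
    case (Suc j)
    have f: "real p * ((T ^^ j) z) $ 1 = b ^ j * of_int n" unfolding Tn_fst z12 using p_pos by simp
    have "real p * ((T ^^ Suc j) z) $ 2 = c * (real p * ((T ^^ j) z) $ 1) + \<beta> * (real p * ((T ^^ j) z) $ 2)"
      by (simp add: algebra_simps)
    also have "\<dots> = c * (b ^ j * of_int n) + \<beta> * s j" by (simp only: f Suc)
    also have "\<dots> = (\<kappa> * (b - \<beta>)) * (b ^ j * of_int n) + \<beta> * s j" by (simp only: \<kappa>)
    also have "\<dots> = s (Suc j)" by (simp add: s_def algebra_simps)
    finally show ?case .
  qed
  have sI: "\<exists>N. s j = of_int (int p * N)" if j: "1 \<le> j" "j \<le> 3" for j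
  proof -
    obtain N :: int where "((T ^^ j) z) $ 2 = of_int N" using lat j by (auto simp: integer_lattice_iff elim: Ints_cases)
    thus ?thesis using s[of j] by (intro exI[of _ N]) simp
  qed
  have s0: "s 0 = of_int r" by (simp add: s_def y_def)
  obtain N1 N2 N3 where N: "s 1 = of_int (int p * N1)" "s 2 = of_int (int p * N2)" "s 3 = of_int (int p * N3)"
    using sI[of 1] sI[of 2] sI[of 3] by auto
  have b0: "b \<noteq> 0" using b by simp
  have bR: "b \<in> \<rat>" unfolding b' by simp
  have sR: "s 0 \<in> \<rat>" "s 1 \<in> \<rat>" "s 2 \<in> \<rat>" "s 3 \<in> \<rat>" unfolding s0 N by (simp_all only: Rats_of_int)
  have bR': "\<beta> \<in> \<rat> \<Longrightarrow> \<kappa> \<in> \<rat>"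
  proof -
    assume bt: "\<beta> \<in> \<rat>"
    have "s 1 = \<beta> * of_int r + \<kappa> * ((b - \<beta>) * of_int n)" by (simp add: s_def y_def algebra_simps)
    hence "\<kappa> = (s 1 - \<beta> * of_int r) / ((b - \<beta>) * of_int n)" using ne nr by (simp add: field_simps)
    also have "\<dots> \<in> \<rat>" using bt bR sR by (intro Rats_divide Rats_diff Rats_mult Rats_of_int)
    finally show ?thesis .
  qed
  consider "y = 0" | "y \<noteq> 0" "\<kappa> = 0" | "y \<noteq> 0" "\<kappa> \<noteq> 0" by blast
  thus ?thesis
  proof cases
    case 1
    hence "\<kappa> = of_int r / of_int n" using nr by (simp add: y_def field_simps)
    thus ?thesis using ad by blast
  next
    case 2
    hence "\<beta> = s 1 / of_int r" using nr by (simp add: s_def y_def)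
    also have "\<dots> \<in> \<rat>" using sR by (intro Rats_divide Rats_of_int)
    finally show ?thesis using bR' by blast
  next
    case 3
    have h1: "s 0 * s 2 - s 1 * s 1 = y * \<kappa> * of_int n * (b - \<beta>) * (b - \<beta>)"
      by (simp add: s_def algebra_simps power2_eq_square)
    have h2: "s 1 * s 3 - s 2 * s 2 = b * \<beta> * (s 0 * s 2 - s 1 * s 1)"
      by (simp add: s_def algebra_simps power2_eq_square power3_eq_cube)
    have "s 0 * s 2 - s 1 * s 1 \<noteq> 0" unfolding h1 using 3 nr ne by simp
    hence "\<beta> = (s 1 * s 3 - s 2 * s 2) / (b * (s 0 * s 2 - s 1 * s 1))" unfolding h2 using b0 by simp
    also have "\<dots> \<in> \<rat>" using sR bR by (intro Rats_divide Rats_diff Rats_mult)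
    finally show ?thesis using bR' by blast
  qed
qed

lemma rat_coprime:
  fixes x :: real
  assumes "x \<in> \<rat>"
  obtains h l :: int where "l > 0" "coprime h l" "x = of_int h / of_int l"
proof -
  obtain m n :: nat where mn: "n \<noteq> 0" "\<bar>x\<bar> = real m / real n" "coprime m n" by (rule Rats_abs_nat_div_natE[OF assms])
  show ?thesis
  proof (cases "x \<ge> 0")
    case True
    show ?thesis by (rule that[of "int n" "int m"]) (use mn True in auto)
  next
    case False
    show ?thesis by (rule that[of "int n" "- int m"]) (use mn False in auto)
  qed
qed

text \<open>If \<open>\<kappa> = s/t\<close> is not congruent to the slope of \<open>a\<close>, the functional \<open>t z\<^sub>2 - s z\<^sub>1\<close> sees every level: it
  takes values prime to \<open>p\<close> on the numerators of the zeros of the mask. With an integral \<open>T z\<close> this makes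
  the numerator of \<open>\<beta>\<close> divisible by \<open>p\<close>, and the argument that made \<open>b\<close> integral applies to \<open>\<beta>\<close>. If \<open>p\<close>
  divides \<open>t\<close>, then \<open>s\<close> is prime to \<open>p\<close>, and the integrality of \<open>T z\<close> turns \<open>t c = s (b - \<beta>)\<close> into
  divisibility of \<open>b - \<beta>\<close> by one more power of \<open>p\<close> than \<open>t\<close> contains.\<close>

lemma necessary_beta:
  assumes b': "b = of_int (int p * b')" and tight: "tight \<Lambda>" and ne: "\<beta> \<noteq> b"
    and \<kappa>: "c = of_int s / of_int t * (b - \<beta>)" and st: "t \<noteq> 0" "coprime s t" "\<not> int p dvd (t * a2 - s * a1)"
    and rat: "\<beta> \<in> \<rat>"
  shows "\<exists>\<beta>'. \<beta> = of_int (int p * \<beta>')"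
    and "t = int p ^ l * q \<Longrightarrow> \<not> int p dvd q \<Longrightarrow> \<exists>k. b - \<beta> = of_int (int p ^ (l + 1) * k)"
proof -
  define f where "f z = real_of_int (- s) * z $ 1 + of_int t * (z :: real^2) $ 2" for z
  have fT: "f (T z) = \<beta> * f z" for z
  proof -
    have tc: "of_int t * c = of_int s * (b - \<beta>)" using \<kappa> st(1) by simp
    have "f (T z) = - of_int s * b * z $ 1 + (of_int t * c) * z $ 1 + of_int t * \<beta> * z $ 2"
      by (simp add: f_def algebra_simps)
    also have "\<dots> = - of_int s * b * z $ 1 + (of_int s * (b - \<beta>)) * z $ 1 + of_int t * \<beta> * z $ 2" by (simp only: tc)
    also have "\<dots> = \<beta> * f z" by (simp add: f_def algebra_simps)
    finally show ?thesis .
  qed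
  have fTn: "f ((T ^^ k) z) = \<beta> ^ k * f z" for k z by (induction k) (simp_all add: fT)
  have fI: "f z \<in> \<int>" if "z \<in> integer_lattice" for z using that by (auto simp: f_def integer_lattice_iff)
  have unit: "\<not> int p dvd t * r - s * n" if ad: "adm n r" for n r
  proof
    assume "int p dvd t * r - s * n"
    hence "int p dvd a1 * (t * r - s * n) - t * (a1 * r - a2 * n)" using ad by (simp add: adm_def)
    moreover have "a1 * (t * r - s * n) - t * (a1 * r - a2 * n) = n * (t * a2 - s * a1)" by (simp add: algebra_simps)
    ultimately show False using ad st(3) prime_int_p by (simp add: adm_def prime_dvd_mult_iff)
  qed
  have fz: "real p * f z = of_int (t * r - s * n)" if "z $ 1 = of_int n / real p" "z $ 2 = of_int r / real p" for z n r
    using that p_pos by (simp add: f_def field_simps)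
  obtain u w :: nat where w0: "w \<noteq> 0" and bs: "\<bar>\<beta>\<bar> = real u / real w" and cop: "coprime u w"
    by (rule Rats_abs_nat_div_natE[OF rat])
  have \<beta>uw: "\<beta> = real u / real w" using bs \<beta> by simp
  have wb: "real w * \<beta> = real u" using \<beta>uw w0 by simp
  obtain z n r where "z \<in> Z0" and ad: "adm n r" and z12: "z $ 1 = of_int n / real p" "z $ 2 = of_int r / real p"
    and lat: "\<forall>j. 1 \<le> j \<and> j \<le> 1 \<longrightarrow> (T ^^ j) z \<in> integer_lattice" by (rule integral_chain[OF b' tight, of 1])
  have "T z \<in> integer_lattice" using lat[rule_format, of 1] by simp
  then obtain N :: int where N: "T z $ 2 = of_int N" by (auto simp: integer_lattice_iff elim: Ints_cases)
  have cn: "c * of_int n + \<beta> * of_int r = of_int (int p * N)"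
  proof -
    have "c * of_int n + \<beta> * of_int r = real p * T z $ 2" using z12 p_pos by (simp add: field_simps)
    thus ?thesis unfolding N by simp
  qed
  have main: "\<beta> * of_int (t * r - s * n) = of_int (int p * (t * N - s * b' * n))"
  proof -
    have tc: "of_int t * c = of_int s * (b - \<beta>)" using \<kappa> st(1) by simp
    have "of_int t * (c * of_int n + \<beta> * of_int r) = (of_int t * c) * of_int n + of_int t * \<beta> * of_int r"
      by (simp add: algebra_simps)
    also have "\<dots> = of_int s * (b - \<beta>) * of_int n + of_int t * \<beta> * of_int r" by (simp only: tc)
    finally have "\<beta> * of_int (t * r - s * n) = of_int t * of_int (int p * N) - of_int s * b * of_int n"
      unfolding cn by (simp add: algebra_simps)
    thus ?thesis unfolding b' by (simp add: algebra_simps)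
  qed
  have pu: "p dvd u"
  proof -
    have "real u * of_int (t * r - s * n) = real w * (\<beta> * of_int (t * r - s * n))" using wb by (simp add: mult.assoc[symmetric])
    also have "\<dots> = of_int (int p * (int w * (t * N - s * b' * n)))" unfolding main by simp
    finally have "of_int (int u * (t * r - s * n)) = (of_int (int p * (int w * (t * N - s * b' * n))) :: real)" by simp
    hence "int u * (t * r - s * n) = int p * (int w * (t * N - s * b' * n))" by (simp only: of_int_eq_iff)
    hence "int p dvd int u * (t * r - s * n)" by simp
    thus ?thesis using unit[OF ad] prime_int_p by (simp add: prime_dvd_mult_iff)
  qed
  have "w = 1"
  proof (rule ccontr)
    assume "w \<noteq> 1"
    show False
    proof (rule no_fast_gaps[OF tight f_def fT \<beta>uw \<beta>])
      show "2 \<le> w" using w0 \<open>w \<noteq> 1\<close> by simp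
      show "coprime u w" by (rule cop)
      show "f z \<in> \<int>" if "z \<in> integer_lattice" for z by (rule fI[OF that])
      show "1 / (real p * real w) > 0" using p_pos w0 by simp
      fix v x assume vx: "v \<in> \<Lambda>" "x \<in> \<Lambda>" "v \<noteq> x"
      obtain k z where kz: "k \<ge> 1" "z \<in> Z0" "v - x = (T ^^ k) z" by (rule tight_differenceE[OF tight vx])
      obtain n r where nr: "adm n r" "z $ 1 = of_int n / real p" "z $ 2 = of_int r / real p" by (rule Z0E[OF kz(2)])
      define Y where "Y = t * r - s * n"
      have Y0: "Y \<noteq> 0" using unit[OF nr(1)] unfolding Y_def by auto
      have fY: "real p * f z = of_int Y" unfolding Y_def by (rule fz[OF nr(2,3)])
      have "int w ^ (k - 1) dvd Y"
      proof (cases "k = 1")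
        case False
        have "(T ^^ (k - 1)) z \<in> integer_lattice"
          by (rule level_integral[OF b' tight vx(1,2) kz(2,3)]) (use False kz in auto)
        then obtain m :: int where m: "f ((T ^^ (k - 1)) z) = of_int m" using fI by (auto elim: Ints_cases)
        have "\<beta> ^ (k - 1) * of_int Y = real p * (\<beta> ^ (k - 1) * f z)" unfolding fY[symmetric] by simp
        also have "\<dots> = real p * of_int m" using m by (simp only: fTn)
        finally have "\<beta> ^ (k - 1) * of_int Y = of_int (int p * m)" by simp
        note bY = this
        have "real u ^ (k - 1) * of_int Y = real w ^ (k - 1) * (\<beta> ^ (k - 1) * of_int Y)"
          unfolding wb[symmetric] power_mult_distrib by simp
        also have "\<dots> = real w ^ (k - 1) * of_int (int p * m)" by (simp only: bY)
        finally have "of_int (int u ^ (k - 1) * Y) = (of_int (int w ^ (k - 1) * (int p * m)) :: real)"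
          by simp
        hence "int u ^ (k - 1) * Y = int w ^ (k - 1) * (int p * m)" by (simp only: of_int_eq_iff)
        hence "int w ^ (k - 1) dvd int u ^ (k - 1) * Y" by simp
        moreover have "coprime (int w ^ (k - 1)) (int u ^ (k - 1))" using cop by (simp add: coprime_commute)
        ultimately show ?thesis by (simp add: coprime_dvd_mult_right_iff)
      qed simp
      hence "int w ^ (k - 1) \<le> \<bar>Y\<bar>" using Y0 by (simp add: zdvd_imp_le)
      hence wY: "real w ^ (k - 1) \<le> \<bar>of_int Y\<bar>" by (metis of_int_abs of_int_le_iff of_int_of_nat_eq of_int_power)
      have "real u ^ k = real w ^ k * \<beta> ^ k" by (simp only: wb[symmetric] power_mult_distrib)
      also have "\<dots> = real w * (real w ^ (k - 1) * \<beta> ^ k)" using kz(1) by (simp add: power_Suc[symmetric] mult.assoc[symmetric] del: power_Suc)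
      also have "\<dots> \<le> real w * (\<bar>of_int Y\<bar> * \<beta> ^ k)" using wY \<beta> by (intro mult_left_mono mult_right_mono) auto
      also have "\<bar>of_int Y\<bar> * \<beta> ^ k = real p * \<bar>f (v - x)\<bar>"
        unfolding kz(3) fTn fY[symmetric] using \<beta> by (simp add: abs_mult)
      finally have "1 / (real p * real w) * real u ^ k \<le> \<bar>f (v - x)\<bar>" using p_pos w0 by (simp add: field_simps)
      thus "\<exists>k z. 1 \<le> k \<and> z \<in> Z0 \<and> v - x = (T ^^ k) z \<and> 1 / (real p * real w) * real u ^ k \<le> \<bar>f (v - x)\<bar>"
        using kz by blast
    qed
  qed
  obtain \<beta>' where "u = p * \<beta>'" using pu by blast
  hence bi: "\<beta> = of_int (int p * int \<beta>')" using \<beta>uw \<open>w = 1\<close> by simp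
  thus "\<exists>\<beta>'. \<beta> = of_int (int p * \<beta>')" by blast
  assume tl: "t = int p ^ l * q" and q: "\<not> int p dvd q"
  have bd: "b - \<beta> = of_int (int p * (b' - int \<beta>'))" unfolding b' bi by (simp add: algebra_simps)
  show "\<exists>k. b - \<beta> = of_int (int p ^ (l + 1) * k)"
  proof (cases "l = 0")
    case True
    thus ?thesis using bd by (intro exI[of _ "b' - int \<beta>'"]) simp
  next
    case False
    hence "int p dvd t" using tl by simp
    hence ps: "\<not> int p dvd s" using st(2) prime_int_p by (metis coprime_common_divisor not_prime_unit)
    have tc: "of_int t * c = of_int s * (b - \<beta>)" using \<kappa> st(1) by simp
    have "of_int s * (b - \<beta>) * of_int n = of_int t * c * of_int n" by (simp only: tc)
    also have "\<dots> = of_int t * ((c * of_int n + \<beta> * of_int r) - \<beta> * of_int r)" by (simp add: algebra_simps)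
    also have "\<dots> = of_int t * (of_int (int p * N) - \<beta> * of_int r)" by (simp only: cn)
    finally have eq: "of_int s * (b - \<beta>) * of_int n = of_int t * (of_int (int p * N) - \<beta> * of_int r)" .
    note eq1 = eq[unfolded bd]
    have "of_int (s * (int p * (b' - int \<beta>')) * n) = (of_int (t * (int p * N - int p * int \<beta>' * r)) :: real)"
      using eq1[unfolded bi] by simp
    hence "s * (int p * (b' - int \<beta>')) * n = t * (int p * N - int p * int \<beta>' * r)" by (simp only: of_int_eq_iff)
    also have "\<dots> = int p ^ (l + 1) * (q * (N - int \<beta>' * r))" unfolding tl by (simp add: algebra_simps)
    finally have e: "s * (int p * (b' - int \<beta>')) * n = int p ^ (l + 1) * (q * (N - int \<beta>' * r))" .
    have "(s * n) * (int p * (b' - int \<beta>')) = s * (int p * (b' - int \<beta>')) * n" by (simp only: mult_ac)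
    hence "int p ^ (l + 1) dvd (s * n) * (int p * (b' - int \<beta>'))" unfolding e by (metis dvd_triv_left)
    moreover have "coprime (int p ^ (l + 1)) (s * n)"
      using prime_int_p ps ad by (simp add: adm_def prime_imp_coprime)
    ultimately have "int p ^ (l + 1) dvd int p * (b' - int \<beta>')" by (simp add: coprime_dvd_mult_right_iff)
    then obtain k where "int p * (b' - int \<beta>') = int p ^ (l + 1) * k" by (rule dvdE)
    thus ?thesis unfolding bd by (intro exI[of _ k]) (simp only:)
  qed
qed

section \<open>Spectra on a line and in the plane\<close>

text \<open>\<open>(l, h)\<close> is an eigenvector of \<open>T\<close> for \<open>b\<close>. As it is a multiple of \<open>a\<close> modulo \<open>p\<close>, and not zero modulo \<open>p\<close>, its
  multiples by \<open>1/p\<close> represent all multiples of \<open>a/p\<close> modulo the integer lattice. So the construction can be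
  carried out on the line through it, where \<open>T\<close> is multiplication by the integer \<open>b\<close>. The zeros of \<open>\<phi>\<close> on
  the line are integer multiples of \<open>(l, h)\<close>, and those lie in the coset of \<open>0\<close>.\<close>

lemma spectral_on_line:
  assumes b': "b = of_int (int p * b')" and \<kappa>: "c = of_int h / of_int l * (b - \<beta>)"
    and hl: "l \<noteq> 0" "coprime h l" "int p dvd (l * a2 - h * a1)"
  shows "spectral_measure \<mu>"
proof -
  define e where "e x = (vector [of_int l * x, of_int h * x] :: real^2)" for x :: real
  have e_nth: "e x $ 1 = of_int l * x" "e x $ 2 = of_int h * x" for x by (simp_all add: e_def)
  have b0: "b \<noteq> 0" using b by simp
  have e_add: "e x + e y = e (x + y)" for x y by (rule vec2_eqI) (simp_all add: e_nth algebra_simps)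
  have Te: "T (e x) = e (b * x)" for x
  proof (rule vec2_eqI)
    have cl: "c * of_int l = of_int h * (b - \<beta>)" using \<kappa> hl(1) by simp
    have "T (e x) $ 2 = (c * of_int l) * x + \<beta> * of_int h * x" by (simp add: e_nth)
    also have "\<dots> = (of_int h * (b - \<beta>)) * x + \<beta> * of_int h * x" by (simp only: cl)
    also have "\<dots> = e (b * x) $ 2" by (simp add: e_nth algebra_simps)
    finally show "T (e x) $ 2 = e (b * x) $ 2" .
  qed (simp add: e_nth)
  have Se: "S (e x) = e (x / b)" for x using Te[of "x / b"] b0 by (metis S_T nonzero_mult_div_cancel_left times_divide_eq_right)
  have Sne: "(S ^^ k) (e x) = e (x / b ^ k)" for k x by (induction k) (simp_all add: Se mult.commute)
  have pl: "\<not> int p dvd l"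
  proof
    assume l: "int p dvd l"
    hence "int p dvd l * a2 - (l * a2 - h * a1)" using hl(3) by (meson dvd_diff dvd_mult2)
    hence "int p dvd h * a1" by simp
    hence "int p dvd h" using prime_int_p not_dvd_a by (simp add: prime_dvd_mult_iff)
    thus False using l hl(2) prime_int_p by (metis coprime_common_divisor not_prime_unit)
  qed
  obtain q g where qg: "q * l = 1 + int p * g" using inverse_mod_prime[OF prime_int_p pl] by blast
  define nn where "nn j = q * int j * a1" for j
  define W where "W j = e (of_int (nn j) / real p)" for j
  show ?thesis
  proof (rule spectral_from_lattice[where G = "range (\<lambda>k::int. e (of_int k))" and V = "range e" and W = W and K = "e ` {0..1}"])
    show "0 \<in> range (\<lambda>k::int. e (of_int k))"
      by (rule image_eqI[of _ _ 0]) (auto intro!: vec2_eqI simp: e_nth)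
    show "x + y \<in> range (\<lambda>k::int. e (of_int k))"
      if xy: "x \<in> range (\<lambda>k::int. e (of_int k))" "y \<in> range (\<lambda>k::int. e (of_int k))" for x y
    proof -
      obtain k l :: int where "x = e (of_int k)" "y = e (of_int l)" using xy by blast
      hence "x + y = e (of_int (k + l))" by (simp only: e_add of_int_add)
      thus ?thesis by blast
    qed
    show "range (\<lambda>k::int. e (of_int k)) \<subseteq> integer_lattice" by (auto simp: integer_lattice_iff e_nth)
    show "T x \<in> range (\<lambda>k::int. e (of_int k))" if xr: "x \<in> range (\<lambda>k::int. e (of_int k))" for x
    proof -
      obtain k :: int where k: "x = e (of_int k)" using xr by blast
      have "b * of_int k = of_int (int p * b' * k)" unfolding b' by simp
      hence "T x = e (of_int (int p * b' * k))" unfolding k Te by (simp only:)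
      thus ?thesis by blast
    qed
    show "W 0 = 0" by (rule vec2_eqI) (simp_all add: W_def nn_def e_nth)
    show "\<exists>k\<in>integer_lattice. W j = (real j / real p) *\<^sub>R a + k" if "j < p" for j
    proof -
      have d1: "l * nn j - int j * a1 = int p * (g * int j * a1)"
      proof -
        have "l * nn j = (q * l) * (int j * a1)" by (simp add: nn_def)
        thus ?thesis unfolding qg by (simp add: algebra_simps)
      qed
      have "l * (h * nn j - int j * a2) = h * (l * nn j - int j * a1) - int j * (l * a2 - h * a1)" by (simp add: algebra_simps)
      hence "int p dvd l * (h * nn j - int j * a2)" using d1 hl(3) by simp
      hence "int p dvd h * nn j - int j * a2" using pl prime_int_p by (simp add: prime_dvd_mult_iff)
      then obtain k2 where k2: "h * nn j - int j * a2 = int p * k2" by blast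
      have e1: "of_int l * of_int (nn j) - real j * of_int a1 = real p * of_int (g * int j * a1)"
        using arg_cong[OF d1, of real_of_int] by simp
      have e2: "of_int h * of_int (nn j) - real j * of_int a2 = real p * of_int k2"
        using arg_cong[OF k2, of real_of_int] by simp
      have "W j = (real j / real p) *\<^sub>R a + vector [of_int (g * int j * a1), of_int k2]"
      proof (rule vec2_eqI)
        show "W j $ 1 = ((real j / real p) *\<^sub>R a + vector [of_int (g * int j * a1), of_int k2]) $ 1"
          using e1 p_pos by (simp add: W_def e_nth a_nth field_simps)
        show "W j $ 2 = ((real j / real p) *\<^sub>R a + vector [of_int (g * int j * a1), of_int k2]) $ 2"
          using e2 p_pos by (simp add: W_def e_nth a_nth field_simps)
      qed
      moreover have "(vector [of_int (g * int j * a1), of_int k2] :: real^2) \<in> integer_lattice"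
        by (simp add: integer_lattice_iff)
      ultimately show ?thesis by blast
    qed
    show "T (W j) \<in> range (\<lambda>k::int. e (of_int k))" for j
    proof -
      have "b * (of_int (nn j) / real p) = of_int (b' * nn j)" unfolding b' using p_pos by simp
      hence "T (W j) = e (of_int (b' * nn j))" unfolding W_def Te by (simp only:)
      thus ?thesis by blast
    qed
    show "range (\<lambda>k::int. e (of_int k)) \<subseteq> range e" by blast
    show "W j \<in> range e" for j by (simp add: W_def)
    show "x + y \<in> range e" if "x \<in> range e" "y \<in> range e" for x y using that by (auto simp: e_add)
    show "S x \<in> range e" if "x \<in> range e" for x using that by (auto simp: Se)
    have "e = (\<lambda>x. x *\<^sub>R vector [of_int l, of_int h])" by (rule ext, rule vec2_eqI) (simp_all add: e_nth mult.commute)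
    hence "continuous_on {0..1} e" by (simp add: continuous_intros)
    thus "compact (e ` {0..1})" by (intro compact_continuous_image) auto
    show "e ` {0..1} \<subseteq> range e" by blast
    show "\<exists>g\<in>range (\<lambda>k::int. e (of_int k)). \<eta> + g \<in> e ` {0..1}" if er: "\<eta> \<in> range e" for \<eta>
    proof -
      obtain x where x: "\<eta> = e x" using er by blast
      have "x - of_int \<lfloor>x\<rfloor> \<in> {0..1}" by simp linarith
      moreover have "\<eta> + e (of_int (- \<lfloor>x\<rfloor>)) = e (x - of_int \<lfloor>x\<rfloor>)" unfolding x e_add by simp
      ultimately show ?thesis by blast
    qed
    show "\<exists>g\<in>range (\<lambda>k::int. e (of_int k)). \<phi> (\<eta> + g) \<noteq> 0" if er: "\<eta> \<in> range e" for \<eta>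
    proof -
      obtain x where x: "\<eta> = e x" using er by blast
      show ?thesis
      proof (cases "x \<in> \<int>")
        case True
        then obtain k :: int where "x = of_int k" by (auto elim: Ints_cases)
        hence "\<eta> + e (of_int (- k)) = e 0" unfolding x e_add by simp
        also have "e 0 = 0" by (rule vec2_eqI) (simp_all add: e_nth)
        finally have "\<phi> (\<eta> + e (of_int (- k))) \<noteq> 0" by simp
        thus ?thesis by blast
      next
        case False
        have "\<phi> \<eta> \<noteq> 0"
        proof
          assume "\<phi> \<eta> = 0"
          then obtain k z where kz: "k \<ge> 1" "z \<in> Z0" "\<eta> = (T ^^ k) z" by (rule phi_zeroE)
          have ze: "z = e (x / b ^ k)" using Sn_Tn[of k z] Sne[of k x] kz(3) x by simp
          obtain n r where nr: "adm n r" "z $ 1 = of_int n / real p" "z $ 2 = of_int r / real p" by (rule Z0E[OF kz(2)])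
          define v where "v = real p * (x / b ^ k)"
          have lv: "of_int l * v = of_int n" "of_int h * v = of_int r"
            using nr(2,3) p_pos unfolding ze e_nth v_def by (simp_all add: field_simps)
          obtain s t where "s * h + t * l = gcd h l" using bezout_int by blast
          hence st: "s * h + t * l = 1" using hl(2) by simp
          have "v = of_int (s * h + t * l) * v" unfolding st by simp
          also have "\<dots> = of_int s * (of_int h * v) + of_int t * (of_int l * v)" by (simp add: algebra_simps)
          also have "\<dots> = of_int (s * r + t * n)" unfolding lv by simp
          finally have v: "v = of_int (s * r + t * n)" .
          have "x = b ^ k * (v / real p)" using p_pos b0 by (simp add: v_def)
          also have "\<dots> = b ^ (k - 1) * (b / real p) * v"
          proof -
            have "b ^ k = b ^ (k - 1) * b" using kz(1) by (simp add: power_Suc2[symmetric] del: power_Suc)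
            thus ?thesis by simp
          qed
          also have "b / real p = of_int b'" unfolding b' using p_pos by simp
          also have "b ^ (k - 1) * of_int b' * v = of_int ((int p * b') ^ (k - 1) * b' * (s * r + t * n))"
            unfolding v b' by simp
          finally show False using False by (metis Ints_of_int)
        qed
        moreover have "\<eta> + e (of_int 0) = \<eta>" unfolding x e_add by simp
        ultimately show ?thesis by (metis rangeI)
      qed
    qed
  qed
qed

text \<open>Since \<open>u c\<close> is an integer divisible by \<open>p\<close>, and \<open>p\<close> does not divide \<open>u\<close>, the lattice of the integer points with first
  coordinate divisible by \<open>u\<close> is invariant under \<open>T\<close> and contains, up to the factor \<open>1/p\<close>, representatives of
  all multiples of \<open>a\<close>. If \<open>\<phi>\<close> vanished on a coset of it, then so it would on the coset of one of the \<open>p\<close>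
  preimages. Only one of them qualifies, as zeros have integral first coordinates and those of the
  preimages are incongruent. The whole weight then falls on this preimage, which is therefore integral
  (\<open>m_abs_1\<close>). After two such steps the coset is forced to contain \<open>0\<close>, but \<open>\<phi> 0 = 1\<close>.\<close>

lemma spectral_on_plane:
  assumes b': "b = of_int (int p * b')" and \<beta>': "\<beta> = of_int (int p * \<beta>')"
    and c: "c = of_int C / of_int u" "u > 0" "coprime C u" "int p dvd C"
  shows "spectral_measure \<mu>"
proof -
  define G where "G = {z :: real^2. (\<exists>x::int. z $ 1 = of_int (u * x)) \<and> z $ 2 \<in> \<int>}"
  obtain C' where C': "C = int p * C'" using c(4) by blast
  have uc: "of_int u * c = of_int C" using c(1,2) by simp
  have pu: "\<not> int p dvd u" using c(3,4) prime_int_p by (metis coprime_common_divisor not_prime_unit)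
  obtain q g where qg: "q * u = 1 + int p * g" using inverse_mod_prime[OF prime_int_p pu] by blast
  define xx where "xx j = q * int j * a1" for j
  define W where "W j = (vector [of_int (u * xx j) / real p, real j * of_int a2 / real p] :: real^2)" for j
  have W_nth: "W j $ 1 = of_int (u * xx j) / real p" "W j $ 2 = real j * of_int a2 / real p" for j by (simp_all add: W_def)
  have G0: "0 \<in> G" unfolding G_def by (auto intro: exI[of _ 0])
  have Gadd: "x + y \<in> G" if "x \<in> G" "y \<in> G" for x y
  proof -
    obtain k l :: int where "x $ 1 = of_int (u * k)" "y $ 1 = of_int (u * l)" using \<open>x \<in> G\<close> \<open>y \<in> G\<close> unfolding G_def by blast
    hence "(x + y) $ 1 = of_int (u * (k + l))" by (simp add: algebra_simps)
    moreover have "(x + y) $ 2 \<in> \<int>" using \<open>x \<in> G\<close> \<open>y \<in> G\<close> unfolding G_def by simp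
    ultimately show ?thesis unfolding G_def by blast
  qed
  have Gneg: "- x \<in> G" if "x \<in> G" for x
  proof -
    obtain k :: int where "x $ 1 = of_int (u * k)" using \<open>x \<in> G\<close> unfolding G_def by blast
    hence "(- x) $ 1 = of_int (u * (- k))" by simp
    moreover have "(- x) $ 2 \<in> \<int>" using \<open>x \<in> G\<close> unfolding G_def by simp
    ultimately show ?thesis unfolding G_def by blast
  qed
  have GL: "G \<subseteq> integer_lattice" by (auto simp: G_def integer_lattice_iff)
  have TG: "T x \<in> G" if x: "x \<in> G" for x
  proof -
    have x12: "\<exists>k. x $ 1 = of_int (u * k)" "x $ 2 \<in> \<int>" using x unfolding G_def by blast+
    obtain k where k: "x $ 1 = of_int (u * k)" using x12(1) by blast
    obtain l :: int where l: "x $ 2 = of_int l" using x12(2) by (rule Ints_cases)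
    note kl = k l
    have "T x $ 1 = b * of_int (u * k)" by (simp only: T_nth kl)
    also have "\<dots> = of_int (u * (int p * b' * k))" unfolding b' by simp
    finally have "T x $ 1 = of_int (u * (int p * b' * k))" .
    moreover have "T x $ 2 = of_int (C * k + int p * \<beta>' * l)"
    proof -
      have "T x $ 2 = (of_int u * c) * of_int k + \<beta> * of_int l" by (simp add: kl)
      also have "\<dots> = of_int (C * k + int p * \<beta>' * l)" unfolding uc \<beta>' by simp
      finally show ?thesis .
    qed
    ultimately show ?thesis unfolding G_def by (auto simp only: mem_Collect_eq Ints_of_int)
  qed
  have W_form: "\<exists>k\<in>integer_lattice. W j = (real j / real p) *\<^sub>R a + k" for j
  proof -
    have "u * xx j = (q * u) * (int j * a1)" by (simp add: xx_def)
    hence "u * xx j = int j * a1 + int p * (g * int j * a1)" unfolding qg by (simp add: algebra_simps)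
    hence e: "real_of_int (u * xx j) = real j * of_int a1 + real p * of_int (g * int j * a1)" by simp
    have "W j = (real j / real p) *\<^sub>R a + vector [of_int (g * int j * a1), 0]"
    proof (rule vec2_eqI)
      show "W j $ 1 = ((real j / real p) *\<^sub>R a + vector [of_int (g * int j * a1), 0]) $ 1"
        unfolding W_nth e using p_pos by (simp add: a_nth field_simps)
      show "W j $ 2 = ((real j / real p) *\<^sub>R a + vector [of_int (g * int j * a1), 0]) $ 2"
        unfolding W_nth by (simp add: a_nth)
    qed
    moreover have "(vector [of_int (g * int j * a1), 0] :: real^2) \<in> integer_lattice" by (simp add: integer_lattice_iff)
    ultimately show ?thesis by blast
  qed
  have TW: "T (W j) \<in> G" for j
  proof -
    have "T (W j) $ 1 = b * (of_int (u * xx j) / real p)" by (simp only: T_nth W_nth)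
    also have "\<dots> = of_int (u * (b' * xx j))" unfolding b' using p_pos by simp
    finally have "T (W j) $ 1 = of_int (u * (b' * xx j))" .
    moreover have "T (W j) $ 2 = of_int (C' * xx j + \<beta>' * int j * a2)"
    proof -
      have "T (W j) $ 2 = (of_int u * c) * of_int (xx j) / real p + \<beta> * (real j * of_int a2 / real p)"
        by (simp add: W_nth)
      also have "\<dots> = of_int (C' * xx j + \<beta>' * int j * a2)"
        unfolding uc C' \<beta>' using p_pos by (simp add: add_divide_distrib[symmetric] field_simps)
      finally show ?thesis .
    qed
    ultimately show ?thesis unfolding G_def by (auto simp only: mem_Collect_eq Ints_of_int)
  qed
  have zero_coords: "\<eta> $ 1 \<in> \<int> \<and> of_int u * \<eta> $ 2 \<in> \<int>" if phi0: "\<phi> \<eta> = 0" for \<eta>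
  proof -
    obtain k z where kz: "k \<ge> 1" "z \<in> Z0" "\<eta> = (T ^^ k) z" by (rule phi_zeroE[OF phi0])
    obtain n r where nr: "adm n r" "z $ 1 = of_int n / real p" "z $ 2 = of_int r / real p" by (rule Z0E[OF kz(2)])
    have "(T ^^ Suc k') z $ 1 \<in> \<int> \<and> of_int u * (T ^^ Suc k') z $ 2 \<in> \<int>" for k'
    proof (induction k')
      case 0
      have "T z $ 1 = b * (of_int n / real p)" by (simp only: T_nth nr)
      also have "\<dots> = of_int (b' * n)" unfolding b' using p_pos by simp
      finally have "T z $ 1 = of_int (b' * n)" .
      moreover have "of_int u * T z $ 2 = of_int (C' * n + u * (\<beta>' * r))"
      proof -
        have "of_int u * T z $ 2 = (of_int u * c) * (of_int n / real p) + of_int u * (\<beta> * (of_int r / real p))"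
          by (simp add: nr algebra_simps)
        also have "\<dots> = of_int (C' * n + u * (\<beta>' * r))" unfolding uc C' \<beta>' using p_pos by simp
        finally show ?thesis .
      qed
      ultimately show ?case by (simp only: funpow.simps comp_apply id_apply Ints_of_int simp_thms)
    next
      case (Suc k')
      define y where "y = (T ^^ Suc k') z"
      obtain k l :: int where kl: "y $ 1 = of_int k" "of_int u * y $ 2 = of_int l" using Suc unfolding y_def by (metis Ints_cases)
      have "T y $ 1 = b * of_int k" by (simp only: T_nth kl)
      also have "\<dots> = of_int (int p * b' * k)" unfolding b' by simp
      finally have "T y $ 1 = of_int (int p * b' * k)" .
      moreover have "of_int u * T y $ 2 = of_int (C * k + int p * \<beta>' * l)"
      proof -
        have "of_int u * T y $ 2 = (of_int u * c) * y $ 1 + \<beta> * (of_int u * y $ 2)" by (simp add: algebra_simps)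
        also have "\<dots> = of_int (C * k + int p * \<beta>' * l)" unfolding uc kl \<beta>' by simp
        finally show ?thesis .
      qed
      moreover have "(T ^^ Suc (Suc k')) z = T y" by (simp add: y_def)
      ultimately show ?case by (simp only: Ints_of_int simp_thms)
    qed
    moreover obtain k' where "k = Suc k'" using kz(1) by (cases k) auto
    ultimately show ?thesis using kz(3) by blast
  qed
  define bad where "bad \<eta> \<longleftrightarrow> (\<forall>g\<in>G. \<phi> (\<eta> + g) = 0)" for \<eta>
  \<comment> \<open>From a bad point exactly one branch is open, so the mask has modulus one on it.\<close>
  have bad_step: "\<exists>\<eta>'. bad \<eta>' \<and> \<eta>' \<in> integer_lattice \<and> T \<eta>' - \<eta> \<in> G" if bad: "bad \<eta>" for \<eta>
  proof -
    have mW: "m (S \<eta> + W j) = m (S \<eta> + (real j / real p) *\<^sub>R a)" for j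
    proof -
      obtain k where "k \<in> integer_lattice" "W j = (real j / real p) *\<^sub>R a + k" using W_form by blast
      thus ?thesis using m_periodic[of k "S \<eta> + (real j / real p) *\<^sub>R a"] by (simp add: add.assoc)
    qed
    have one: "(\<Sum>j<p. (cmod (m (S \<eta> + W j)))\<^sup>2) = 1" unfolding mW by (rule sum_m_translates)
    have open_bad: "bad (S \<eta> + W j)" if nz: "m (S \<eta> + W j) \<noteq> 0" for j
      unfolding bad_def
    proof
      fix g assume g: "g \<in> G"
      have "T (W j) + T g \<in> G" by (intro Gadd TW TG g)
      hence "\<phi> (\<eta> + (T (W j) + T g)) = 0" using bad unfolding bad_def by blast
      moreover have "S (\<eta> + (T (W j) + T g)) = S \<eta> + W j + g" by (simp add: S_add add.assoc)
      ultimately have "m (S \<eta> + W j + g) * \<phi> (S \<eta> + W j + g) = 0" by (metis phi_refine)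
      moreover have "m (S \<eta> + W j + g) = m (S \<eta> + W j)" using g GL by (intro m_periodic) auto
      ultimately show "\<phi> (S \<eta> + W j + g) = 0" using nz by simp
    qed
    have "\<exists>i<p. m (S \<eta> + W i) \<noteq> 0"
    proof (rule ccontr)
      assume "\<not> ?thesis"
      hence "(\<Sum>j<p. (cmod (m (S \<eta> + W j)))\<^sup>2) = 0" by simp
      thus False using one by simp
    qed
    then obtain i where i: "i < p" "m (S \<eta> + W i) \<noteq> 0" by blast
    have others: "m (S \<eta> + W j) = 0" if j: "j < p" "j \<noteq> i" for j
    proof (rule ccontr)
      assume nz: "m (S \<eta> + W j) \<noteq> 0"
      have I: "(S \<eta> + W j) $ 1 \<in> \<int>" if "m (S \<eta> + W j) \<noteq> 0" for j
      proof -
        have "\<phi> (S \<eta> + W j + 0) = 0" using open_bad[OF that] G0 unfolding bad_def by blast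
        hence "\<phi> (S \<eta> + W j) = 0" by simp
        thus ?thesis using zero_coords by blast
      qed
      have "(S \<eta> + W j) $ 1 - (S \<eta> + W i) $ 1 \<in> \<int>" by (intro Ints_diff I nz i(2))
      hence int: "(W j - W i) $ 1 \<in> \<int>" by simp
      obtain k l where "k \<in> integer_lattice" "W j = (real j / real p) *\<^sub>R a + k" "l \<in> integer_lattice" "W i = (real i / real p) *\<^sub>R a + l"
        using W_form by meson
      hence "W j - W i \<in> Z0" using Z0_translate_diff[OF j(1) i(1) j(2)] by simp
      then obtain n r where nr: "adm n r" "(W j - W i) $ 1 = of_int n / real p" "(W j - W i) $ 2 = of_int r / real p" by (rule Z0E)
      obtain N :: int where "(W j - W i) $ 1 = of_int N" using int by (auto elim: Ints_cases)
      hence "of_int n = real p * of_int N" using nr(2) p_pos by (simp add: field_simps)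
      hence "of_int n = (of_int (int p * N) :: real)" by simp
      hence "n = int p * N" by (simp only: of_int_eq_iff)
      thus False using nr(1) by (simp add: adm_def)
    qed
    have "(\<Sum>j<p. (cmod (m (S \<eta> + W j)))\<^sup>2) = (cmod (m (S \<eta> + W i)))\<^sup>2"
      using i others by (subst sum.remove[of _ i]) (auto intro: sum.neutral)
    hence "(cmod (m (S \<eta> + W i)))\<^sup>2 = 1" using one by simp
    hence "cmod (m (S \<eta> + W i)) = 1" by (simp add: power2_eq_1_iff) (metis norm_ge_zero neg_0_le_iff_le not_one_le_zero)
    hence "S \<eta> + W i \<in> integer_lattice" by (rule m_abs_1)
    moreover have "T (S \<eta> + W i) - \<eta> \<in> G" using TW by (simp add: T_add)
    ultimately show ?thesis using open_bad[OF i(2)] by blast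
  qed
  have never_bad: "\<not> bad \<eta>" for \<eta>
  proof
    assume "bad \<eta>"
    then obtain \<eta>1 where 1: "bad \<eta>1" "\<eta>1 \<in> integer_lattice" using bad_step by blast
    obtain \<eta>2 where 2: "bad \<eta>2" "\<eta>2 \<in> integer_lattice" "T \<eta>2 - \<eta>1 \<in> G" using bad_step[OF 1(1)] by blast
    have "(T \<eta>2 - \<eta>1) + \<eta>1 \<in> integer_lattice" using 1(2) 2(3) GL by (intro integer_lattice_add) auto
    hence TI: "T \<eta>2 $ 2 \<in> \<int>" by (simp add: integer_lattice_iff)
    obtain x y :: int where xy: "\<eta>2 $ 1 = of_int x" "\<eta>2 $ 2 = of_int y" using 2(2) by (auto simp: integer_lattice_iff elim!: Ints_cases)
    obtain N :: int where "T \<eta>2 $ 2 = of_int N" using TI by (auto elim: Ints_cases)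
    hence "of_int u * (c * of_int x + \<beta> * of_int y) = of_int (u * N)" by (simp add: xy)
    hence "(of_int u * c) * of_int x = of_int (u * N) - of_int u * (\<beta> * of_int y)" by (simp add: algebra_simps)
    hence "of_int (C * x) = (of_int (u * (N - int p * \<beta>' * y)) :: real)" unfolding uc \<beta>' by (simp add: algebra_simps)
    hence "C * x = u * (N - int p * \<beta>' * y)" by (simp only: of_int_eq_iff)
    hence "u dvd C * x" by simp
    hence "u dvd x" using c(3) by (simp add: coprime_dvd_mult_right_iff coprime_commute)
    hence "\<eta>2 \<in> G" unfolding G_def using xy by (auto simp: dvd_def)
    hence "\<phi> (\<eta>2 + - \<eta>2) = 0" using 2(1) Gneg unfolding bad_def by blast
    thus False by simp
  qed
  show ?thesis
  proof (rule spectral_from_lattice[where G = G and V = UNIV and W = W and K = "cbox 0 (vector [of_int u, 1])"])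
    show "W 0 = 0" by (rule vec2_eqI) (simp_all add: W_nth xx_def)
    show "\<exists>g\<in>G. \<eta> + g \<in> cbox 0 (vector [of_int u, 1])" for \<eta>
    proof -
      define k where "k = \<lfloor>\<eta> $ 1 / of_int u\<rfloor>"
      define g where "g = (vector [of_int (u * (- k)), of_int (- \<lfloor>\<eta> $ 2\<rfloor>)] :: real^2)"
      have "of_int k \<le> \<eta> $ 1 / of_int u" "\<eta> $ 1 / of_int u \<le> of_int k + 1" unfolding k_def by linarith+
      hence "of_int u * of_int k \<le> \<eta> $ 1" "\<eta> $ 1 \<le> of_int u * of_int k + of_int u"
        using c(2) by (simp_all add: field_simps)
      moreover have "of_int \<lfloor>\<eta> $ 2\<rfloor> \<le> \<eta> $ 2" "\<eta> $ 2 \<le> of_int \<lfloor>\<eta> $ 2\<rfloor> + 1" by linarith+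
      ultimately have "\<eta> + g \<in> cbox 0 (vector [of_int u, 1])"
        by (simp add: mem_box_cart forall_2 g_def) linarith
      moreover have "g $ 1 = of_int (u * (- k))" "g $ 2 \<in> \<int>" by (simp_all add: g_def)
      hence "g \<in> G" unfolding G_def by blast
      ultimately show ?thesis by blast
    qed
    show "\<exists>g\<in>G. \<phi> (\<eta> + g) \<noteq> 0" for \<eta> using never_bad[of \<eta>] by (auto simp: bad_def)
  qed (use G0 Gadd GL TG W_form TW in auto)
qed

section \<open>The characterization\<close>

lemma multiples_iff: "x \<in> multiples N \<longleftrightarrow> (\<exists>k. x = of_int (int N * k))"
  by (auto simp: multiples_def image_iff)

text \<open>The definition speaks of some fraction that represents the number. In lowest terms it is unique up to
  sign, and the exceptional element \<open>0 = 0/1\<close> satisfies the condition because \<open>p\<close> does not divide the second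
  entry of \<open>a\<close>.\<close>

lemma E_set_iff:
  assumes st: "t \<noteq> 0" "coprime s t"
  shows "of_int s / of_int t \<in> E_set p a \<longleftrightarrow> \<not> int p dvd (t * a2 - s * a1)"
proof -
  have val: "of_int l * a $ 2 - of_int h * a $ 1 \<in> \<int> - multiples p \<longleftrightarrow> \<not> int p dvd (l * a2 - h * a1)" for h l
  proof -
    have "of_int l * a $ 2 - of_int h * a $ 1 = of_int (l * a2 - h * a1)" by (simp add: a_nth)
    thus ?thesis by (simp only: multiples_iff of_int_eq_iff Diff_iff Ints_of_int simp_thms dvd_def)
  qed
  show ?thesis
  proof
    assume E: "of_int s / of_int t \<in> E_set p a"
    show "\<not> int p dvd (t * a2 - s * a1)"
    proof
      assume d: "int p dvd (t * a2 - s * a1)"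
      have pt: "\<not> int p dvd t"
      proof
        assume "int p dvd t"
        moreover have "int p dvd t * a2 - (t * a2 - s * a1)" using calculation d by (meson dvd_diff dvd_mult2)
        hence "int p dvd s * a1" by simp
        hence "int p dvd s" using prime_int_p not_dvd_a by (simp add: prime_dvd_mult_iff)
        ultimately show False using st(2) prime_int_p by (metis coprime_common_divisor not_prime_unit)
      qed
      from E consider "of_int s / of_int t = (0 :: real)"
        | h l :: int where "of_int s / of_int t = (of_int h / of_int l :: real)" "l \<noteq> 0" "\<not> int p dvd (l * a2 - h * a1)"
        unfolding E_set_def val by blast
      thus False
      proof cases
        case 1
        hence "s = 0" using st(1) by simp
        thus False using d pt prime_int_p not_dvd_a by (simp add: prime_dvd_mult_iff)
      next
        case 2
        have "of_int (s * l) = (of_int (h * t) :: real)" using 2(1,2) st(1) by (simp add: field_simps)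
        hence e: "s * l = h * t" by (simp only: of_int_eq_iff)
        have "t * (l * a2 - h * a1) = l * (t * a2) - (h * t) * a1" by (simp add: algebra_simps)
        also have "\<dots> = l * (t * a2 - s * a1)" unfolding e[symmetric] by (simp add: algebra_simps)
        finally have "int p dvd t * (l * a2 - h * a1)" using d by simp
        thus False using pt 2(3) prime_int_p by (simp add: prime_dvd_mult_iff)
      qed
    qed
  next
    assume "\<not> int p dvd (t * a2 - s * a1)"
    thus "of_int s / of_int t \<in> E_set p a" unfolding E_set_def val using st by blast
  qed
qed

lemma fraction_lowest_terms:
  assumes "c * of_int Y = of_int (int p * X)" "\<not> int p dvd Y"
  obtains C u where "u > 0" "coprime C u" "int p dvd C" "c = of_int C / of_int u"
proof -
  have Y0: "Y \<noteq> 0" using assms(2) by auto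
  have "c = of_int (int p * X) / of_int Y" using assms(1) Y0 by (simp add: field_simps)
  hence "c \<in> \<rat>" by simp
  then obtain C u :: int where Cu: "u > 0" "coprime C u" "c = of_int C / of_int u" by (rule rat_coprime)
  have "of_int (C * Y) = (of_int (int p * X * u) :: real)" using assms(1) Cu(1,3) by (simp add: field_simps)
  hence "C * Y = int p * (X * u)" by (simp only: of_int_eq_iff mult.assoc)
  hence "int p dvd C * Y" by simp
  hence "int p dvd C" using assms(2) prime_int_p by (simp add: prime_dvd_mult_iff)
  thus ?thesis using Cu by (intro that)
qed

lemma spectral_iff_equal:
  assumes eq: "\<beta> = b"
  shows "spectral_measure \<mu> \<longleftrightarrow> b \<in> multiples p \<and>
    c \<in> {of_int t / of_int s | s t :: int. s \<noteq> 0 \<and> int p dvd t \<and> coprime s t} \<union> {0}"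
proof
  assume "spectral_measure \<mu>"
  then obtain \<Lambda> where t: "tight \<Lambda>" using spectral_imp_tight by blast
  obtain b' where b': "b = of_int (int p * b')" by (rule b_multiple_of_p[OF t])
  obtain n N :: int where n: "\<not> int p dvd n" "c * of_int n = of_int (int p * N)" by (rule necessary_c[OF b' t eq])
  obtain C u where Cu: "u > 0" "coprime C u" "int p dvd C" "c = of_int C / of_int u"
    by (rule fraction_lowest_terms[OF n(2,1)])
  have "u \<noteq> 0 \<and> int p dvd C \<and> coprime u C" using Cu by (simp add: coprime_commute)
  hence "c \<in> {of_int t / of_int s | s t :: int. s \<noteq> 0 \<and> int p dvd t \<and> coprime s t}" using Cu(4) by blast
  thus "b \<in> multiples p \<and> c \<in> {of_int t / of_int s | s t :: int. s \<noteq> 0 \<and> int p dvd t \<and> coprime s t} \<union> {0}"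
    using b' multiples_iff by blast
next
  assume r: "b \<in> multiples p \<and> c \<in> {of_int t / of_int s | s t :: int. s \<noteq> 0 \<and> int p dvd t \<and> coprime s t} \<union> {0}"
  then obtain b' where b': "b = of_int (int p * b')" using multiples_iff by blast
  hence \<beta>': "\<beta> = of_int (int p * b')" using eq by simp
  from r consider "c = 0" | s t :: int where "c = of_int t / of_int s" "s \<noteq> 0" "int p dvd t" "coprime s t" by blast
  hence "\<exists>X Y. c * of_int Y = of_int (int p * X) \<and> \<not> int p dvd Y"
  proof cases
    case 1
    have "c * of_int 1 = of_int (int p * 0) \<and> \<not> int p dvd 1" using 1 prime_gt_1_nat[OF prime_p] by simp
    thus ?thesis by blast
  next
    case 2
    obtain X where X: "t = int p * X" using 2(3) by blast
    have "c * of_int s = of_int (int p * X)" using 2(1,2) unfolding X by simp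
    moreover have "\<not> int p dvd s" using 2(3,4) prime_int_p by (metis coprime_common_divisor not_prime_unit)
    ultimately show ?thesis by blast
  qed
  then obtain X Y where "c * of_int Y = of_int (int p * X)" "\<not> int p dvd Y" by blast
  then obtain C u where Cu: "u > 0" "coprime C u" "int p dvd C" "c = of_int C / of_int u" by (rule fraction_lowest_terms)
  show "spectral_measure \<mu>" by (rule spectral_on_plane[OF b' \<beta>' Cu(4,1,2,3)])
qed

text \<open>If \<open>\<kappa>\<close> is in \<open>E\<close>, it is not the slope \<open>r/n\<close> of a multiple of \<open>a\<close> modulo \<open>p\<close>, so \<open>\<beta>\<close> is rational and
  must be a multiple of \<open>p\<close>. Conversely, for \<open>\<kappa> = s/t\<close> with \<open>t = p\<^sup>l u\<close> the divisibility of \<open>b - \<beta>\<close> by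
  \<open>p\<^sup>l\<^sup>+\<^sup>1\<close> cancels the factor \<open>p\<^sup>l\<close> of the denominator of \<open>c\<close> and leaves a factor \<open>p\<close> in the numerator.\<close>

lemma spectral_iff_distinct:
  assumes ne: "\<beta> \<noteq> b" and \<kappa>: "\<kappa> = c / (b - \<beta>)"
  shows "spectral_measure \<mu> \<longleftrightarrow> (b \<in> multiples p \<and> \<kappa> \<in> \<rat> - E_set p a) \<or>
     (b \<in> multiples p \<and> \<beta> \<in> multiples p \<and>
        (\<exists>s t :: int. t \<noteq> 0 \<and> \<kappa> = of_int s / of_int t \<and> \<kappa> \<in> E_set p a \<and> coprime s t \<and>
          (\<exists>l :: nat. (\<exists>u :: int. \<not> int p dvd u \<and> t = int p ^ l * u) \<and>
             b - \<beta> \<in> multiples (p ^ (l + 1)))))"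
    (is "_ \<longleftrightarrow> ?i \<or> ?ii")
proof -
  have c: "c = \<kappa> * (b - \<beta>)" using \<kappa> ne by simp
  show ?thesis
  proof
    assume "spectral_measure \<mu>"
    then obtain \<Lambda> where t: "tight \<Lambda>" using spectral_imp_tight by blast
    obtain b' where b': "b = of_int (int p * b')" by (rule b_multiple_of_p[OF t])
    have bm: "b \<in> multiples p" using b' multiples_iff by blast
    have rat: "(\<exists>n r. adm n r \<and> \<kappa> = of_int r / of_int n) \<or> (\<kappa> \<in> \<rat> \<and> \<beta> \<in> \<rat>)"
      by (rule necessary_rational[OF b' t ne c])
    hence "\<kappa> \<in> \<rat>" by auto
    then obtain s t' :: int where st: "t' > 0" "coprime s t'" "\<kappa> = of_int s / of_int t'" by (rule rat_coprime)
    show "?i \<or> ?ii"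
    proof (cases "\<kappa> \<in> E_set p a")
      case False
      thus ?thesis using bm \<open>\<kappa> \<in> \<rat>\<close> by blast
    next
      case True
      have ndvd: "\<not> int p dvd (t' * a2 - s * a1)" using True E_set_iff[of t' s] st by simp
      have "\<beta> \<in> \<rat>"
      proof (rule ccontr)
        assume "\<beta> \<notin> \<rat>"
        then obtain n r where nr: "adm n r" "\<kappa> = of_int r / of_int n" using rat by blast
        have n: "\<not> int p dvd n" "int p dvd a1 * r - a2 * n" using nr(1) by (simp_all add: adm_def)
        have n0: "n \<noteq> 0" using n(1) by auto
        have "of_int (s * n) = (of_int (r * t') :: real)" using nr(2) st(1,3) n0 by (simp add: field_simps)
        hence e: "s * n = r * t'" by (simp only: of_int_eq_iff)
        have "n * (t' * a2 - s * a1) = n * t' * a2 - (s * n) * a1" by (simp add: algebra_simps)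
        also have "\<dots> = - t' * (a1 * r - a2 * n)" unfolding e by (simp add: algebra_simps)
        finally have "n * (t' * a2 - s * a1) = - t' * (a1 * r - a2 * n)" .
        hence "int p dvd n * (t' * a2 - s * a1)" using n(2) by simp
        thus False using n(1) ndvd prime_int_p by (simp add: prime_dvd_mult_iff)
      qed
      have t0: "t' \<noteq> 0" using st(1) by simp
      have c': "c = of_int s / of_int t' * (b - \<beta>)" using c st(3) by simp
      note nb = necessary_beta[OF b' t ne c' t0 st(2) ndvd \<open>\<beta> \<in> \<rat>\<close>]
      have "\<not> is_unit (int p)" using prime_int_p by auto
      then obtain u where u: "t' = int p ^ multiplicity (int p) t' * u" "\<not> int p dvd u"
        using multiplicity_decompose'[of t' "int p"] t0 by metis
      have "\<exists>k. b - \<beta> = of_int (int p ^ (multiplicity (int p) t' + 1) * k)" by (rule nb(2)[OF u])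
      hence m: "b - \<beta> \<in> multiples (p ^ (multiplicity (int p) t' + 1))" unfolding multiples_iff by simp
      have "\<beta> \<in> multiples p" unfolding multiples_iff by (rule nb(1))
      thus ?thesis using bm t0 st(2,3) True u m by blast
    qed
  next
    assume "?i \<or> ?ii"
    thus "spectral_measure \<mu>"
    proof
      assume i: ?i
      then obtain b' where b': "b = of_int (int p * b')" using multiples_iff by blast
      obtain h l :: int where hl: "l > 0" "coprime h l" "\<kappa> = of_int h / of_int l" using i by (blast intro: rat_coprime)
      have l0: "l \<noteq> 0" using hl(1) by simp
      have "int p dvd (l * a2 - h * a1)" using i E_set_iff[OF l0 hl(2)] hl(3) by simp
      moreover have "c = of_int h / of_int l * (b - \<beta>)" using c hl(3) by simp
      ultimately show ?thesis by (intro spectral_on_line[OF b' _ l0 hl(2)])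
    next
      assume ii: ?ii
      then obtain b' where b': "b = of_int (int p * b')" using multiples_iff by blast
      obtain \<beta>' where \<beta>': "\<beta> = of_int (int p * \<beta>')" using ii multiples_iff by blast
      obtain s t u :: int and l :: nat where st: "t \<noteq> 0" "\<kappa> = of_int s / of_int t"
        and u: "\<not> int p dvd u" "t = int p ^ l * u" and m: "b - \<beta> \<in> multiples (p ^ (l + 1))" using ii by blast
      obtain k where k: "b - \<beta> = of_int (int p ^ (l + 1) * k)" using m by (auto simp: multiples_iff)
      have "c * of_int t = of_int s * (b - \<beta>)" using c st by simp
      also have "\<dots> = of_int (int p ^ l) * of_int (int p * (s * k))" unfolding k by simp
      finally have "of_int (int p ^ l) * (c * of_int u) = of_int (int p ^ l) * of_int (int p * (s * k))"
        unfolding u(2) by simp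
      moreover have "(of_int (int p ^ l) :: real) \<noteq> 0" using p_pos by simp
      ultimately have "c * of_int u = of_int (int p * (s * k))" by (simp only: mult_left_cancel[of "of_int (int p ^ l) :: real"] simp_thms)
      then obtain C q where Cu: "q > 0" "coprime C q" "int p dvd C" "c = of_int C / of_int q"
        using u(1) by (rule fraction_lowest_terms)
      show ?thesis by (rule spectral_on_plane[OF b' \<beta>' Cu(4,1,2,3)])
    qed
  qed
qed

end

theorem theorem1p7:
  fixes p :: nat and \<rho>1 \<rho>2 c c'' d11 :: real and M :: "real^2^2"
    and d :: "nat \<Rightarrow> real^2" and D :: "(real^2) set" and a :: "real^2"
    and \<mu> :: "(real^2) measure"
  assumes "prime p"
    and "\<rho>1 \<in> {0<..<1}" and "\<rho>2 \<in> {0<..<1}"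
    and "M = upper_triangular \<rho>1 \<rho>2 c"
    and "D = d ` {..<p}" and "inj_on d {..<p}" and "D \<subseteq> integer_lattice"
    and "d 0 = 0" and "d 1 = vector [d11, 0]" and "d11 \<noteq> 0"
    and "a \<in> calE p"
    and "zero_set (fourier_transform (mean_dirac D)) =
           (\<Union>j\<in>{1..p-1}. (\<lambda>k. (real j / real p) *\<^sub>R a + k) ` integer_lattice)"
    and "self_affine_measure M D \<mu>"
    and "\<rho>1 \<noteq> \<rho>2 \<Longrightarrow> c'' = c / (inverse \<rho>1 - inverse \<rho>2)"
  shows "spectral_measure \<mu> \<longleftrightarrow>
      (\<rho>1 \<noteq> \<rho>2 \<and> inverse \<rho>1 \<in> multiples p \<and> c'' \<in> \<rat> - E_set p a)
    \<or> (\<rho>1 \<noteq> \<rho>2 \<and> inverse \<rho>1 \<in> multiples p \<and> inverse \<rho>2 \<in> multiples p \<and>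
        (\<exists>s t :: int. t \<noteq> 0 \<and> c'' = of_int s / of_int t \<and> c'' \<in> E_set p a \<and> coprime s t \<and>
          (\<exists>l :: nat. (\<exists>u :: int. \<not> int p dvd u \<and> t = int p ^ l * u) \<and>
             inverse \<rho>1 - inverse \<rho>2 \<in> multiples (p ^ (l + 1)))))
    \<or> (\<rho>1 = \<rho>2 \<and> inverse \<rho>1 \<in> multiples p \<and>
        c \<in> {of_int t / of_int s | s t :: int. s \<noteq> 0 \<and> int p dvd t \<and> coprime s t} \<union> {0})"
proof -
  have card: "card D = p" unfolding \<open>D = d ` {..<p}\<close> using \<open>inj_on d {..<p}\<close> by (simp add: card_image)
  have "0 < p" using \<open>prime p\<close> by (rule prime_gt_0_nat)
  hence D0: "0 \<in> D" unfolding \<open>D = d ` {..<p}\<close> using \<open>d 0 = 0\<close> by (metis image_eqI lessThan_iff)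
  interpret self_affine_system p a D "inverse \<rho>1" "inverse \<rho>2" c \<mu>
  proof
    show "finite D" using \<open>D = d ` {..<p}\<close> by simp
    show "inverse \<rho>1 > 1" "inverse \<rho>2 > 1" using \<open>\<rho>1 \<in> {0<..<1}\<close> \<open>\<rho>2 \<in> {0<..<1}\<close> by (simp_all add: one_less_inverse)
    show "self_affine_measure (upper_triangular (inverse (inverse \<rho>1)) (inverse (inverse \<rho>2)) c) D \<mu>"
      using \<open>self_affine_measure M D \<mu>\<close> \<open>M = upper_triangular \<rho>1 \<rho>2 c\<close> by simp
  qed (use assms(1,7,11,12) card D0 in simp_all)
  show ?thesis
  proof (cases "\<rho>1 = \<rho>2")
    case True
    thus ?thesis using spectral_iff_equal by simp
  next
    case False
    hence ne: "inverse \<rho>2 \<noteq> inverse \<rho>1" by simp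
    show ?thesis using spectral_iff_distinct[OF ne assms(14)[OF False]] False by simp
  qed
qed

end
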